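(* Let $n\ge1$, $s\in\mathbb{R}$, $0<q<\infty$ and let $w$ be an admissible weight. The space $F^{s,w}_{\infty,q}(\mathbb{R}^n)$ is independent of the resolution of unity chosen to define $\|\cdot\|_{F^{s,w}_{\infty,q}(\mathbb{R}^n)}$, in the sense that different choices give equivalent quasi-norms: if $\{\varphi_j\}_{j\ge0}$ and $\{\psi_j\}_{j\ge0}$ are two resolutions of unity, then there are constants $c,C>0$ such that $c\|f\|^{\psi}\le\|f\|^{\varphi}\le C\|f\|^{\psi}$ for all tempered distributions $f$ on $\mathbb{R}^n$, where $\|f\|^{\varphi}$ and $\|f\|^{\psi}$ (with values in $[0,\infty]$) denote $\|f\|_{F^{s,w}_{\infty,q}(\mathbb{R}^n)}$ computed with $\{\varphi_j\}_{j\ge0}$ and $\{\psi_j\}_{j\ge0}$ respectively.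
   Context: Admissible weights: a monotonic function $w:(0,1]\to(0,\infty)$, extended to $(0,\infty)$ by $w(t)=w(1)$ for $t\ge1$, is admissible if there are $c,d>0$ with $c\,w(2^{-j})\le w(2^{-2j})\le d\,w(2^{-j})$ for all $j\in\mathbb{N}$. Resolution of unity: a family $\{\varphi_j\}_{j\ge0}$ obtained from a nonnegative radially decreasing Schwartz function $\varphi_0$ supported in $\{|\xi|\le3/2\}$ and identically one on $\{|\xi|\le1\}$ by $\varphi(\xi)=\varphi_0(\xi)-\varphi_0(2\xi)$ and $\varphi_j(\xi)=\varphi(2^{-j}\xi)$ for $j\ge1$. For a symbol $a$, $a(D)f$ is the inverse Fourier transform of $a(\xi)\widehat f(\xi)$, with $\widehat f(\xi)=\int_{\mathbb{R}^n} f(x)e^{-ix\xi}\,dx$. For $0<q<\infty$, $F^{s,w}_{\infty,q}(\mathbb{R}^n)$ is the set of tempered distributions $f$ for which $$\|f\|_{F^{s,w}_{\infty,q}(\mathbb{R}^n)}:=\|\varphi_0(D)f\|_\infty+\sup_{Q}\Big(\frac1{|Q|}\int_Q\sum_{j=-\log_2\ell(Q)}^\infty2^{sjq}w(2^{-j})^q|\varphi_j(D)f(x)|^q\,dx\Big)^{1/q}$$ is finite, where the supremum is over all dyadic cubes $Q$ in $\mathbb{R}^n$ with side length $\ell(Q)\le1$. *)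

theory Defs
  imports "HOL-Probability.Essential_Supremum"
begin

section \<open>Schwartz functions and tempered distributions\<close>

definition partial_deriv :: "'n::finite \<Rightarrow> (real^'n \<Rightarrow> 'b::real_normed_vector) \<Rightarrow> real^'n \<Rightarrow> 'b" where
  "partial_deriv i f x = vector_derivative (\<lambda>t. f (x + t *\<^sub>R axis i 1)) (at 0)"

text \<open>A multi-index is given as the list of the coordinates in which one differentiates, so
  \<open>length is\<close> is the order of the derivative.\<close>

primrec iter_partial :: "'n::finite list \<Rightarrow> (real^'n \<Rightarrow> 'b::real_normed_vector) \<Rightarrow> real^'n \<Rightarrow> 'b" where
  "iter_partial [] f = f"
| "iter_partial (i # is) f = partial_deriv i (iter_partial is f)"

definition schwartz :: "(real^'n::finite \<Rightarrow> 'b::real_normed_vector) \<Rightarrow> bool" where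
  "schwartz f \<longleftrightarrow>
     (\<forall>is x. iter_partial is f differentiable (at x)) \<and>
     (\<forall>is N. bounded (range (\<lambda>x. (1 + norm x) ^ N *\<^sub>R iter_partial is f x)))"

definition schwartz_seminorm :: "nat \<Rightarrow> (real^'n::finite \<Rightarrow> complex) \<Rightarrow> real" where
  "schwartz_seminorm N f =
     (SUP (is, x) \<in> {is. length is \<le> N} \<times> UNIV. (1 + norm x) ^ N * norm (iter_partial is f x))"

text \<open>A distribution is a functional on all functions of which only the values on Schwartz
  functions are meaningful; its values elsewhere are arbitrary and are never used.\<close>

type_synonym 'n functional = "(real^'n \<Rightarrow> complex) \<Rightarrow> complex"

definition tempered_distribution :: "'n::finite functional \<Rightarrow> bool" where
  "tempered_distribution T \<longleftrightarrow>
     (\<forall>f g. schwartz f \<longrightarrow> schwartz g \<longrightarrow> T (\<lambda>x. f x + g x) = T f + T g) \<and>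
     (\<forall>a f. schwartz f \<longrightarrow> T (\<lambda>x. a * f x) = a * T f) \<and>
     (\<exists>N C. \<forall>f. schwartz f \<longrightarrow> norm (T f) \<le> C * schwartz_seminorm N f)"

section \<open>Fourier transform and Fourier multipliers\<close>

definition fourier :: "(real^'n::finite \<Rightarrow> complex) \<Rightarrow> real^'n \<Rightarrow> complex" where
  "fourier f \<xi> = (LINT x|lborel. f x * exp (- \<i> * complex_of_real (x \<bullet> \<xi>)))"

definition inv_fourier :: "(real^'n::finite \<Rightarrow> complex) \<Rightarrow> real^'n \<Rightarrow> complex" where
  "inv_fourier f x = 1 / (2 * pi) ^ CARD('n) * (LINT \<xi>|lborel. f \<xi> * exp (\<i> * complex_of_real (x \<bullet> \<xi>)))"

text \<open>The corresponding operations on tempered distributions, by duality.\<close>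

definition fourier_dist :: "'n::finite functional \<Rightarrow> 'n functional" where
  "fourier_dist T = (\<lambda>g. T (fourier g))"

definition inv_fourier_dist :: "'n::finite functional \<Rightarrow> 'n functional" where
  "inv_fourier_dist T = (\<lambda>g. T (inv_fourier g))"

definition mult_dist :: "(real^'n::finite \<Rightarrow> real) \<Rightarrow> 'n functional \<Rightarrow> 'n functional" where
  "mult_dist a T = (\<lambda>g. T (\<lambda>\<xi>. complex_of_real (a \<xi>) * g \<xi>))"

definition multiplier :: "(real^'n::finite \<Rightarrow> real) \<Rightarrow> 'n functional \<Rightarrow> 'n functional" where
  "multiplier a T = inv_fourier_dist (mult_dist a (fourier_dist T))"

definition represents :: "(real^'n::finite \<Rightarrow> complex) \<Rightarrow> 'n functional \<Rightarrow> bool" where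
  "represents u T \<longleftrightarrow>
     (\<forall>g. schwartz g \<longrightarrow> integrable lborel (\<lambda>x. u x * g x) \<and> T g = (LINT x|lborel. u x * g x))"

text \<open>The continuous function with which a distribution is identified. It is unique if it exists.
  For \<open>multiplier a T\<close> with \<open>T\<close> tempered and \<open>a\<close> smooth of compact support it exists by the
  Paley-Wiener-Schwartz theorem; this is the only case in which it is used.\<close>

definition dist_fun :: "'n::finite functional \<Rightarrow> real^'n \<Rightarrow> complex" where
  "dist_fun T = (THE u. continuous_on UNIV u \<and> represents u T)"

section \<open>Weights and resolutions of unity\<close>

definition admissible :: "(real \<Rightarrow> real) \<Rightarrow> bool" where
  "admissible w \<longleftrightarrow>
     (\<forall>t\<in>{0<..1}. 0 < w t) \<and>
     (monotone_on {0<..1} (\<le>) (\<le>) w \<or> monotone_on {0<..1} (\<le>) (\<ge>) w) \<and>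
     (\<forall>t\<ge>1. w t = w 1) \<and>
     (\<exists>c>0. \<exists>d>0. \<forall>j::nat. c * w ((1/2) ^ j) \<le> w ((1/2) ^ (2 * j)) \<and>
                           w ((1/2) ^ (2 * j)) \<le> d * w ((1/2) ^ j))"

text \<open>This says that \<open>f\<close> is radial and nonincreasing in the norm of its argument:
  the case of equal norms gives radiality.\<close>

definition radially_decreasing :: "(real^'n::finite \<Rightarrow> real) \<Rightarrow> bool" where
  "radially_decreasing f \<longleftrightarrow> (\<forall>x y. norm x \<le> norm y \<longrightarrow> f y \<le> f x)"

definition resolution_of_unity :: "(nat \<Rightarrow> real^'n::finite \<Rightarrow> real) \<Rightarrow> bool" where
  "resolution_of_unity \<phi> \<longleftrightarrow>
     schwartz (\<phi> 0) \<and> (\<forall>\<xi>. 0 \<le> \<phi> 0 \<xi>) \<and> radially_decreasing (\<phi> 0) \<and>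
     closure {\<xi>. \<phi> 0 \<xi> \<noteq> 0} \<subseteq> {\<xi>. norm \<xi> \<le> 3/2} \<and>
     (\<forall>\<xi>. norm \<xi> \<le> 1 \<longrightarrow> \<phi> 0 \<xi> = 1) \<and>
     (\<forall>j\<ge>1. \<forall>\<xi>. \<phi> j \<xi> = (let \<eta> = (1/2) ^ j *\<^sub>R \<xi> in \<phi> 0 \<eta> - \<phi> 0 (2 *\<^sub>R \<eta>)))"

section \<open>The quasi-norm\<close>

text \<open>The dyadic cube with side length \<open>2\<^sup>-\<^sup>k\<close> and corner \<open>2\<^sup>-\<^sup>k m\<close>. With \<open>k\<close> a natural number
  these are precisely the dyadic cubes of side length at most \<open>1\<close>.\<close>

definition dyadic_cube :: "nat \<Rightarrow> int^'n::finite \<Rightarrow> (real^'n) set" where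
  "dyadic_cube k m =
     {x. \<forall>i. (1/2) ^ k * of_int (m $ i) \<le> x $ i \<and> x $ i < (1/2) ^ k * (of_int (m $ i) + 1)}"

text \<open>Powers of extended nonnegative numbers, for positive exponents.\<close>

definition ennreal_powr :: "ennreal \<Rightarrow> real \<Rightarrow> ennreal" where
  "ennreal_powr x p = (if x = \<infinity> then \<infinity> else ennreal (enn2real x powr p))"

definition F_norm ::
  "real \<Rightarrow> (real \<Rightarrow> real) \<Rightarrow> real \<Rightarrow> (nat \<Rightarrow> real^'n::finite \<Rightarrow> real) \<Rightarrow> 'n functional \<Rightarrow> ennreal" where
  "F_norm s w q \<phi> f =
     esssup lborel (\<lambda>x. ennreal (norm (dist_fun (multiplier (\<phi> 0) f) x))) +
     (SUP (k, m) \<in> UNIV.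
        ennreal_powr
          ((\<integral>\<^sup>+ x \<in> dyadic_cube k m.
              (\<Sum>i. let j = k + i in
                 ennreal (2 powr (s * real j * q) * w ((1/2) ^ j) powr q *
                          norm (dist_fun (multiplier (\<phi> j) f) x) powr q))
            \<partial>lborel) / emeasure lborel (dyadic_cube k m))
          (1 / q))"

definition F_space ::
  "real \<Rightarrow> (real \<Rightarrow> real) \<Rightarrow> real \<Rightarrow> (nat \<Rightarrow> real^'n::finite \<Rightarrow> real) \<Rightarrow> 'n functional set" where
  "F_space s w q \<phi> = {f. tempered_distribution f \<and> F_norm s w q \<phi> f < \<infinity>}"

end

theory Submission
  imports Defs "HOL-Probability.Sinc_Integral" "HOL-Probability.Characteristic_Functions"
begin

text \<open>
  Write \<open>v\<^sub>j\<close> for the function \<open>\<psi>\<^sub>j(D) f\<close> and \<open>u\<^sub>j\<close> for \<open>\<phi>\<^sub>j(D) f\<close>. Since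
  \<open>\<phi>\<^sub>j = \<phi>\<^sub>j (\<psi>\<^bsub>j-1\<^esub> + \<psi>\<^sub>j + \<psi>\<^bsub>j+1\<^esub>)\<close>, the function \<open>u\<^sub>j\<close> is the sum of the convolutions of three
  neighbouring \<open>v\<^sub>i\<close> with a Schwartz kernel dilated to scale \<open>2\<^bsup>-j\<^esup>\<close>, and each of these \<open>v\<^sub>i\<close> is
  reproduced by another such kernel because its spectrum is contained in a ball of radius comparable to
  \<open>2\<^bsup>j\<^esup>\<close>. By Jensen's inequality for \<open>q \<ge> 1\<close> and Peetre's maximal function for \<open>q < 1\<close>, this gives
  \<open>|u\<^sub>j(x)|\<^bsup>q\<^esup> \<le> C \<Sum>\<^bsub>|i-j| \<le> 1\<^esub> \<integral> (1 + |t|)\<^bsup>-L\<^esup> |v\<^sub>i(x - 2\<^bsup>-j\<^esup> t)|\<^bsup>q\<^esup> dt\<close> with \<open>C\<close> independent of \<open>f\<close>.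
  Integrate over a dyadic cube \<open>Q\<close> and sum over \<open>2\<^bsup>-j\<^esup> \<le> \<ell>(Q)\<close>: for fixed \<open>t\<close>, all the translates of
  \<open>Q\<close> by \<open>2\<^bsup>-j\<^esup> t\<close> lie in the same family of \<open>O((1 + |t|)\<^bsup>n\<^esup>)\<close> cubes of the size of \<open>Q\<close>, so the integral
  in \<open>t\<close> converges if \<open>L\<close> is large. Cubes of side length one also control the supremum of \<open>|u\<^sub>0|\<close>.
\<close>

section \<open>Schwartz functions\<close>

text \<open>The distribution enters only through continuous functions: \<open>band b T y\<close> is
  \<open>T\<close> applied to a translate of the kernel of \<open>b\<close>, and uniqueness of
  continuous representatives identifies it with \<open>dist_fun\<close>. The convolution formulas
  need \<open>T\<close> to pass under an integral of translates; continuity in a single Schwartz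
  seminorm permits this. The obstacle for q < 1 is uniformity in f. Peetre's argument divides by a
  power of a supremum, so the supremum must be finite, but a fixed weight need not tame the unknown
  polynomial growth of the function. The argument is therefore run twice: with a weight adapted to f
  and a constant depending on f, merely to obtain finiteness for the fixed weight, and again with
  the fixed weight, whose constant is independent of f. Uniformity in j holds because every kernel
  is a dilate of one of three functions: the symbols of level 0 and of all higher levels, and one
  reproducing kernel. Passing to the parent cube restores it; for unit cubes j = 0 and there is no
  lower level.\<close>

lemma partial_deriv_eqI:
  fixes f :: "real^'n::finite \<Rightarrow> 'b::real_normed_vector"
  assumes "(f has_derivative f') (at x)"
  shows "partial_deriv i f x = f' (axis i 1)"
proof -
  have 1: "((\<lambda>t. x + t *\<^sub>R axis i 1) has_derivative (\<lambda>t. t *\<^sub>R axis i 1)) (at 0)"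
    by (auto intro!: derivative_eq_intros)
  have "(f has_derivative f') (at (x + 0 *\<^sub>R axis i 1))" using assms by simp
  from diff_chain_at[OF 1 this]
  have "((\<lambda>t. f (x + t *\<^sub>R axis i 1)) has_vector_derivative f' (axis i 1)) (at 0)"
    using assms by (simp add: has_vector_derivative_def o_def linear_cmul
        bounded_linear.linear has_derivative_bounded_linear)
  then show ?thesis unfolding partial_deriv_def by (rule vector_derivative_at)
qed

lemma has_derivative_partial_deriv:
  fixes f :: "real^'n::finite \<Rightarrow> 'b::real_normed_vector"
  assumes "f differentiable (at x)"
  shows "(f has_derivative (\<lambda>v. \<Sum>i\<in>UNIV. v $ i *\<^sub>R partial_deriv i f x)) (at x)"
proof -
  obtain f' where f': "(f has_derivative f') (at x)"
    using assms by (auto simp: differentiable_def)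
  then have lin: "linear f'" by (simp add: bounded_linear.linear has_derivative_bounded_linear)
  have "f' v = (\<Sum>i\<in>UNIV. v $ i *\<^sub>R partial_deriv i f x)" for v
  proof -
    have "v = (\<Sum>i\<in>UNIV. v $ i *\<^sub>R axis i 1)"
      by (simp add: vec_eq_iff axis_def if_distrib cong: if_cong)
    then have "f' v = f' (\<Sum>i\<in>UNIV. v $ i *\<^sub>R axis i 1)" by simp
    also have "\<dots> = (\<Sum>i\<in>UNIV. v $ i *\<^sub>R f' (axis i 1))"
      by (simp add: linear_sum[OF lin] linear_cmul[OF lin])
    finally show ?thesis by (simp add: partial_deriv_eqI[OF f'])
  qed
  then have "f' = (\<lambda>v. \<Sum>i\<in>UNIV. v $ i *\<^sub>R partial_deriv i f x)" by auto
  with f' show ?thesis by simp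
qed

lemma iter_partial_append: "iter_partial (is @ js) f = iter_partial is (iter_partial js f)"
  by (induction "is") auto

text \<open>Spares explicit formulas for iterated derivatives: it is enough to find a class of
  differentiable, rapidly decreasing functions that is stable under one partial derivative. In the
  closure results below, \<open>C\<close> is the set of all functions of the shape in
  question.\<close>

lemma schwartz_coinduct:
  fixes f :: "real^'n::finite \<Rightarrow> 'b::real_normed_vector"
  assumes "C f"
    and diff: "\<And>f x. C f \<Longrightarrow> f differentiable (at x)"
    and bnd: "\<And>f N. C f \<Longrightarrow> \<exists>B. \<forall>x. (1 + norm x) ^ N * norm (f x) \<le> B"
    and step: "\<And>f i. C f \<Longrightarrow> C (partial_deriv i f)"
  shows "schwartz f"
proof -
  have C: "C (iter_partial is f)" for "is" by (induction "is") (auto simp: assms(1) step)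
  have "bounded (range (\<lambda>x. (1 + norm x) ^ N *\<^sub>R iter_partial is f x))" for "is" N
    using bnd[OF C, of N "is"] unfolding bounded_iff by auto
  with diff[OF C] show ?thesis by (simp add: schwartz_def)
qed

lemma schwartz_iter_partial: "schwartz f \<Longrightarrow> schwartz (iter_partial js f)"
  by (simp add: schwartz_def iter_partial_append[symmetric])

lemma schwartz_partial_deriv: "schwartz f \<Longrightarrow> schwartz (partial_deriv i f)"
  using schwartz_iter_partial[of f "[i]"] by simp

lemma schwartz_differentiable: "schwartz f \<Longrightarrow> f differentiable (at x)"
  unfolding schwartz_def by (metis iter_partial.simps(1))

lemma schwartz_has_derivative:
  "schwartz f \<Longrightarrow> (f has_derivative (\<lambda>v. \<Sum>i\<in>UNIV. v $ i *\<^sub>R partial_deriv i f x)) (at x)"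
  by (simp add: has_derivative_partial_deriv schwartz_differentiable)

lemma schwartz_continuous: "schwartz f \<Longrightarrow> continuous_on UNIV f"
  by (meson differentiable_at_withinI differentiable_imp_continuous_on differentiable_on_def
      schwartz_differentiable)

lemma schwartz_measurable: "schwartz f \<Longrightarrow> f \<in> borel_measurable borel"
  by (simp add: borel_measurable_continuous_onI schwartz_continuous)

lemma schwartz_bound:
  assumes "schwartz f"
  obtains B where "B \<ge> 0" "\<And>x. (1 + norm x) ^ N * norm (f x) \<le> B"
proof -
  have "bounded (range (\<lambda>x. (1 + norm x) ^ N *\<^sub>R iter_partial [] f x))"
    using assms unfolding schwartz_def by blast
  then obtain B where "\<And>x. (1 + norm x) ^ N * norm (f x) \<le> B"
    unfolding bounded_iff by auto
  moreover from this[of 0] have "B \<ge> 0" by (smt (verit) norm_ge_zero mult_nonneg_nonneg zero_le_power)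
  ultimately show ?thesis using that by blast
qed

lemma schwartz_deriv_bound:
  fixes f :: "real^'n::finite \<Rightarrow> 'b::real_normed_vector"
  assumes "schwartz f"
  obtains B where "B \<ge> 0" "\<And>x v. (1 + norm x) ^ N *
    norm (\<Sum>i\<in>UNIV. v $ i *\<^sub>R partial_deriv i f x) \<le> B * norm v"
proof -
  have "\<exists>B\<ge>0. \<forall>x. (1 + norm x) ^ N * norm (partial_deriv i f x) \<le> B" for i
    using schwartz_bound[OF schwartz_partial_deriv[OF assms]] by metis
  then obtain b where b: "\<And>i. b i \<ge> 0" "\<And>i x. (1 + norm x) ^ N * norm (partial_deriv i f x) \<le> b i"
    by metis
  have "(1 + norm x) ^ N * norm (\<Sum>i\<in>UNIV. v $ i *\<^sub>R partial_deriv i f x)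
     \<le> (\<Sum>i\<in>UNIV. b i) * norm v" for x v
  proof -
    have "(1 + norm x) ^ N * norm (\<Sum>i\<in>UNIV. v $ i *\<^sub>R partial_deriv i f x)
      \<le> (1 + norm x) ^ N * (\<Sum>i\<in>UNIV. norm (v $ i *\<^sub>R partial_deriv i f x))"
      by (intro mult_left_mono norm_sum) auto
    also have "\<dots> = (\<Sum>i\<in>UNIV. \<bar>v $ i\<bar> * ((1 + norm x) ^ N * norm (partial_deriv i f x)))"
      by (simp add: sum_distrib_left mult_ac)
    also have "\<dots> \<le> (\<Sum>i\<in>UNIV. norm v * b i)"
      by (intro sum_mono mult_mono b component_le_norm_cart) auto
    finally show ?thesis by (simp add: sum_distrib_left mult.commute)
  qed
  moreover have "(\<Sum>i\<in>UNIV. b i) \<ge> 0" by (simp add: b sum_nonneg)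
  ultimately show ?thesis using that by blast
qed

lemma schwartz_bounded_linear:
  fixes f :: "real^'n::finite \<Rightarrow> 'b::real_normed_vector"
  assumes "bounded_linear L" "schwartz f"
  shows "schwartz (\<lambda>x. L (f x))"
proof (rule schwartz_coinduct[where C="\<lambda>h. \<exists>f. schwartz f \<and> h = (\<lambda>x. L (f x))"])
  interpret L: bounded_linear L by fact
  show "\<exists>g. schwartz g \<and> (\<lambda>x. L (f x)) = (\<lambda>x. L (g x))" using assms by auto
next
  interpret L: bounded_linear L by fact
  have D: "((\<lambda>x. L (g x)) has_derivative (\<lambda>v. L (\<Sum>i\<in>UNIV. v $ i *\<^sub>R partial_deriv i g x))) (at x)"
    if "schwartz g" for g :: "real^'n \<Rightarrow> 'b" and x
    by (intro L.has_derivative schwartz_has_derivative that)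
  fix h assume "\<exists>f::real^'n \<Rightarrow> 'b. schwartz f \<and> h = (\<lambda>x. L (f x))"
  then obtain g :: "real^'n \<Rightarrow> 'b" where g: "schwartz g" "h = (\<lambda>x. L (g x))" by auto
  show "h differentiable at x" for x
    using D[OF g(1)] g(2) unfolding differentiable_def by blast
  show "\<exists>B. \<forall>x. (1 + norm x) ^ N * norm (h x) \<le> B" for N
  proof -
    obtain B where B: "\<And>x. (1 + norm x) ^ N * norm (g x) \<le> B" using schwartz_bound[OF g(1)] by metis
    obtain K where K: "K \<ge> 0" "\<And>x. norm (L x) \<le> norm x * K" using L.nonneg_bounded by auto
    have "(1 + norm x) ^ N * norm (h x) \<le> B * K" for x
    proof -
      have "(1 + norm x) ^ N * norm (h x) \<le> (1 + norm x) ^ N * (norm (g x) * K)"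
        unfolding g by (intro mult_left_mono K) auto
      also have "\<dots> \<le> B * K" using mult_right_mono[OF B K(1)] by (simp add: mult.assoc)
      finally show ?thesis .
    qed
    then show ?thesis by blast
  qed
  have "partial_deriv i h = (\<lambda>x. L (partial_deriv i g x))" for i
    unfolding g(2) partial_deriv_eqI[OF D[OF g(1)]]
    by (simp add: axis_def if_distrib if_distribR cong: if_cong)
  then show "\<exists>f. schwartz f \<and> partial_deriv i h = (\<lambda>x. L (f x))" for i
    using schwartz_partial_deriv[OF g(1)] by blast
qed

lemma schwartz_cmult: "schwartz f \<Longrightarrow> schwartz (\<lambda>x. a * f x)"
  for f :: "real^'n::finite \<Rightarrow> complex"
  by (rule schwartz_bounded_linear[OF bounded_linear_mult_right])

lemma schwartz_of_real: "schwartz f \<Longrightarrow> schwartz (\<lambda>x. complex_of_real (f x))"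
  by (rule schwartz_bounded_linear[OF bounded_linear_of_real])

lemma partial_deriv_add:
  fixes f g :: "real^'n::finite \<Rightarrow> 'b::real_normed_vector"
  assumes "schwartz f" "schwartz g"
  shows "partial_deriv i (\<lambda>x. f x + g x) = (\<lambda>x. partial_deriv i f x + partial_deriv i g x)"
proof
  fix x
  show "partial_deriv i (\<lambda>x. f x + g x) x = partial_deriv i f x + partial_deriv i g x"
    using partial_deriv_eqI[OF has_derivative_add[OF schwartz_has_derivative[OF assms(1)]
          schwartz_has_derivative[OF assms(2)]], of i x]
    by (simp add: axis_def if_distrib if_distribR cong: if_cong)
qed

lemma partial_deriv_cmult:
  fixes f :: "real^'n::finite \<Rightarrow> complex"
  assumes "schwartz f"
  shows "partial_deriv i (\<lambda>x. a * f x) = (\<lambda>x. a * partial_deriv i f x)"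
proof
  fix x
  show "partial_deriv i (\<lambda>x. a * f x) x = a * partial_deriv i f x"
    using partial_deriv_eqI[OF has_derivative_mult_right[OF schwartz_has_derivative[OF assms, of x], of a], of i]
    by (simp add: axis_def if_distrib if_distribR cong: if_cong)
qed

lemma schwartz_add:
  fixes f g :: "real^'n::finite \<Rightarrow> 'b::real_normed_vector"
  assumes "schwartz f" "schwartz g"
  shows "schwartz (\<lambda>x. f x + g x)"
proof (rule schwartz_coinduct[where C="\<lambda>h. \<exists>f g. schwartz f \<and> schwartz g \<and> h = (\<lambda>x. f x + g x)"])
  show "\<exists>u v. schwartz u \<and> schwartz v \<and> (\<lambda>x. f x + g x) = (\<lambda>x. u x + v x)" using assms by blast
next
  fix h :: "real^'n \<Rightarrow> 'b" assume "\<exists>f g. schwartz f \<and> schwartz g \<and> h = (\<lambda>x. f x + g x)"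
  then obtain f g where fg: "schwartz f" "schwartz g" and h: "h = (\<lambda>x. f x + g x)" by blast
  show "h differentiable at x" for x
    unfolding h by (intro differentiable_add schwartz_differentiable fg)
  show "\<exists>B. \<forall>x. (1 + norm x) ^ N * norm (h x) \<le> B" for N
  proof -
    obtain B1 where B1: "\<And>x. (1 + norm x) ^ N * norm (f x) \<le> B1" using schwartz_bound[OF fg(1)] by metis
    obtain B2 where B2: "\<And>x. (1 + norm x) ^ N * norm (g x) \<le> B2" using schwartz_bound[OF fg(2)] by metis
    have "(1 + norm x) ^ N * norm (h x) \<le> B1 + B2" for x
    proof -
      have "(1 + norm x) ^ N * norm (h x) \<le> (1 + norm x) ^ N * (norm (f x) + norm (g x))"
        unfolding h by (intro mult_left_mono norm_triangle_ineq) auto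
      with B1[of x] B2[of x] show ?thesis by (simp add: distrib_left)
    qed
    then show ?thesis by blast
  qed
  show "\<exists>f g. schwartz f \<and> schwartz g \<and> partial_deriv i h = (\<lambda>x. f x + g x)" for i
    using partial_deriv_add[OF fg] schwartz_partial_deriv[OF fg(1)] schwartz_partial_deriv[OF fg(2)] h
    by blast
qed

lemma schwartz_diff: "schwartz f \<Longrightarrow> schwartz g \<Longrightarrow> schwartz (\<lambda>x. f x - g x)"
  using schwartz_add[of f "\<lambda>x. - g x"] schwartz_bounded_linear[OF bounded_linear_minus[OF bounded_linear_ident], of g]
  by simp

lemma iter_partial_add:
  assumes "schwartz f" "schwartz g"
  shows "iter_partial is (\<lambda>x. f x + g x) = (\<lambda>x. iter_partial is f x + iter_partial is g x)"
  by (induction "is") (simp_all add: partial_deriv_add schwartz_iter_partial assms)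

lemma iter_partial_cmult:
  fixes f :: "real^'n::finite \<Rightarrow> complex"
  assumes "schwartz f"
  shows "iter_partial is (\<lambda>x. a * f x) = (\<lambda>x. a * iter_partial is f x)"
  by (induction "is") (simp_all add: partial_deriv_cmult schwartz_iter_partial assms)

lemma iter_partial_diff:
  fixes f g :: "real^'n::finite \<Rightarrow> complex"
  assumes "schwartz f" "schwartz g"
  shows "iter_partial is (\<lambda>x. f x - g x) = (\<lambda>x. iter_partial is f x - iter_partial is g x)"
  using iter_partial_add[OF assms(1) schwartz_cmult[OF assms(2)], of "is" "-1"]
    iter_partial_cmult[OF assms(2), of "is" "-1"] by simp

section \<open>Peetre's inequality, affine substitutions and multiplication by coordinates\<close>

lemma peetre: "1 + norm (x + y) \<le> (1 + norm x) * (1 + norm (y::'a::real_normed_vector))"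
  using norm_triangle_ineq[of x y] mult_nonneg_nonneg[OF norm_ge_zero norm_ge_zero, of x y]
  unfolding distrib_left distrib_right by linarith

lemma peetre_power:
  "(1 + norm (x + y)) ^ N \<le> (1 + norm x) ^ N * (1 + norm (y::'a::real_normed_vector)) ^ N"
  unfolding power_mult_distrib[symmetric] by (intro power_mono peetre) auto

lemma partial_deriv_affine:
  fixes f :: "real^'n::finite \<Rightarrow> 'b::real_normed_vector"
  assumes "schwartz f"
  shows "((\<lambda>x. f (c *\<^sub>R x + y)) has_derivative
           (\<lambda>v. \<Sum>i\<in>UNIV. (c *\<^sub>R v) $ i *\<^sub>R partial_deriv i f (c *\<^sub>R x + y))) (at x)"
    and "partial_deriv i (\<lambda>x. f (c *\<^sub>R x + y)) = (\<lambda>x. c *\<^sub>R partial_deriv i f (c *\<^sub>R x + y))"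
proof -
  have "((\<lambda>x. c *\<^sub>R x + y) has_derivative (\<lambda>v. c *\<^sub>R v)) (at x)" for x :: "real^'n"
    by (auto intro!: derivative_eq_intros)
  from diff_chain_at[OF this schwartz_has_derivative[OF assms]]
  show D: "((\<lambda>x. f (c *\<^sub>R x + y)) has_derivative
           (\<lambda>v. \<Sum>i\<in>UNIV. (c *\<^sub>R v) $ i *\<^sub>R partial_deriv i f (c *\<^sub>R x + y))) (at x)" for x
    by (simp add: o_def)
  show "partial_deriv i (\<lambda>x. f (c *\<^sub>R x + y)) = (\<lambda>x. c *\<^sub>R partial_deriv i f (c *\<^sub>R x + y))"
    unfolding partial_deriv_eqI[OF D]
    by (simp add: axis_def if_distrib if_distribR cong: if_cong)
qed

lemma schwartz_affine:
  fixes f :: "real^'n::finite \<Rightarrow> 'b::real_normed_vector"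
  assumes "schwartz f" "c \<noteq> 0"
  shows "schwartz (\<lambda>x. f (c *\<^sub>R x + y))"
proof (rule schwartz_coinduct[where C="\<lambda>h. \<exists>f. schwartz f \<and> h = (\<lambda>x. f (c *\<^sub>R x + y))"])
  show "\<exists>g. schwartz g \<and> (\<lambda>x. f (c *\<^sub>R x + y)) = (\<lambda>x. g (c *\<^sub>R x + y))" using assms by auto
next
  fix h assume "\<exists>f::real^'n\<Rightarrow>'b. schwartz f \<and> h = (\<lambda>x. f (c *\<^sub>R x + y))"
  then obtain g :: "real^'n \<Rightarrow> 'b" where g: "schwartz g" "h = (\<lambda>x. g (c *\<^sub>R x + y))" by auto
  show "h differentiable at x" for x
    using partial_deriv_affine(1)[OF g(1)] g(2) unfolding differentiable_def by blast
  show "\<exists>B. \<forall>x. (1 + norm x) ^ N * norm (h x) \<le> B" for N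
  proof -
    obtain B where B: "B \<ge> 0" "\<And>x. (1 + norm x) ^ N * norm (g x) \<le> B" using schwartz_bound[OF g(1)] by metis
    \<comment> \<open>Chosen so that \<open>1 + norm x\<close> is at most
      \<open>m * (1 + norm (c *\<^sub>R x))\<close> whether the dilation shrinks or expands.\<close>
    define m where "m = max 1 (1 / \<bar>c\<bar>)"
    have "(1 + norm x) ^ N * norm (h x) \<le> (m * (1 + norm y)) ^ N * B" for x
    proof -
      have "1 + norm x \<le> m * (1 + norm (c *\<^sub>R x))"
      proof -
        have "norm x = (1 / \<bar>c\<bar>) * norm (c *\<^sub>R x)" using assms by simp
        also have "\<dots> \<le> m * norm (c *\<^sub>R x)" by (intro mult_right_mono) (auto simp: m_def)
        finally show ?thesis by (simp add: m_def distrib_left)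
      qed
      also have "\<dots> \<le> m * ((1 + norm (c *\<^sub>R x + y)) * (1 + norm y))"
        using peetre[of "c *\<^sub>R x + y" "-y"] by (intro mult_left_mono) (auto simp: m_def)
      finally have "(1 + norm x) ^ N \<le> (m * (1 + norm y) * (1 + norm (c *\<^sub>R x + y))) ^ N"
        by (intro power_mono) (auto simp: mult_ac)
      then have "(1 + norm x) ^ N * norm (h x) \<le>
        (m * (1 + norm y) * (1 + norm (c *\<^sub>R x + y))) ^ N * norm (g (c *\<^sub>R x + y))"
        unfolding g by (intro mult_right_mono) auto
      also have "\<dots> = (m * (1 + norm y)) ^ N * ((1 + norm (c *\<^sub>R x + y)) ^ N * norm (g (c *\<^sub>R x + y)))"
        by (simp add: power_mult_distrib mult_ac)
      also have "\<dots> \<le> (m * (1 + norm y)) ^ N * B"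
        by (intro mult_left_mono B) (auto simp: m_def)
      finally show ?thesis .
    qed
    then show ?thesis by blast
  qed
  have "schwartz (\<lambda>x. c *\<^sub>R partial_deriv i g x)" for i
    by (rule schwartz_bounded_linear[OF bounded_linear_scaleR_right schwartz_partial_deriv[OF g(1)]])
  then show "\<exists>f. schwartz f \<and> partial_deriv i h = (\<lambda>x. f (c *\<^sub>R x + y))" for i
    unfolding g(2) partial_deriv_affine(2)[OF g(1)] by blast
qed

lemma schwartz_shift:
  fixes f :: "real^'n::finite \<Rightarrow> 'b::real_normed_vector"
  shows "schwartz f \<Longrightarrow> schwartz (\<lambda>x. f (x - y))"
  using schwartz_affine[of f 1 "- y"] by simp

lemma iter_partial_shift:
  fixes f :: "real^'n::finite \<Rightarrow> 'b::real_normed_vector"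
  assumes "schwartz f"
  shows "iter_partial is (\<lambda>x. f (x - y)) = (\<lambda>x. iter_partial is f (x - y))"
proof (induction "is")
  case (Cons i "is")
  then show ?case
    using partial_deriv_affine(2)[OF schwartz_iter_partial[OF assms, of "is"], of i 1 "-y"] by simp
qed simp

lemma schwartz_coord_mult:
  fixes f :: "real^'n::finite \<Rightarrow> complex"
  assumes "schwartz f"
  shows "schwartz (\<lambda>x. complex_of_real (x $ k) * f x)"
\<comment> \<open>Products with the coordinate alone are not stable under differentiation, since the
  product rule produces a bare \<open>f\<close> when the directions agree. The second summand
  \<open>g\<close> of the class absorbs it.\<close>
proof (rule schwartz_coinduct[where C="\<lambda>h. \<exists>f g. schwartz f \<and> schwartz g \<and>
      h = (\<lambda>x. complex_of_real (x $ k) * f x + g x)"])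
  have "schwartz (\<lambda>x. 0 * f x)" by (rule schwartz_cmult[OF assms])
  then have "schwartz (\<lambda>x::real^'n. 0 :: complex)" by simp
  then show "\<exists>u v. schwartz u \<and> schwartz v \<and>
    (\<lambda>x. complex_of_real (x $ k) * f x) = (\<lambda>x. complex_of_real (x $ k) * u x + v x)"
    using assms by (intro exI[of _ f] exI[of _ "\<lambda>x. 0"]) auto
next
  fix h :: "real^'n \<Rightarrow> complex"
  assume "\<exists>f g. schwartz f \<and> schwartz g \<and> h = (\<lambda>x. complex_of_real (x $ k) * f x + g x)"
  then obtain f g where fg: "schwartz f" "schwartz g"
    and h: "h = (\<lambda>x. complex_of_real (x $ k) * f x + g x)" by blast
  have D: "(h has_derivative (\<lambda>v. (complex_of_real (x $ k) * (\<Sum>i\<in>UNIV. v $ i *\<^sub>R partial_deriv i f x)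
      + complex_of_real (v $ k) * f x) + (\<Sum>i\<in>UNIV. v $ i *\<^sub>R partial_deriv i g x))) (at x)" for x
    unfolding h
    by (rule has_derivative_add has_derivative_mult schwartz_has_derivative fg
        has_derivative_of_real bounded_linear.has_derivative[OF bounded_linear_vec_nth] has_derivative_ident)+
  show "h differentiable at x" for x
    using D unfolding differentiable_def by blast
  show "\<exists>B. \<forall>x. (1 + norm x) ^ N * norm (h x) \<le> B" for N
  proof -
    obtain B1 where B1: "\<And>x. (1 + norm x) ^ Suc N * norm (f x) \<le> B1" using schwartz_bound[OF fg(1)] by metis
    obtain B2 where B2: "\<And>x. (1 + norm x) ^ N * norm (g x) \<le> B2" using schwartz_bound[OF fg(2)] by metis
    have "(1 + norm x) ^ N * norm (h x) \<le> B1 + B2" for x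
    proof -
      have "norm (h x) \<le> (1 + norm x) * norm (f x) + norm (g x)"
        unfolding h using component_le_norm_cart[of x k]
        by (intro norm_triangle_le add_mono) (auto simp: norm_mult intro!: mult_right_mono)
      then have "(1 + norm x) ^ N * norm (h x) \<le> (1 + norm x) ^ N * ((1 + norm x) * norm (f x) + norm (g x))"
        by (intro mult_left_mono) auto
      with B1[of x] B2[of x] show ?thesis by (simp add: algebra_simps)
    qed
    then show ?thesis by blast
  qed
  fix i
  have eq: "partial_deriv i h = (\<lambda>x. complex_of_real (x $ k) * partial_deriv i f x +
      ((if i = k then 1 else 0) * f x + partial_deriv i g x))"
    unfolding partial_deriv_eqI[OF D]
    by (auto simp: axis_def if_distrib if_distribR cong: if_cong)
  show "\<exists>f g. schwartz f \<and> schwartz g \<and> partial_deriv i h = (\<lambda>x. complex_of_real (x $ k) * f x + g x)"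
    unfolding eq
    by (rule exI[of _ "partial_deriv i f"],
        rule exI[of _ "\<lambda>x. (if i = k then 1 else 0) * f x + partial_deriv i g x"])
      (intro conjI refl schwartz_add schwartz_cmult schwartz_partial_deriv fg)
qed

section \<open>Continuity estimates for tempered distributions\<close>

lemma schwartz_seminorm_le:
  assumes "\<And>is x. length is \<le> N \<Longrightarrow> (1 + norm x) ^ N * norm (iter_partial is f x) \<le> B"
  shows "schwartz_seminorm N f \<le> B"
  unfolding schwartz_seminorm_def using assms by (intro cSUP_least) (auto intro!: exI[of _ "[]"])

text \<open>Trades the real-valued supremum in the seminorm for an arbitrary pointwise bound
  \<open>B\<close>. The constant from the definition may be negative; its absolute value serves
  because the seminorm of a Schwartz function is at least the modulus of its value at 0.\<close>

lemma tempered_distribution_bound: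
  assumes "tempered_distribution T"
  obtains N C where "C \<ge> 0"
    "\<And>f B. schwartz f \<Longrightarrow> (\<And>is x. length is \<le> N \<Longrightarrow> (1 + norm x) ^ N * norm (iter_partial is f x) \<le> B) \<Longrightarrow>
      norm (T f) \<le> C * B"
proof -
  obtain N C where NC: "\<And>f. schwartz f \<Longrightarrow> norm (T f) \<le> C * schwartz_seminorm N f"
    using assms unfolding tempered_distribution_def by blast
  have "norm (T f) \<le> \<bar>C\<bar> * B" if f: "schwartz f"
    and B: "\<And>is x. length is \<le> N \<Longrightarrow> (1 + norm x) ^ N * norm (iter_partial is f x) \<le> B" for f B
  proof -
    have "(1 + norm 0) ^ N * norm (iter_partial [] f 0) \<le> schwartz_seminorm N f"
      unfolding schwartz_seminorm_def using B
      by (intro cSUP_upper2[where x="([], 0)"]) (auto intro!: bdd_aboveI[of _ B])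
    then have "norm (f 0) \<le> schwartz_seminorm N f" by simp
    with norm_ge_zero have "0 \<le> schwartz_seminorm N f" by (rule order_trans)
    then have "norm (T f) \<le> \<bar>C\<bar> * schwartz_seminorm N f"
      using NC[OF f] by (smt (verit) mult_right_mono abs_ge_self)
    also have "\<dots> \<le> \<bar>C\<bar> * B" using B by (intro mult_left_mono schwartz_seminorm_le) auto
    finally show ?thesis .
  qed
  then show ?thesis using that[of "\<bar>C\<bar>" N] by auto
qed

lemma tempered_distribution_add:
  "tempered_distribution T \<Longrightarrow> schwartz f \<Longrightarrow> schwartz g \<Longrightarrow> T (\<lambda>x. f x + g x) = T f + T g"
  unfolding tempered_distribution_def by blast

lemma tempered_distribution_cmult:
  "tempered_distribution T \<Longrightarrow> schwartz f \<Longrightarrow> T (\<lambda>x. a * f x) = a * T f"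
  unfolding tempered_distribution_def by blast

lemma tempered_distribution_diff:
  assumes "tempered_distribution T" "schwartz f" "schwartz g"
  shows "T (\<lambda>x. f x - g x) = T f - T g"
  using tempered_distribution_add[OF assms(1,2) schwartz_cmult[OF assms(3)], of "-1"]
    tempered_distribution_cmult[OF assms(1,3), of "-1"] by simp

lemma schwartz_sum:
  fixes f :: "'a \<Rightarrow> real^'n::finite \<Rightarrow> complex"
  assumes "finite I" "I \<noteq> {}" "\<And>i. i \<in> I \<Longrightarrow> schwartz (f i)"
  shows "schwartz (\<lambda>x. \<Sum>i\<in>I. f i x)"
  using assms by (induction rule: finite_ne_induct) (auto intro: schwartz_add)

lemma tempered_distribution_sum:
  assumes "tempered_distribution T" "finite I" "I \<noteq> {}" "\<And>i. i \<in> I \<Longrightarrow> schwartz (f i)"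
  shows "T (\<lambda>x. \<Sum>i\<in>I. f i x) = (\<Sum>i\<in>I. T (f i))"
  using assms(2-) by (induction rule: finite_ne_induct)
    (auto simp: tempered_distribution_add[OF assms(1)] schwartz_sum)

section \<open>Integration on Euclidean space\<close>

text \<open>Differentiation under the integral sign for Frechet derivatives. The mean value theorem
  on the unit ball dominates the normalised remainder by \<open>2 * B y\<close>, and dominated
  convergence sends its integral to 0.\<close>

lemma has_derivative_integral:
  fixes G :: "'a \<Rightarrow> 'e::euclidean_space \<Rightarrow> 'b::{banach,second_countable_topology}"
  assumes int: "\<And>x. x \<in> ball x0 1 \<Longrightarrow> integrable M (\<lambda>y. G y x)"
    and deriv: "\<And>y x. x \<in> ball x0 1 \<Longrightarrow> (G y has_derivative G' y x) (at x)"
    and bound: "\<And>y x v. x \<in> ball x0 1 \<Longrightarrow> norm (G' y x v) \<le> B y * norm v"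
    and B: "integrable M B"
    and meas: "\<And>v. (\<lambda>y. G' y x0 v) \<in> borel_measurable M"
  shows "((\<lambda>x. \<integral>y. G y x \<partial>M) has_derivative (\<lambda>v. \<integral>y. G' y x0 v \<partial>M)) (at x0)"
proof -
  have x0: "x0 \<in> ball x0 1" by simp
  \<comment> \<open>Testing the derivative bound on a unit vector is what shows that
    \<open>B\<close> is nonnegative.\<close>
  obtain e :: 'e where "norm e = 1" using vector_choose_size[of 1] by auto
  then have B0: "B y \<ge> 0" for y using bound[OF x0, of y e]
    order_trans[OF norm_ge_zero] by fastforce
  have int': "integrable M (\<lambda>y. G' y x0 v)" for v
    by (rule Bochner_Integration.integrable_bound[OF integrable_mult_left[OF B, of "norm v"] meas])
       (use bound[OF x0] in \<open>auto intro!: AE_I2 order_trans[OF _ abs_ge_self]\<close>)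
  have lin: "linear (G' y x0)" for y
    by (rule bounded_linear.linear[OF has_derivative_bounded_linear[OF deriv[OF x0]]])
  have bl: "bounded_linear (\<lambda>v. \<integral>y. G' y x0 v \<partial>M)"
  proof (rule bounded_linear_intro[where K="\<integral>y. B y \<partial>M"])
    fix u v r
    show "(\<integral>y. G' y x0 (u + v) \<partial>M) = (\<integral>y. G' y x0 u \<partial>M) + (\<integral>y. G' y x0 v \<partial>M)"
      by (simp add: linear_add[OF lin] int')
    show "(\<integral>y. G' y x0 (r *\<^sub>R v) \<partial>M) = r *\<^sub>R (\<integral>y. G' y x0 v \<partial>M)"
      by (simp add: linear_cmul[OF lin])
    have "norm (\<integral>y. G' y x0 v \<partial>M) \<le> (\<integral>y. B y * norm v \<partial>M)"
      using bound[OF x0] int' B by (intro order_trans[OF integral_norm_bound integral_mono]) auto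
    then show "norm (\<integral>y. G' y x0 v \<partial>M) \<le> norm v * (\<integral>y. B y \<partial>M)" by (simp add: mult.commute)
  qed
  have lip: "norm (G y (x0 + h) - G y x0) \<le> B y * norm h" if "norm h < 1" for y h
  proof -
    have "norm (G y (x0 + h) - G y x0) \<le> B y * norm ((x0 + h) - x0)"
    proof (rule differentiable_bound[where S="ball x0 1" and f'="G' y"])
      show "(G y has_derivative G' y x) (at x within ball x0 1)" if "x \<in> ball x0 1" for x
        by (rule has_derivative_at_withinI[OF deriv[OF that]])
      show "onorm (G' y x) \<le> B y" if "x \<in> ball x0 1" for x
        by (rule onorm_le) (use bound[OF that] in auto)
    qed (use that in \<open>auto simp: dist_norm\<close>)
    then show ?thesis by simp
  qed
  define D where "D = (\<lambda>h y. (norm (G y (x0 + h) - G y x0 - G' y x0 h)) / norm h)"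
  have D_le: "D h y \<le> 2 * B y" if "norm h < 1" for h y
  proof (cases "h = 0")
    case False
    have "norm (G y (x0 + h) - G y x0 - G' y x0 h) \<le> B y * norm h + B y * norm h"
      by (rule norm_triangle_le_diff, rule add_mono[OF lip[OF that] bound[OF x0]])
    then show ?thesis using False by (simp add: D_def field_simps)
  qed (simp add: D_def B0)
  have intD: "integrable M (\<lambda>y. norm (G y (x0 + h) - G y x0 - G' y x0 h))" if "norm h < 1" for h
    using that by (intro integrable_norm Bochner_Integration.integrable_diff int int') (auto simp: dist_norm)
  have "((\<lambda>h. norm ((\<integral>y. G y (x0 + h) \<partial>M) - (\<integral>y. G y x0 \<partial>M) - (\<integral>y. G' y x0 h \<partial>M)) / norm h) \<longlongrightarrow> 0) (at 0)"
    unfolding tendsto_at_iff_sequentially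
  proof (intro allI impI)
    fix X :: "nat \<Rightarrow> 'e" assume X: "\<forall>i. X i \<in> UNIV - {0}" "X \<longlonglongrightarrow> 0"
    have ev: "\<forall>\<^sub>F n in sequentially. norm (X n) < 1"
      using tendstoD[OF X(2) zero_less_one] by simp
    \<comment> \<open>Early terms of \<open>X\<close> may leave the ball, where the remainder is not
      dominated. Setting them to 0 makes the domination hold for every index without changing the
      limit.\<close>
    define s where "s = (\<lambda>n y. if norm (X n) < 1 then D (X n) y else 0)"
    have "(\<lambda>n. \<integral>y. s n y \<partial>M) \<longlonglongrightarrow> (\<integral>y. 0 \<partial>M)"
    proof (rule integral_dominated_convergence[where w="\<lambda>y. 2 * B y"])
      show "s n \<in> borel_measurable M" for n
      proof (cases "norm (X n) < 1")
        case True
        then show ?thesis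
          using borel_measurable_integrable[OF intD[OF True]] by (simp add: s_def D_def)
      qed (simp add: s_def)
      show "integrable M (\<lambda>y. 2 * B y)" using B by simp
      show "AE y in M. norm (s n y) \<le> 2 * B y" for n
        using D_le B0 by (auto simp: s_def D_def intro!: AE_I2)
      show "AE y in M. (\<lambda>n. s n y) \<longlonglongrightarrow> 0"
      proof (rule AE_I2)
        fix y
        have "((\<lambda>h. D h y) \<longlongrightarrow> 0) (at 0)"
          using deriv[OF x0, of y] unfolding has_derivative_at D_def by simp
        then have "(\<lambda>n. D (X n) y) \<longlonglongrightarrow> 0"
          using X unfolding tendsto_at_iff_sequentially o_def by blast
        then show "(\<lambda>n. s n y) \<longlonglongrightarrow> 0"
          by (rule Lim_transform_eventually) (use ev in \<open>auto elim!: eventually_mono simp: s_def\<close>)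
      qed
    qed simp
    then have lim: "(\<lambda>n. \<integral>y. s n y \<partial>M) \<longlonglongrightarrow> 0" by simp
    show "((\<lambda>h. norm ((\<integral>y. G y (x0 + h) \<partial>M) - (\<integral>y. G y x0 \<partial>M) - (\<integral>y. G' y x0 h \<partial>M)) / norm h) \<circ> X) \<longlonglongrightarrow> 0"
    proof (rule Lim_null_comparison[OF _ lim])
      show "\<forall>\<^sub>F n in sequentially. norm (((\<lambda>h. norm ((\<integral>y. G y (x0 + h) \<partial>M) - (\<integral>y. G y x0 \<partial>M)
          - (\<integral>y. G' y x0 h \<partial>M)) / norm h) \<circ> X) n) \<le> (\<integral>y. s n y \<partial>M)"
        using ev
      proof (rule eventually_mono)
        fix n assume n: "norm (X n) < 1"
        have "norm ((\<integral>y. G y (x0 + X n) \<partial>M) - (\<integral>y. G y x0 \<partial>M) - (\<integral>y. G' y x0 (X n) \<partial>M))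
          = norm (\<integral>y. G y (x0 + X n) - G y x0 - G' y x0 (X n) \<partial>M)"
          using n by (simp add: int int' dist_norm)
        also have "\<dots> \<le> (\<integral>y. norm (G y (x0 + X n) - G y x0 - G' y x0 (X n)) \<partial>M)"
          by (rule integral_norm_bound)
        finally have "norm ((\<integral>y. G y (x0 + X n) \<partial>M) - (\<integral>y. G y x0 \<partial>M) - (\<integral>y. G' y x0 (X n) \<partial>M)) / norm (X n)
          \<le> (\<integral>y. norm (G y (x0 + X n) - G y x0 - G' y x0 (X n)) \<partial>M) / norm (X n)"
          by (rule divide_right_mono) simp
        also have "\<dots> = (\<integral>y. s n y \<partial>M)" using n by (simp add: s_def D_def)
        finally show "norm (((\<lambda>h. norm ((\<integral>y. G y (x0 + h) \<partial>M) - (\<integral>y. G y x0 \<partial>M)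
          - (\<integral>y. G' y x0 h \<partial>M)) / norm h) \<circ> X) n) \<le> (\<integral>y. s n y \<partial>M)" by simp
      qed
    qed
  qed
  with bl show ?thesis by (simp add: has_derivative_at)
qed

text \<open>Lebesgue measure on \<open>real^'n\<close> is the image of a product measure indexed by
  \<open>Basis\<close>, whereas the product here is indexed by coordinates; \<open>k\<close> inverts
  \<open>axis\<close> to pass between the two. It serves for the integrable weight and for the
  Gaussian.\<close>

lemma integral_prod_vec:
  fixes f :: "'n::finite \<Rightarrow> real \<Rightarrow> 'b::{real_normed_field,banach,second_countable_topology}"
  assumes "\<And>i. integrable lborel (f i)"
  shows "integrable lborel (\<lambda>x::real^'n. \<Prod>i\<in>UNIV. f i (x $ i))"
    and "integral\<^sup>L lborel (\<lambda>x::real^'n. \<Prod>i\<in>UNIV. f i (x $ i)) = (\<Prod>i\<in>UNIV. (LINT t|lborel. f i t))"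
proof -
  interpret product_sigma_finite "\<lambda>_. lborel :: real measure" ..
  let ?a = "\<lambda>i. axis i (1::real) :: real^'n"
  have inj: "inj ?a" by (auto simp: inj_def axis_eq_axis)
  have bas: "(Basis :: (real^'n) set) = range ?a" by (auto simp: Basis_vec_def)
  define k where "k = inv ?a"
  have k: "k (?a i) = i" for i unfolding k_def by (rule inv_f_f[OF inj])
  have nth: "(\<Sum>b\<in>Basis. g b * b $ i) = g (?a i)" for g :: "real^'n \<Rightarrow> real" and i
  proof -
    have "(\<Sum>b\<in>Basis. g b * b $ i) = (\<Sum>j\<in>UNIV. g (?a j) * ?a j $ i)"
      unfolding bas by (subst sum.reindex[OF inj]) simp
    also have "\<dots> = (\<Sum>j\<in>UNIV. if j = i then g (?a j) else 0)"
      by (intro sum.cong) (auto simp: axis_def)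
    finally show ?thesis by simp
  qed
  have pr: "(\<Prod>i\<in>UNIV. f i (g (?a i))) = (\<Prod>b\<in>Basis. f (k b) (g b))" for g
    unfolding bas by (simp add: prod.reindex[OF inj] k)
  have pr2: "(\<Prod>b\<in>Basis. (LINT t|lborel. f (k b) t)) = (\<Prod>i\<in>UNIV. (LINT t|lborel. f i t))"
    unfolding bas by (simp add: prod.reindex[OF inj] k)
  have [measurable]: "f i \<in> borel_measurable borel" for i
    using borel_measurable_integrable[OF assms[of i]] by simp
  have [measurable]: "(\<lambda>x::real^'n. x $ i) \<in> borel_measurable borel" for i
    by (intro borel_measurable_continuous_onI continuous_intros)
  have m: "(\<lambda>x::real^'n. \<Prod>i\<in>UNIV. f i (x $ i)) \<in> borel_measurable borel" by measurable
  have e: "(lborel :: (real^'n) measure) = distr (\<Pi>\<^sub>M b\<in>Basis. lborel) borel (\<lambda>f. \<Sum>b\<in>Basis. f b *\<^sub>R b)"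
    by (rule lborel_eq)
  show "integrable lborel (\<lambda>x::real^'n. \<Prod>i\<in>UNIV. f i (x $ i))"
    unfolding e by (subst integrable_distr_eq) (auto simp: nth pr m assms intro!: product_integrable_prod)
  show "integral\<^sup>L lborel (\<lambda>x::real^'n. \<Prod>i\<in>UNIV. f i (x $ i)) = (\<Prod>i\<in>UNIV. (LINT t|lborel. f i t))"
    unfolding e by (subst integral_distr)
      (auto simp: nth pr m pr2[symmetric] intro!: product_integral_prod assms)
qed

section \<open>Polynomially decaying weights and absolute integrability\<close>

definition wt :: "nat \<Rightarrow> 'a::real_normed_vector \<Rightarrow> real" where
  "wt N x = 1 / (1 + norm x) ^ N"

lemma one_plus_norm_power_pos [simp]: "0 < (1 + norm x) ^ N"
  by (intro zero_less_power add_pos_nonneg) auto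

lemma wt_nonneg [simp]: "wt N x \<ge> 0" and wt_le_1: "wt N x \<le> 1"
  by (simp_all add: wt_def one_le_power divide_le_eq_1)

lemma wt_mono: "N \<le> M \<Longrightarrow> wt M x \<le> wt N x"
  unfolding wt_def by (intro divide_left_mono power_increasing) (auto intro!: mult_pos_pos)

lemma wt_add: "wt (M + N) x = wt M x * wt N x"
  by (simp add: wt_def power_add)

lemma wt_mult_power: "wt N x * (1 + norm x) ^ N = 1" "(1 + norm x) ^ N * wt N x = 1"
  using add_pos_nonneg[of 1 "norm x"] by (auto simp: wt_def)

lemma le_wt: "(1 + norm x) ^ N * a \<le> B \<Longrightarrow> a \<le> B * wt N x"
  using add_pos_nonneg[of 1 "norm x"] by (simp add: wt_def field_simps)

lemma wt_continuous: "continuous_on UNIV (wt N)"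
  unfolding wt_def using one_plus_norm_power_pos
  by (intro continuous_intros) (simp add: add_nonneg_eq_0_iff)

lemma wt_measurable [measurable]: "wt N \<in> borel_measurable borel"
  by (rule borel_measurable_continuous_onI[OF wt_continuous])

lemma wt_shift: "wt N (x + y) * wt N y \<le> wt N x" "wt N (x + y) \<le> (1 + norm y) ^ N * wt N x"
proof -
  have p: "(1 + norm x) ^ N > 0" "(1 + norm y) ^ N > 0" "(1 + norm (x + y)) ^ N > 0"
    using add_pos_nonneg[OF zero_less_one norm_ge_zero] by (metis zero_less_power)+
  have "(1 + norm x) ^ N \<le> (1 + norm (x + y)) ^ N * (1 + norm y) ^ N"
    using peetre_power[of "x + y" "-y" N] by simp
  then show "wt N (x + y) * wt N y \<le> wt N x" "wt N (x + y) \<le> (1 + norm y) ^ N * wt N x"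
    using p by (auto simp: wt_def field_simps)
qed

text \<open>The exponent is twice the dimension so that one factor
  \<open>(1 + norm x)\<^sup>2\<close> is available per coordinate; each is at least
  \<open>1 + (x $ i)\<^sup>2\<close>, which leaves a product of integrable functions of one
  variable.\<close>

lemma wt_integrable:
  "integrable lborel (wt (2 * CARD('n)) :: real^'n::finite \<Rightarrow> real)"
proof (rule Bochner_Integration.integrable_bound)
  have "integrable lborel (\<lambda>t::real. inverse (1 + t\<^sup>2))"
    using integrable_inverse_1_plus_square by (simp add: set_integrable_def)
  then show "integrable lborel (\<lambda>x::real^'n. \<Prod>i\<in>UNIV. inverse (1 + (x $ i)\<^sup>2))"
    by (intro integral_prod_vec(1))
  show "AE x::real^'n in lborel. norm (wt (2 * CARD('n)) x) \<le> norm (\<Prod>i\<in>UNIV. inverse (1 + (x $ i)\<^sup>2))"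
  proof (rule AE_I2)
    fix x :: "real^'n"
    have "wt (2 * CARD('n)) x = (\<Prod>i::'n\<in>UNIV. inverse ((1 + norm x)\<^sup>2))"
      by (simp add: wt_def power_mult power_inverse inverse_eq_divide power_one_over)
    also have "\<dots> \<le> (\<Prod>i\<in>UNIV. inverse (1 + (x $ i)\<^sup>2))"
    proof (intro prod_mono conjI le_imp_inverse_le)
      fix i
      have "(x $ i)\<^sup>2 \<le> (norm x)\<^sup>2"
        using component_le_norm_cart[of x i] by (simp add: abs_le_square_iff[symmetric])
      then show "1 + (x $ i)\<^sup>2 \<le> (1 + norm x)\<^sup>2" using norm_ge_zero[of x] by (simp add: power2_sum del: norm_ge_zero)
    qed (auto intro: add_pos_nonneg)
    finally show "norm (wt (2 * CARD('n)) x) \<le> norm (\<Prod>i\<in>UNIV. inverse (1 + (x $ i)\<^sup>2))"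
      by simp
  qed
qed simp

lemma integrable_wt_bound:
  fixes f :: "real^'n::finite \<Rightarrow> 'b::{banach,second_countable_topology}"
  assumes "f \<in> borel_measurable borel" "\<And>x. norm (f x) \<le> B * wt (2 * CARD('n)) x"
  shows "integrable lborel f"
  by (rule Bochner_Integration.integrable_bound[OF integrable_mult_right[OF wt_integrable, of B]])
     (use assms in \<open>auto intro!: AE_I2 order_trans[OF _ abs_ge_self]\<close>)

lemma schwartz_wt_bound:
  assumes "schwartz f"
  obtains B where "B \<ge> 0" "\<And>x. norm (f x) \<le> B * wt N x"
  using schwartz_bound[OF assms, of N] le_wt by metis

lemma schwartz_integrable:
  fixes f :: "real^'n::finite \<Rightarrow> 'b::{banach,second_countable_topology}"
  assumes "schwartz f"
  shows "integrable lborel f"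
  using schwartz_wt_bound[OF assms, of "2 * CARD('n)"] schwartz_measurable[OF assms] integrable_wt_bound
  by metis

lemma schwartz_mult_integrable:
  fixes f u :: "real^'n::finite \<Rightarrow> complex"
  assumes "schwartz f" "u \<in> borel_measurable borel" "\<And>x. norm (u x) \<le> A * (1 + norm x) ^ N"
  shows "integrable lborel (\<lambda>x. u x * f x)"
proof -
  obtain B where B: "B \<ge> 0" "\<And>x. norm (f x) \<le> B * wt (N + 2 * CARD('n)) x"
    using schwartz_wt_bound[OF assms(1)] by metis
  show ?thesis
  proof (rule integrable_wt_bound)
    show "(\<lambda>x. u x * f x) \<in> borel_measurable borel"
      using assms(2) schwartz_measurable[OF assms(1)] by measurable
    show "norm (u x * f x) \<le> (A * B) * wt (2 * CARD('n)) x" for x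
    proof -
      have "norm (u x * f x) \<le> (A * (1 + norm x) ^ N) * (B * (wt N x * wt (2 * CARD('n)) x))"
        unfolding norm_mult using assms(3)[of x] B(2)[of x]
        by (intro mult_mono) (auto simp: wt_add intro: order_trans[OF norm_ge_zero])
      also have "\<dots> = (A * B) * wt (2 * CARD('n)) x * (wt N x * (1 + norm x) ^ N)" by simp
      finally show ?thesis by (simp add: wt_mult_power)
    qed
  qed
qed

section \<open>Affine changes of variables\<close>

lemma nn_integral_affine:
  fixes f :: "'a::euclidean_space \<Rightarrow> ennreal"
  assumes "c \<noteq> 0" and [measurable]: "f \<in> borel_measurable borel"
  shows "(\<integral>\<^sup>+x. f x \<partial>lborel) = ennreal (\<bar>c\<bar> ^ DIM('a)) * (\<integral>\<^sup>+x. f (t + c *\<^sub>R x) \<partial>lborel)"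
proof -
  have "(\<integral>\<^sup>+x. f x \<partial>lborel) =
      (\<integral>\<^sup>+x. f x \<partial>density (distr lborel borel (\<lambda>x. t + c *\<^sub>R x)) (\<lambda>_. ennreal (\<bar>c\<bar> ^ DIM('a))))"
    by (rule arg_cong[OF lborel_affine[OF assms(1)], of "\<lambda>M. integral\<^sup>N M f"])
  then show ?thesis by (simp add: nn_integral_density nn_integral_distr nn_integral_cmult)
qed

lemma integral_affine:
  fixes f :: "'a::euclidean_space \<Rightarrow> 'b::{banach,second_countable_topology}"
  assumes "c \<noteq> 0" and [measurable]: "f \<in> borel_measurable borel"
  shows "(LINT x|lborel. f x) = \<bar>c\<bar> ^ DIM('a) *\<^sub>R (LINT x|lborel. f (t + c *\<^sub>R x))"
proof -
  have "(LINT x|lborel. f x) =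
      (LINT x|density (distr lborel borel (\<lambda>x. t + c *\<^sub>R x)) (\<lambda>_. ennreal (\<bar>c\<bar> ^ DIM('a))). f x)"
    by (rule arg_cong[OF lborel_affine[OF assms(1)], of "\<lambda>M. integral\<^sup>L M f"])
  then show ?thesis by (simp add: integral_density integral_distr)
qed

lemma integral_shift:
  fixes f :: "'a::euclidean_space \<Rightarrow> 'b::{banach,second_countable_topology}"
  assumes "f \<in> borel_measurable borel"
  shows "(LINT x|lborel. f (t + x)) = (LINT x|lborel. f x)"
    "(LINT x|lborel. f (t - x)) = (LINT x|lborel. f x)"
proof -
  show "(LINT x|lborel. f (t + x)) = (LINT x|lborel. f x)"
    using integral_affine[OF one_neq_zero assms, of t]
    by (simp only: abs_one power_one scaleR_one)
  have "(- 1::real) \<noteq> 0" by simp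
  then show "(LINT x|lborel. f (t - x)) = (LINT x|lborel. f x)"
    using integral_affine[OF _ assms, of "- 1" t]
    by (simp only: abs_minus_cancel abs_one power_one scaleR_one scaleR_minus_left diff_conv_add_uminus simp_thms)
qed

lemma nn_integral_shift:
  fixes f :: "'a::euclidean_space \<Rightarrow> ennreal"
  assumes "f \<in> borel_measurable borel"
  shows "(\<integral>\<^sup>+x. f (t + x) \<partial>lborel) = (\<integral>\<^sup>+x. f x \<partial>lborel)"
    "(\<integral>\<^sup>+x. f (t - x) \<partial>lborel) = (\<integral>\<^sup>+x. f x \<partial>lborel)"
proof -
  show "(\<integral>\<^sup>+x. f (t + x) \<partial>lborel) = (\<integral>\<^sup>+x. f x \<partial>lborel)"
    using nn_integral_affine[OF one_neq_zero assms, of t]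
    by (simp only: abs_one power_one scaleR_one ennreal_1 mult_1_left)
  have "(- 1::real) \<noteq> 0" by simp
  then show "(\<integral>\<^sup>+x. f (t - x) \<partial>lborel) = (\<integral>\<^sup>+x. f x \<partial>lborel)"
    using nn_integral_affine[OF _ assms, of "- 1" t]
    by (simp only: abs_minus_cancel abs_one power_one scaleR_one scaleR_minus_left
        diff_conv_add_uminus ennreal_1 mult_1_left simp_thms)
qed

section \<open>The Fourier transform of Schwartz functions\<close>

lemma integrable_pair_bound:
  fixes f :: "'a::euclidean_space \<Rightarrow> complex" and g :: "'b::euclidean_space \<Rightarrow> complex"
    and h :: "'a \<times> 'b \<Rightarrow> complex"
  assumes f: "integrable lborel f" and g: "integrable lborel g"
    and h: "h \<in> borel_measurable (lborel \<Otimes>\<^sub>M lborel)"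
    and le: "\<And>x y. norm (h (x, y)) \<le> norm (f x) * norm (g y)"
  shows "integrable (lborel \<Otimes>\<^sub>M lborel) h"
proof (rule Bochner_Integration.integrable_bound[OF _ h])
  have [measurable]: "f \<in> borel_measurable borel" "g \<in> borel_measurable borel"
    using borel_measurable_integrable[OF f] borel_measurable_integrable[OF g] by simp_all
  show "integrable (lborel \<Otimes>\<^sub>M lborel) (\<lambda>p. norm (f (fst p)) * norm (g (snd p)))"
    by (rule lborel_pair.Fubini_integrable) (use f g in auto)
  show "AE p in lborel \<Otimes>\<^sub>M lborel. norm (h p) \<le> norm (norm (f (fst p)) * norm (g (snd p)))"
    using le by (auto intro!: AE_I2 simp: split_paired_all)
qed

lemma norm_exp_kernel [simp]: "norm (exp (- (\<i> * complex_of_real t))) = 1" "norm (exp (\<i> * complex_of_real t)) = 1"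
  by (simp_all add: norm_exp_eq_Re)

lemma fourier_altdef: "fourier f \<xi> = (LINT x|lborel. f x * exp (- (\<i> * complex_of_real (x \<bullet> \<xi>))))"
  by (simp add: fourier_def)

lemma integrable_mult_kernel:
  fixes f :: "real^'n::finite \<Rightarrow> complex"
  assumes "integrable lborel f"
  shows "integrable lborel (\<lambda>x. f x * exp (- (\<i> * complex_of_real (x \<bullet> \<xi>))))"
proof (rule Bochner_Integration.integrable_bound[OF assms])
  have [measurable]: "f \<in> borel_measurable borel"
    using borel_measurable_integrable[OF assms] by simp
  show "(\<lambda>x. f x * exp (- (\<i> * complex_of_real (x \<bullet> \<xi>)))) \<in> borel_measurable lborel" by measurable
qed (simp add: norm_mult)

lemma fourier_cmult: "fourier (\<lambda>x. a * f x) \<xi> = a * fourier f \<xi>"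
  unfolding fourier_altdef mult.assoc by (rule integral_mult_right_zero)

lemma norm_fourier_le: "norm (fourier f \<xi>) \<le> (LINT x|lborel. norm (f x))"
  unfolding fourier_altdef by (rule order_trans[OF integral_norm_bound]) (simp add: norm_mult)

lemma has_derivative_exp_kernel:
  "((\<lambda>\<xi>. exp (c * complex_of_real (x \<bullet> \<xi>))) has_derivative
     (\<lambda>v. exp (c * complex_of_real (x \<bullet> \<eta>)) * (c * complex_of_real (x \<bullet> v)))) (at \<eta>)"
proof -
  have 1: "((\<lambda>\<xi>. c * complex_of_real (x \<bullet> \<xi>)) has_derivative (\<lambda>v. c * complex_of_real (x \<bullet> v))) (at \<eta>)"
    by (intro has_derivative_mult_right has_derivative_of_real has_derivative_inner_right has_derivative_ident)
  show ?thesis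
    using has_derivative_compose[OF 1 DERIV_exp[unfolded has_field_derivative_def]] by simp
qed

lemma fourier_has_derivative:
  fixes f :: "real^'n::finite \<Rightarrow> complex"
  assumes "schwartz f"
  shows "(fourier f has_derivative (\<lambda>v. LINT x|lborel.
      f x * (exp (- (\<i> * complex_of_real (x \<bullet> \<xi>))) * - (\<i> * complex_of_real (x \<bullet> v))))) (at \<xi>)"
  unfolding fourier_altdef
proof (rule has_derivative_integral[where G'="\<lambda>x \<xi> v. f x * (exp (- (\<i> * complex_of_real (x \<bullet> \<xi>))) *
      - (\<i> * complex_of_real (x \<bullet> v)))" and B="\<lambda>x. norm (complex_of_real (norm x) * f x)"])
  have [measurable]: "f \<in> borel_measurable borel" by (rule schwartz_measurable[OF assms])
  show "integrable lborel (\<lambda>x. f x * exp (- (\<i> * complex_of_real (x \<bullet> \<eta>))))" for \<eta>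
    by (intro integrable_mult_kernel schwartz_integrable assms)
  show "((\<lambda>\<xi>. f x * exp (- (\<i> * complex_of_real (x \<bullet> \<xi>)))) has_derivative
      (\<lambda>v. f x * (exp (- (\<i> * complex_of_real (x \<bullet> \<eta>))) * - (\<i> * complex_of_real (x \<bullet> v))))) (at \<eta>)" for x \<eta>
    using has_derivative_mult_right[OF has_derivative_exp_kernel[of "- \<i>" x \<eta>], of "f x"] by simp
  show "norm (f x * (exp (- (\<i> * complex_of_real (x \<bullet> \<eta>))) * - (\<i> * complex_of_real (x \<bullet> v))))
      \<le> norm (complex_of_real (norm x) * f x) * norm v" for x \<eta> v
    using mult_left_mono[OF Cauchy_Schwarz_ineq2[of x v], of "norm (f x)"] by (simp add: norm_mult mult_ac)
  show "integrable lborel (\<lambda>x. norm (complex_of_real (norm x) * f x))"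
    by (intro integrable_norm schwartz_mult_integrable[OF assms, where A=1 and N=1]) auto
  show "(\<lambda>x. f x * (exp (- (\<i> * complex_of_real (x \<bullet> \<xi>))) * - (\<i> * complex_of_real (x \<bullet> v)))) \<in> borel_measurable lborel" for v
    by measurable
qed

lemma partial_deriv_fourier:
  assumes "schwartz f"
  shows "partial_deriv i (fourier f) = fourier (\<lambda>x. - \<i> * (complex_of_real (x $ i) * f x))"
proof
  fix \<xi>
  show "partial_deriv i (fourier f) \<xi> = fourier (\<lambda>x. - \<i> * (complex_of_real (x $ i) * f x)) \<xi>"
    unfolding partial_deriv_eqI[OF fourier_has_derivative[OF assms]] fourier_altdef
    by (intro Bochner_Integration.integral_cong) (simp_all add: inner_axis)
qed

text \<open>Differentiate both sides of \<open>fourier (f (\<cdot> + h)) \<xi> = exp (\<i> h \<bullet> \<xi>) fourier f \<xi>\<close> in \<open>h\<close> at \<open>0\<close>.\<close>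
lemma fourier_partial_deriv:
  fixes f :: "real^'n::finite \<Rightarrow> complex"
  assumes f: "schwartz f"
  shows "fourier (partial_deriv i f) \<xi> = \<i> * complex_of_real (\<xi> $ i) * fourier f \<xi>"
proof -
  let ?e = "\<lambda>y. exp (- (\<i> * complex_of_real (y \<bullet> \<xi>)))"
  define d where "d = (\<lambda>y v. \<Sum>i\<in>UNIV. v $ i *\<^sub>R partial_deriv i f y)"
  have [measurable]: "f \<in> borel_measurable borel" "partial_deriv j f \<in> borel_measurable borel" for j
    by (intro schwartz_measurable schwartz_partial_deriv f)+
  obtain B where B: "B \<ge> 0" "\<And>x v. (1 + norm x) ^ (2 * CARD('n)) * norm (d x v) \<le> B * norm v"
    unfolding d_def using schwartz_deriv_bound[OF f] by metis
  have "((\<lambda>h. LINT y|lborel. f (y + h) * ?e y) has_derivative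
    (\<lambda>v. LINT y|lborel. d (y + 0) v * ?e y)) (at 0)"
  proof (rule has_derivative_integral[where G'="\<lambda>y h v. d (y + h) v * ?e y" and
        B="\<lambda>y. B * 2 ^ (2 * CARD('n)) * wt (2 * CARD('n)) y"])
    show "integrable lborel (\<lambda>y. f (y + h) * ?e y)" for h
      using schwartz_shift[OF f, of "-h"] by (intro integrable_mult_kernel schwartz_integrable) simp
    have "((\<lambda>h. f (y + h)) has_derivative d (y + h)) (at h)" for y h
    proof -
      have "((\<lambda>h. y + h) has_derivative (\<lambda>v. v)) (at h)" by (auto intro!: derivative_eq_intros)
      from has_derivative_compose[OF this schwartz_has_derivative[OF f]]
      show ?thesis by (simp add: d_def[abs_def])
    qed
    then show "((\<lambda>h. f (y + h) * ?e y) has_derivative (\<lambda>v. d (y + h) v * ?e y)) (at h)" for y h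
      by (rule has_derivative_mult_left)
    show "norm (d (y + h) v * ?e y) \<le> B * 2 ^ (2 * CARD('n)) * wt (2 * CARD('n)) y * norm v"
      if "h \<in> ball 0 1" for y h v
    proof -
      have "norm (d (y + h) v * ?e y) \<le> B * norm v * wt (2 * CARD('n)) (y + h)"
        by (simp add: norm_mult le_wt[OF B(2)])
      also have "\<dots> \<le> B * norm v * ((1 + norm h) ^ (2 * CARD('n)) * wt (2 * CARD('n)) y)"
        by (intro mult_left_mono wt_shift) (simp add: B)
      also have "\<dots> \<le> B * norm v * (2 ^ (2 * CARD('n)) * wt (2 * CARD('n)) y)"
        using that by (intro mult_left_mono mult_right_mono power_mono) (auto simp: B)
      finally show ?thesis by (simp add: mult_ac)
    qed
    show "integrable lborel (\<lambda>y::real^'n. B * 2 ^ (2 * CARD('n)) * wt (2 * CARD('n)) y)"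
      by (intro integrable_mult_right wt_integrable)
    show "(\<lambda>y. d (y + 0) v * ?e y) \<in> borel_measurable lborel" for v
      unfolding d_def by measurable
  qed
  moreover have "(LINT y|lborel. f (y + h) * ?e y) = exp (\<i> * complex_of_real (h \<bullet> \<xi>)) * fourier f \<xi>" for h
  proof -
    have "(LINT y|lborel. f (y + h) * ?e y) = (LINT y|lborel. (\<lambda>y. f y * ?e (y - h)) (h + y))"
      by (simp add: add.commute)
    also have "\<dots> = (LINT y|lborel. f y * ?e (y - h))" by (rule integral_shift) measurable
    also have "\<dots> = (LINT y|lborel. exp (\<i> * complex_of_real (h \<bullet> \<xi>)) * (f y * ?e y))"
      by (intro Bochner_Integration.integral_cong)
         (simp_all add: inner_diff_left right_diff_distrib exp_diff exp_minus field_simps)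
    finally show ?thesis by (simp add: fourier_altdef)
  qed
  moreover have "((\<lambda>h. exp (\<i> * complex_of_real (h \<bullet> \<xi>)) * fourier f \<xi>) has_derivative
    (\<lambda>v. \<i> * complex_of_real (v \<bullet> \<xi>) * fourier f \<xi>)) (at 0)"
    using has_derivative_mult_left[OF has_derivative_exp_kernel[of \<i> \<xi> 0], of "fourier f \<xi>"]
    by (simp add: inner_commute)
  ultimately have "(\<lambda>v. LINT y|lborel. d (y + 0) v * ?e y) = (\<lambda>v. \<i> * complex_of_real (v \<bullet> \<xi>) * fourier f \<xi>)"
    using has_derivative_unique by simp
  from fun_cong[OF this, of "axis i 1"] have "(LINT y|lborel. d y (axis i 1) * ?e y) = \<i> * complex_of_real (\<xi> $ i) * fourier f \<xi>"
    by (simp add: inner_axis' )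
  moreover have "d y (axis i 1) = partial_deriv i f y" for y
    by (simp add: d_def axis_def if_distrib if_distribR cong: if_cong)
  ultimately show ?thesis by (simp add: fourier_altdef)
qed

text \<open>Since \<open>1 + norm \<xi>\<close> is at most one plus the sum of the moduli of the
  coordinates, each additional power of decay costs one derivative of \<open>f\<close>. Hence the
  induction on \<open>N\<close> has to run over all Schwartz functions at once.\<close>

lemma fourier_decay:
  fixes f :: "real^'n::finite \<Rightarrow> complex"
  assumes "schwartz f"
  shows "\<exists>B. \<forall>\<xi>. (1 + norm \<xi>) ^ N * norm (fourier f \<xi>) \<le> B"
  using assms
proof (induction N arbitrary: f)
  case 0
  then show ?case using norm_fourier_le by auto
next
  case (Suc N)
  obtain B where B: "\<And>\<xi>. (1 + norm \<xi>) ^ N * norm (fourier f \<xi>) \<le> B" using Suc by metis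
  have "\<exists>B. \<forall>\<xi>. (1 + norm \<xi>) ^ N * norm (fourier (partial_deriv i f) \<xi>) \<le> B" for i
    by (intro Suc.IH schwartz_partial_deriv Suc.prems)
  then obtain b where b: "\<And>i \<xi>. (1 + norm \<xi>) ^ N * norm (fourier (partial_deriv i f) \<xi>) \<le> b i" by metis
  have "(1 + norm \<xi>) ^ Suc N * norm (fourier f \<xi>) \<le> B + (\<Sum>i\<in>UNIV. b i)" for \<xi>
  proof -
    have "(1 + norm \<xi>) ^ Suc N * norm (fourier f \<xi>) \<le>
      (1 + (\<Sum>i\<in>UNIV. \<bar>\<xi> $ i\<bar>)) * ((1 + norm \<xi>) ^ N * norm (fourier f \<xi>))"
      using mult_right_mono[OF add_left_mono[OF norm_le_l1_cart[of \<xi>], of 1], of "(1 + norm \<xi>) ^ N * norm (fourier f \<xi>)"]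
      by (simp add: mult_ac)
    also have "\<dots> = (1 + norm \<xi>) ^ N * norm (fourier f \<xi>) +
      (\<Sum>i\<in>UNIV. (1 + norm \<xi>) ^ N * norm (fourier (partial_deriv i f) \<xi>))"
      by (simp add: fourier_partial_deriv[OF Suc.prems] norm_mult distrib_right distrib_left sum_distrib_left sum_distrib_right mult_ac)
    also have "\<dots> \<le> B + (\<Sum>i\<in>UNIV. b i)" by (intro add_mono sum_mono B b)
    finally show ?thesis .
  qed
  then show ?case by blast
qed

lemma schwartz_fourier:
  fixes f :: "real^'n::finite \<Rightarrow> complex"
  assumes "schwartz f"
  shows "schwartz (fourier f)"
proof (rule schwartz_coinduct[where C="\<lambda>h. \<exists>f. schwartz f \<and> h = fourier f"])
  show "\<exists>g. schwartz g \<and> fourier f = fourier g" using assms by blast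
next
  fix h :: "real^'n \<Rightarrow> complex" assume "\<exists>f. schwartz f \<and> h = fourier f"
  then obtain f where f: "schwartz f" "h = fourier f" by blast
  show "h differentiable at x" for x
    using fourier_has_derivative[OF f(1)] f(2) unfolding differentiable_def by blast
  show "\<exists>B. \<forall>x. (1 + norm x) ^ N * norm (h x) \<le> B" for N
    unfolding f(2) by (rule fourier_decay[OF f(1)])
  show "\<exists>f. schwartz f \<and> partial_deriv i h = fourier f" for i
    unfolding f(2) partial_deriv_fourier[OF f(1)] using f(1)
    by (intro exI[of _ "\<lambda>x. - \<i> * (complex_of_real (x $ i) * f x)"] conjI refl schwartz_cmult schwartz_coord_mult)
qed

lemma inv_fourier_eq_fourier:
  fixes f :: "real^'n::finite \<Rightarrow> complex"
  shows "inv_fourier f x = 1 / (2 * pi) ^ CARD('n) * fourier f (- x)"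
  unfolding inv_fourier_def fourier_altdef by (simp add: inner_commute)

lemma schwartz_inv_fourier: "schwartz f \<Longrightarrow> schwartz (inv_fourier f)"
  unfolding inv_fourier_eq_fourier[abs_def]
  using schwartz_affine[OF schwartz_fourier, of f "-1" 0] by (intro schwartz_cmult) simp

section \<open>Gaussians and Fourier inversion\<close>

definition gaussian :: "real^'n::finite \<Rightarrow> complex" where
  "gaussian x = complex_of_real (exp (- (norm x)\<^sup>2 / 2))"

text \<open>This is the characteristic function of the standard normal law, taken at
  \<open>- z\<close> and freed of the normalisation \<open>sqrt (2 * pi)\<close>.\<close>

lemma fourier_gaussian_1d:
  "integrable lborel (\<lambda>t::real. complex_of_real (exp (- t\<^sup>2 / 2)) * exp (- (\<i> * complex_of_real (t * z))))"
  "(LINT t|lborel. complex_of_real (exp (- t\<^sup>2 / 2)) * exp (- (\<i> * complex_of_real (t * z)))) =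
    complex_of_real (sqrt (2 * pi) * exp (- z\<^sup>2 / 2))"
proof -
  have d: "complex_of_real (exp (- t\<^sup>2 / 2)) = sqrt (2 * pi) * complex_of_real (std_normal_density t)" for t
    by (simp add: std_normal_density_def)
  have "integrable lborel (\<lambda>t. std_normal_density t)"
    by (rule integrable_normal_density) simp
  then have i: "integrable lborel (\<lambda>t. complex_of_real (exp (- t\<^sup>2 / 2)))"
    unfolding d by (intro integrable_mult_right) (simp add: complex_of_real_integrable_eq)
  show "integrable lborel (\<lambda>t::real. complex_of_real (exp (- t\<^sup>2 / 2)) * exp (- (\<i> * complex_of_real (t * z))))"
    by (rule Bochner_Integration.integrable_bound[OF i]) (auto simp: norm_mult simp del: of_real_mult)
  have "char std_normal_distribution (- z) = complex_of_real (exp (- z\<^sup>2 / 2))"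
    by (simp add: char_std_normal_distribution)
  moreover have "char std_normal_distribution (- z) =
      (LINT t|lborel. std_normal_density t *\<^sub>R exp (- (\<i> * complex_of_real (t * z))))"
    unfolding char_def by (subst integral_density) (auto simp: normal_density_nonneg mult_ac)
  ultimately have "complex_of_real (sqrt (2 * pi) * exp (- z\<^sup>2 / 2)) =
    sqrt (2 * pi) * (LINT t|lborel. std_normal_density t *\<^sub>R exp (- (\<i> * complex_of_real (t * z))))" by simp
  also have "\<dots> = (LINT t|lborel. sqrt (2 * pi) * (std_normal_density t *\<^sub>R exp (- (\<i> * complex_of_real (t * z)))))"
    by (rule integral_mult_right_zero[symmetric])
  also have "\<dots> = (LINT t|lborel. complex_of_real (exp (- t\<^sup>2 / 2)) * exp (- (\<i> * complex_of_real (t * z))))"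
    unfolding d by (simp add: scaleR_conv_of_real mult_ac)
  finally show "(LINT t|lborel. complex_of_real (exp (- t\<^sup>2 / 2)) * exp (- (\<i> * complex_of_real (t * z)))) =
    complex_of_real (sqrt (2 * pi) * exp (- z\<^sup>2 / 2))" by simp
qed

lemma fourier_gaussian:
  fixes z :: "real^'n::finite"
  shows "integrable lborel (gaussian :: real^'n \<Rightarrow> complex)"
    and "fourier gaussian z = complex_of_real (sqrt (2 * pi) ^ CARD('n)) * gaussian z"
proof -
  have norm2: "(norm x)\<^sup>2 = (\<Sum>i\<in>UNIV. (x $ i)\<^sup>2)" for x :: "real^'n"
    by (simp add: norm_vec_def L2_set_def sum_nonneg)
  have g: "gaussian x = (\<Prod>i\<in>UNIV. complex_of_real (exp (- (x $ i)\<^sup>2 / 2)))" for x :: "real^'n"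
    by (simp add: gaussian_def norm2 exp_sum sum_negf[symmetric] sum_divide_distrib)
  have e: "exp (- (\<i> * complex_of_real (x \<bullet> z))) = (\<Prod>i\<in>UNIV. exp (- (\<i> * complex_of_real (x $ i * z $ i))))" for x z :: "real^'n"
    by (simp add: inner_vec_def exp_sum[symmetric] sum_negf sum_distrib_left)
  have eq: "gaussian x * exp (- (\<i> * complex_of_real (x \<bullet> z))) = (\<Prod>i\<in>UNIV. complex_of_real (exp (- (x $ i)\<^sup>2 / 2)) *
     exp (- (\<i> * complex_of_real (x $ i * z $ i))))" for x z :: "real^'n"
    unfolding g e prod.distrib ..
  note I = integral_prod_vec[where f="\<lambda>i t. complex_of_real (exp (- t\<^sup>2 / 2)) * exp (- (\<i> * complex_of_real (t * z $ i)))" for z :: "real^'n",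
      OF fourier_gaussian_1d(1)]
  show "integrable lborel (gaussian :: real^'n \<Rightarrow> complex)"
    using I(1)[of 0] unfolding eq[symmetric] by simp
  show "fourier gaussian z = complex_of_real (sqrt (2 * pi) ^ CARD('n)) * gaussian z"
    unfolding fourier_altdef 
    by (subst eq, subst I(2), subst fourier_gaussian_1d(2)) (simp add: g prod.distrib)
qed

lemma gaussian_continuous: "continuous_on UNIV gaussian"
  unfolding gaussian_def by (intro continuous_intros) auto

lemma gaussian_measurable [measurable]: "gaussian \<in> borel_measurable borel"
  by (rule borel_measurable_continuous_onI[OF gaussian_continuous])

lemma norm_gaussian_le_1: "norm (gaussian x) \<le> 1"
  by (simp add: gaussian_def)

text \<open>An exchange of integrals, needed in two roles: with \<open>b\<close> a dilated Gaussian
  it yields Fourier inversion, and with \<open>b\<close> a symbol it turns a multiplier tested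
  against \<open>g\<close> into a superposition of translates of a kernel. Asking only for
  integrability covers both.\<close>

lemma fourier_mult_inv_fourier:
  fixes b g :: "real^'n::finite \<Rightarrow> complex"
  assumes b: "integrable lborel b" and g: "integrable lborel g"
  shows "fourier (\<lambda>\<xi>. b \<xi> * inv_fourier g \<xi>) x =
    (LINT y|lborel. g y * (1 / (2 * pi) ^ CARD('n) * fourier b (x - y)))"
proof -
  have [measurable]: "b \<in> borel_measurable borel" "g \<in> borel_measurable borel"
    using borel_measurable_integrable[OF b] borel_measurable_integrable[OF g] by simp_all
  define c :: complex where "c = 1 / (2 * pi) ^ CARD('n)"
  define F where "F = (\<lambda>\<xi> y. c * (b \<xi> * (g y * exp (- (\<i> * complex_of_real (\<xi> \<bullet> (x - y)))))))"
  have int: "integrable (lborel \<Otimes>\<^sub>M lborel) (\<lambda>(\<xi>, y). F \<xi> y)"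
    unfolding F_def
    by (rule integrable_pair_bound[of "\<lambda>\<xi>. c * b \<xi>" g]) (use b g in \<open>auto simp: norm_mult\<close>)
  have "fourier (\<lambda>\<xi>. b \<xi> * inv_fourier g \<xi>) x = (LINT \<xi>|lborel. (LINT y|lborel. F \<xi> y))"
    unfolding fourier_altdef[of "\<lambda>\<xi>. b \<xi> * inv_fourier g \<xi>"]
  proof (intro Bochner_Integration.integral_cong refl)
    fix \<xi> :: "real^'n"
    have "F \<xi> y = (c * b \<xi> * exp (- (\<i> * complex_of_real (\<xi> \<bullet> x)))) * (g y * exp (- (\<i> * complex_of_real (y \<bullet> (- \<xi>)))))" for y
      by (simp add: F_def exp_minus exp_diff exp_add[symmetric] inner_diff_right inner_commute[of y] field_simps)
    then have "(LINT y|lborel. F \<xi> y) = (c * b \<xi> * exp (- (\<i> * complex_of_real (\<xi> \<bullet> x)))) * fourier g (- \<xi>)"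
      unfolding fourier_altdef by (simp only: integral_mult_right_zero)
    then show "b \<xi> * inv_fourier g \<xi> * exp (- (\<i> * complex_of_real (\<xi> \<bullet> x))) = (LINT y|lborel. F \<xi> y)"
      by (simp add: inv_fourier_eq_fourier c_def)
  qed
  also have "\<dots> = (LINT y|lborel. (LINT \<xi>|lborel. F \<xi> y))"
    by (rule lborel_pair.Fubini_integral[OF int, symmetric])
  also have "\<dots> = (LINT y|lborel. g y * (c * fourier b (x - y)))"
  proof (intro Bochner_Integration.integral_cong refl)
    fix y :: "real^'n"
    have "F \<xi> y = (g y * c) * (b \<xi> * exp (- (\<i> * complex_of_real (\<xi> \<bullet> (x - y)))))" for \<xi>
      by (simp add: F_def)
    then show "(LINT \<xi>|lborel. F \<xi> y) = g y * (c * fourier b (x - y))"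
      unfolding fourier_altdef by (simp only: integral_mult_right_zero mult.assoc)
  qed
  finally show ?thesis by (simp add: c_def)
qed

lemma fourier_gaussian_scaled:
  fixes z :: "real^'n::finite"
  assumes "e > 0"
  shows "fourier (\<lambda>y. gaussian (e *\<^sub>R y)) z =
    complex_of_real (sqrt (2 * pi) ^ CARD('n) / e ^ CARD('n)) * gaussian (z /\<^sub>R e)"
proof -
  have "fourier gaussian (z /\<^sub>R e) = e ^ CARD('n) *\<^sub>R (LINT y|lborel.
      gaussian (0 + e *\<^sub>R y) * exp (- (\<i> * complex_of_real ((0 + e *\<^sub>R y) \<bullet> (z /\<^sub>R e)))))"
    unfolding fourier_altdef using assms
    by (subst integral_affine[where c=e and t=0]) auto
  also have "(LINT y|lborel. gaussian (0 + e *\<^sub>R y) * exp (- (\<i> * complex_of_real ((0 + e *\<^sub>R y) \<bullet> (z /\<^sub>R e))))) =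
      fourier (\<lambda>y. gaussian (e *\<^sub>R y)) z"
  proof -
    have "(0 + e *\<^sub>R y) \<bullet> (z /\<^sub>R e) = y \<bullet> z" for y :: "real^'n" using assms by simp
    then show ?thesis unfolding fourier_altdef by (simp only: add_0)
  qed
  finally show ?thesis
    using assms unfolding fourier_gaussian(2) by (simp add: scaleR_conv_of_real field_simps)
qed

lemma integrable_gaussian_scaled:
  assumes "e > 0"
  shows "integrable lborel (\<lambda>y::real^'n::finite. gaussian (e *\<^sub>R y))"
proof (rule Bochner_Integration.integrableI_bounded)
  have "integral\<^sup>N lborel (\<lambda>y::real^'n. ennreal (norm (gaussian y))) < \<infinity>"
    using fourier_gaussian(1) unfolding integrable_iff_bounded by blast
  also have "integral\<^sup>N lborel (\<lambda>y::real^'n. ennreal (norm (gaussian y))) =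
      ennreal (\<bar>e\<bar> ^ DIM(real^'n)) * integral\<^sup>N lborel (\<lambda>y::real^'n. ennreal (norm (gaussian (0 + e *\<^sub>R y))))"
    by (rule nn_integral_affine) (use assms in auto)
  finally show "integral\<^sup>N lborel (\<lambda>y::real^'n. ennreal (norm (gaussian (e *\<^sub>R y)))) < \<infinity>"
    using assms by (auto simp: ennreal_mult_less_top)
qed measurable

text \<open>By regularisation with a Gaussian.\<close>
lemma fourier_inv_fourier:
  fixes a :: "real^'n::finite \<Rightarrow> complex"
  assumes a: "schwartz a"
  shows "fourier (inv_fourier a) \<xi> = a \<xi>"
proof -
  define c :: complex where "c = 1 / (2 * pi) ^ CARD('n)"
  define s where "s = complex_of_real (sqrt (2 * pi) ^ CARD('n))"
  define e where "e = (\<lambda>m::nat. inverse (real (Suc m)))"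
  have e_pos: "e m > 0" for m by (simp add: e_def)
  have e_lim: "e \<longlonglongrightarrow> 0" unfolding e_def by (rule LIMSEQ_inverse_real_of_nat)
  note ai = schwartz_integrable[OF a]
  have [measurable]: "a \<in> borel_measurable borel" "inv_fourier a \<in> borel_measurable borel"
    by (intro schwartz_measurable schwartz_inv_fourier a)+
  define I where "I = (\<lambda>m. fourier (\<lambda>y. gaussian (e m *\<^sub>R y) * inv_fourier a y) \<xi>)"
  have lim1: "I \<longlonglongrightarrow> fourier (inv_fourier a) \<xi>"
    unfolding I_def fourier_altdef
  proof (rule integral_dominated_convergence[where w="\<lambda>y. norm (inv_fourier a y)"])
    show "integrable lborel (\<lambda>y. norm (inv_fourier a y))"
      by (intro integrable_norm schwartz_integrable schwartz_inv_fourier a)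
    show "AE y in lborel. norm (gaussian (e m *\<^sub>R y) * inv_fourier a y * exp (- (\<i> * complex_of_real (y \<bullet> \<xi>))))
        \<le> norm (inv_fourier a y)" for m
      by (auto simp: norm_mult intro!: AE_I2 mult_left_le_one_le norm_gaussian_le_1)
    have "(\<lambda>m. gaussian (e m *\<^sub>R y)) \<longlonglongrightarrow> gaussian (0 *\<^sub>R y)" for y :: "real^'n"
      by (intro continuous_on_tendsto_compose[OF gaussian_continuous] tendsto_intros e_lim) auto
    then have "(\<lambda>m. gaussian (e m *\<^sub>R y) * inv_fourier a y * exp (- (\<i> * complex_of_real (y \<bullet> \<xi>))))
        \<longlonglongrightarrow> gaussian (0 *\<^sub>R y) * inv_fourier a y * exp (- (\<i> * complex_of_real (y \<bullet> \<xi>)))" for y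
      by (intro tendsto_intros)
    then show "AE y in lborel. (\<lambda>m. gaussian (e m *\<^sub>R y) * inv_fourier a y * exp (- (\<i> * complex_of_real (y \<bullet> \<xi>))))
        \<longlonglongrightarrow> inv_fourier a y * exp (- (\<i> * complex_of_real (y \<bullet> \<xi>)))"
      by (simp add: gaussian_def)
  qed measurable
  \<comment> \<open>The regularised inversion integral is an average of \<open>a\<close> against a
    Gaussian of width \<open>e m\<close> around \<open>\<xi>\<close>. The substitution
    \<open>y = \<xi> - e m *\<^sub>R t\<close> moves the width into the argument of
    \<open>a\<close>, and its Jacobian cancels the factor in the transform of the dilated
    Gaussian.\<close>
  have I_eq: "I m = c * s * (LINT t|lborel. a (\<xi> + (- e m) *\<^sub>R t) * gaussian t)" for m
  proof -
    have "I m = (LINT y|lborel. a y * (c * fourier (\<lambda>y. gaussian (e m *\<^sub>R y)) (\<xi> - y)))"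
      unfolding I_def c_def by (intro fourier_mult_inv_fourier integrable_gaussian_scaled e_pos ai)
    also have "\<dots> = (LINT y|lborel. a y * (c * (s / complex_of_real (e m ^ CARD('n)) * gaussian ((\<xi> - y) /\<^sub>R e m))))"
      by (simp add: fourier_gaussian_scaled[OF e_pos] s_def)
    also have "\<dots> = \<bar>- e m\<bar> ^ DIM(real^'n) *\<^sub>R (LINT t|lborel. a (\<xi> + (- e m) *\<^sub>R t) *
        (c * (s / complex_of_real (e m ^ CARD('n)) * gaussian ((\<xi> - (\<xi> + (- e m) *\<^sub>R t)) /\<^sub>R e m))))"
      by (rule integral_affine) (use e_pos[of m] in auto)
    also have "\<dots> = \<bar>- e m\<bar> ^ DIM(real^'n) *\<^sub>R (LINT t|lborel. (c * s / complex_of_real (e m ^ CARD('n))) *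
        (a (\<xi> + (- e m) *\<^sub>R t) * gaussian t))"
      using e_pos[of m] by (intro arg_cong[where f="scaleR _"] Bochner_Integration.integral_cong) auto
    also have "\<dots> = c * s * (LINT t|lborel. a (\<xi> + (- e m) *\<^sub>R t) * gaussian t)"
      using e_pos[of m] by (simp only: integral_mult_right_zero) (simp add: scaleR_conv_of_real)
    finally show ?thesis .
  qed
  obtain B where B: "\<And>x. norm (a x) \<le> B" using schwartz_bound[OF a, of 0] by auto
  have "(\<lambda>m. LINT t|lborel. a (\<xi> + (- e m) *\<^sub>R t) * gaussian t) \<longlonglongrightarrow> (LINT t::real^'n|lborel. a \<xi> * gaussian t)"
  proof (rule integral_dominated_convergence[where w="\<lambda>t. B * norm (gaussian t)"])
    show "integrable lborel (\<lambda>t::real^'n. B * norm (gaussian t))"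
      by (intro integrable_mult_right integrable_norm fourier_gaussian(1))
    show "AE t in lborel. norm (a (\<xi> + (- e m) *\<^sub>R t) * gaussian t) \<le> B * norm (gaussian t)" for m
      using B by (auto simp: norm_mult intro!: AE_I2 mult_right_mono)
    have "(\<lambda>m. a (\<xi> + (- e m) *\<^sub>R t)) \<longlonglongrightarrow> a (\<xi> + (- 0) *\<^sub>R t)" for t
      by (intro continuous_on_tendsto_compose[OF schwartz_continuous[OF a]] tendsto_intros e_lim) auto
    then have "(\<lambda>m. a (\<xi> + (- e m) *\<^sub>R t) * gaussian t) \<longlonglongrightarrow> a (\<xi> + (- 0) *\<^sub>R t) * gaussian t" for t
      by (intro tendsto_intros)
    then show "AE t in lborel. (\<lambda>m. a (\<xi> + (- e m) *\<^sub>R t) * gaussian t) \<longlonglongrightarrow> a \<xi> * gaussian t"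
      by simp
  qed measurable
  then have "I \<longlonglongrightarrow> c * s * (LINT t::real^'n|lborel. a \<xi> * gaussian t)"
    unfolding I_eq[abs_def] by (intro tendsto_intros)
  also have "(LINT t::real^'n|lborel. a \<xi> * gaussian t) = a \<xi> * (LINT t::real^'n|lborel. gaussian t)"
    by (rule integral_mult_right_zero)
  also have "(LINT t::real^'n|lborel. gaussian t) = s"
    using fourier_gaussian(2)[of "0::real^'n"] by (simp add: fourier_altdef s_def gaussian_def)
  also have "c * s * (a \<xi> * s) = a \<xi>"
  proof -
    have "s * s = complex_of_real ((sqrt (2 * pi) * sqrt (2 * pi)) ^ CARD('n))"
      unfolding s_def by (simp only: of_real_mult of_real_power power_mult_distrib)
    also have "\<dots> = (2 * pi) ^ CARD('n)" by simp
    finally have "c * (s * s) = 1" by (simp add: c_def)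
    then show ?thesis by (metis mult.assoc mult.commute mult_1_left)
  qed
  finally show ?thesis using LIMSEQ_unique lim1 by blast
qed

section \<open>Tempered distributions and integrals of translates\<close>

text \<open>Equals \<open>inv_fourier b (- x)\<close>, the reflected convolution kernel of the
  multiplier \<open>b\<close>. With the reflection built in, applying \<open>T\<close> to the
  translate of \<open>kernel b\<close> by \<open>y\<close> gives the value of b(D)T at
  \<open>y\<close>.\<close>

definition kernel :: "(real^'n::finite \<Rightarrow> complex) \<Rightarrow> real^'n \<Rightarrow> complex" where
  "kernel b x = 1 / (2 * pi) ^ CARD('n) * fourier b x"

lemma schwartz_kernel: "schwartz b \<Longrightarrow> schwartz (kernel b)"
  unfolding kernel_def[abs_def] by (intro schwartz_cmult schwartz_fourier)

text \<open>For \<open>\<tau>\<close> the identity this is a convolution. The free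
  \<open>\<tau>\<close> admits simple functions as well, for which the integral is a finite sum of
  translates to which linearity of a distribution applies.\<close>

definition superpose :: "(real^'n::finite \<Rightarrow> complex) \<Rightarrow> (real^'n \<Rightarrow> real^'n) \<Rightarrow> (real^'n \<Rightarrow> complex) \<Rightarrow> real^'n \<Rightarrow> complex" where
  "superpose g \<tau> k x = (LINT y|lborel. g y * k (x - \<tau> y))"

lemma superpose_integrable:
  fixes g k :: "real^'n::finite \<Rightarrow> complex"
  assumes "integrable lborel g" "\<tau> \<in> borel_measurable borel" "schwartz k"
  shows "integrable lborel (\<lambda>y. g y * k (x - \<tau> y))"
proof -
  have [measurable]: "g \<in> borel_measurable borel" "\<tau> \<in> borel_measurable borel" "k \<in> borel_measurable borel"
    using borel_measurable_integrable[OF assms(1)] assms(2) schwartz_measurable[OF assms(3)] by simp_all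
  obtain B where B: "B \<ge> 0" "\<And>x. norm (k x) \<le> B" using schwartz_bound[OF assms(3), of 0] by auto
  show ?thesis
    by (rule Bochner_Integration.integrable_bound[OF integrable_mult_right[OF integrable_norm[OF assms(1)], of B]])
       (auto simp: norm_mult mult.commute[of B] B intro!: AE_I2 mult_left_mono)
qed

lemma superpose_has_derivative:
  assumes g: "integrable lborel g" and \<tau>: "\<tau> \<in> borel_measurable borel" and k: "schwartz k"
  shows "(superpose g \<tau> k has_derivative
    (\<lambda>v. LINT y|lborel. g y * (\<Sum>i\<in>UNIV. v $ i *\<^sub>R partial_deriv i k (x - \<tau> y)))) (at x)"
proof -
  have [measurable]: "g \<in> borel_measurable borel" "\<tau> \<in> borel_measurable borel"
    "k \<in> borel_measurable borel" "partial_deriv i k \<in> borel_measurable borel" for i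
    using borel_measurable_integrable[OF g] \<tau> schwartz_measurable[OF k]
      schwartz_measurable[OF schwartz_partial_deriv[OF k]] by simp_all
  obtain B where B: "B \<ge> 0" "\<And>x v. norm (\<Sum>i\<in>UNIV. v $ i *\<^sub>R partial_deriv i k x) \<le> B * norm v"
    using schwartz_deriv_bound[OF k, of 0] by auto
  show ?thesis
    unfolding superpose_def[abs_def]
  proof (rule has_derivative_integral[where B="\<lambda>y. norm (g y) * B"])
    show "integrable lborel (\<lambda>y. g y * k (x - \<tau> y))" for x
      by (rule superpose_integrable[OF g \<tau> k])
    show "((\<lambda>x. g y * k (x - \<tau> y)) has_derivative
        (\<lambda>v. g y * (\<Sum>i\<in>UNIV. v $ i *\<^sub>R partial_deriv i k (x - \<tau> y)))) (at x)" for x y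
    proof -
      have "((\<lambda>x. x - \<tau> y) has_derivative (\<lambda>v. v)) (at x)" by (auto intro!: derivative_eq_intros)
      from has_derivative_mult_right[OF has_derivative_compose[OF this schwartz_has_derivative[OF k]]]
      show ?thesis .
    qed
    show "norm (g y * (\<Sum>i\<in>UNIV. v $ i *\<^sub>R partial_deriv i k (x - \<tau> y))) \<le> norm (g y) * B * norm v" for x y v
      unfolding norm_mult mult.assoc by (intro mult_left_mono B) simp
    show "integrable lborel (\<lambda>y. norm (g y) * B)" using g by simp
  qed measurable
qed

lemma partial_deriv_superpose:
  assumes "integrable lborel g" "\<tau> \<in> borel_measurable borel" "schwartz k"
  shows "partial_deriv i (superpose g \<tau> k) = superpose g \<tau> (partial_deriv i k)"
proof
  fix x
  have "(\<Sum>j\<in>UNIV. axis i 1 $ j *\<^sub>R partial_deriv j k z) = partial_deriv i k z" for z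
    by (simp add: axis_def if_distrib if_distribR cong: if_cong)
  then show "partial_deriv i (superpose g \<tau> k) x = superpose g \<tau> (partial_deriv i k) x"
    unfolding partial_deriv_eqI[OF superpose_has_derivative[OF assms]] by (simp add: superpose_def)
qed

lemma iter_partial_superpose:
  assumes "integrable lborel g" "\<tau> \<in> borel_measurable borel" "schwartz k"
  shows "iter_partial is (superpose g \<tau> k) = superpose g \<tau> (iter_partial is k)"
  by (induction "is") (simp_all add: partial_deriv_superpose assms schwartz_iter_partial)

text \<open>Linear growth of \<open>\<tau>\<close> lets Peetre's inequality move the polynomial
  weight from \<open>x\<close> to \<open>x - \<tau> y\<close>, where \<open>k\<close> decays, at the
  price of a polynomial in \<open>y\<close> that the decay of \<open>g\<close> pays for.\<close>

lemma schwartz_superpose: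
  fixes k :: "real^'n::finite \<Rightarrow> complex"
  assumes g: "schwartz g" and \<tau>: "\<tau> \<in> borel_measurable borel" "\<And>y. norm (\<tau> y) \<le> A * norm y"
    and k: "schwartz k"
  shows "schwartz (superpose g \<tau> k)"
proof (rule schwartz_coinduct[where C="\<lambda>h. \<exists>k. schwartz k \<and> h = superpose g \<tau> k"])
  show "\<exists>k'. schwartz k' \<and> superpose g \<tau> k = superpose g \<tau> k'" using k by blast
next
  note gi = schwartz_integrable[OF g]
  fix h assume "\<exists>k. schwartz k \<and> h = superpose g \<tau> k"
  then obtain k where k: "schwartz k" "h = superpose g \<tau> k" by blast
  show "h differentiable at x" for x
    using superpose_has_derivative[OF gi \<tau>(1) k(1)] k(2) unfolding differentiable_def by blast
  show "\<exists>f. schwartz f \<and> partial_deriv i h = superpose g \<tau> f" for i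
    using partial_deriv_superpose[OF gi \<tau>(1) k(1)] schwartz_partial_deriv[OF k(1)] k(2) by blast
  show "\<exists>B. \<forall>x. (1 + norm x) ^ N * norm (h x) \<le> B" for N
  proof -
    obtain B where B: "B \<ge> 0" "\<And>x. (1 + norm x) ^ N * norm (k x) \<le> B" using schwartz_bound[OF k(1)] by metis
    define M where "M = max 1 A"
    have M: "M \<ge> 1" and \<tau>M: "1 + norm (\<tau> y) \<le> M * (1 + norm y)" for y
    proof -
      show "M \<ge> 1" by (simp add: M_def)
      have "norm (\<tau> y) \<le> M * norm y"
        using \<tau>(2)[of y] mult_right_mono[of A M "norm y"] by (auto simp: M_def)
      then show "1 + norm (\<tau> y) \<le> M * (1 + norm y)" by (simp add: M_def distrib_left)
    qed
    have int: "integrable lborel (\<lambda>y. norm (complex_of_real ((1 + norm y) ^ N) * g y) * (M ^ N * B))"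
      by (intro integrable_mult_left integrable_norm schwartz_mult_integrable[OF g, where A=1 and N=N])
         (auto simp: norm_power intro!: power_mono order_trans[OF norm_triangle_ineq])
    have "(1 + norm x) ^ N * norm (h x) \<le> (LINT y|lborel. norm (complex_of_real ((1 + norm y) ^ N) * g y) * (M ^ N * B))" for x
    proof -
      have "norm ((1 + norm x) ^ N *\<^sub>R h x) = norm (LINT y|lborel. (1 + norm x) ^ N *\<^sub>R (g y * k (x - \<tau> y)))"
        unfolding k superpose_def by simp
      also have "\<dots> \<le> (LINT y|lborel. norm ((1 + norm x) ^ N *\<^sub>R (g y * k (x - \<tau> y))))"
        by (rule integral_norm_bound)
      also have "\<dots> \<le> (LINT y|lborel. norm (complex_of_real ((1 + norm y) ^ N) * g y) * (M ^ N * B))"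
      proof (rule integral_mono[OF _ int])
        show "integrable lborel (\<lambda>y. norm ((1 + norm x) ^ N *\<^sub>R (g y * k (x - \<tau> y))))"
          by (intro integrable_norm integrable_scaleR_right superpose_integrable gi \<tau> k)
        fix y
        have e1: "norm ((1 + norm x) ^ N *\<^sub>R (g y * k (x - \<tau> y))) = norm (g y) * ((1 + norm x) ^ N * norm (k (x - \<tau> y)))"
          by (simp add: norm_mult)
        have e2: "(1 + norm x) ^ N * norm (k (x - \<tau> y)) \<le> (M * (1 + norm y)) ^ N * B"
        proof -
          have "(1 + norm x) ^ N * norm (k (x - \<tau> y)) \<le> ((1 + norm (x - \<tau> y)) ^ N * (1 + norm (\<tau> y)) ^ N) * norm (k (x - \<tau> y))"
          using peetre_power[of "x - \<tau> y" "\<tau> y" N] by (intro mult_right_mono) auto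
        also have "\<dots> \<le> (1 + norm (\<tau> y)) ^ N * B"
          using mult_left_mono[OF B(2)[of "x - \<tau> y"], of "(1 + norm (\<tau> y)) ^ N"] by (simp add: mult_ac)
        also have "\<dots> \<le> (M * (1 + norm y)) ^ N * B"
          by (intro mult_right_mono power_mono \<tau>M B) auto
          finally show ?thesis .
        qed
        have e3: "norm (complex_of_real ((1 + norm y) ^ N) * g y) = (1 + norm y) ^ N * norm (g y)"
          unfolding norm_mult norm_of_real by simp
        show "norm ((1 + norm x) ^ N *\<^sub>R (g y * k (x - \<tau> y))) \<le>
            norm (complex_of_real ((1 + norm y) ^ N) * g y) * (M ^ N * B)"
          unfolding e1 e3 using mult_left_mono[OF e2 norm_ge_zero, of "g y"] by (simp add: power_mult_distrib mult_ac)
      qed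
      finally show ?thesis by simp
    qed
    then show ?thesis by blast
  qed
qed

text \<open>The mean value theorem on the segment between the two arguments. Decay is known at the
  intermediate point and wanted at \<open>x\<close>; Peetre's inequality transfers it with a loss
  polynomial in \<open>y\<close> and \<open>z\<close>, so the bound remains integrable against a
  Schwartz function.\<close>

lemma schwartz_shift_diff_bound:
  fixes h :: "real^'n::finite \<Rightarrow> complex"
  assumes "schwartz h"
  obtains K where "K \<ge> 0" "\<And>x y z. (1 + norm x) ^ N * norm (h (x - y) - h (x - z)) \<le>
      K * (norm (y - z) * (1 + norm y + norm z) ^ N)"
proof -
  obtain B where B: "B \<ge> 0" "\<And>x v. (1 + norm x) ^ N *
    norm (\<Sum>i\<in>UNIV. v $ i *\<^sub>R partial_deriv i h x) \<le> B * norm v"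
    using schwartz_deriv_bound[OF assms] by metis
  have "(1 + norm x) ^ N * norm (h (x - y) - h (x - z)) \<le> B * (norm (y - z) * (1 + norm y + norm z) ^ N)" for x y z
  proof -
    define L where "L = B * (1 + norm y + norm z) ^ N * wt N x"
    have "norm (h (x - y) - h (x - z)) \<le> L * norm ((x - y) - (x - z))"
    proof (rule differentiable_bound[where S="closed_segment (x - y) (x - z)"
          and f'="\<lambda>u v. \<Sum>i\<in>UNIV. v $ i *\<^sub>R partial_deriv i h u"])
      show "(h has_derivative (\<lambda>v. \<Sum>i\<in>UNIV. v $ i *\<^sub>R partial_deriv i h u)) (at u within closed_segment (x - y) (x - z))" for u
        by (rule has_derivative_at_withinI[OF schwartz_has_derivative[OF assms]])
      fix u assume "u \<in> closed_segment (x - y) (x - z)"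
      then obtain \<theta> where \<theta>: "0 \<le> \<theta>" "\<theta> \<le> 1" "u = (1 - \<theta>) *\<^sub>R (x - y) + \<theta> *\<^sub>R (x - z)"
        by (auto simp: closed_segment_def)
      then have "x - u = (1 - \<theta>) *\<^sub>R y + \<theta> *\<^sub>R z" by (simp add: algebra_simps)
      then have "norm (x - u) \<le> (1 - \<theta>) * norm y + \<theta> * norm z"
        using \<theta> norm_triangle_ineq[of "(1 - \<theta>) *\<^sub>R y" "\<theta> *\<^sub>R z"] by simp
      also have "\<dots> \<le> 1 * norm y + 1 * norm z" using \<theta> by (intro add_mono mult_right_mono) auto
      finally have "(1 + norm (x - u)) ^ N \<le> (1 + norm y + norm z) ^ N" by (intro power_mono) auto
      then have "(1 + norm x) ^ N \<le> (1 + norm u) ^ N * (1 + norm y + norm z) ^ N"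
        using peetre_power[of u "x - u" N] by (auto intro: order_trans mult_left_mono)
      then have *: "wt N u \<le> (1 + norm y + norm z) ^ N * wt N x"
        by (simp add: wt_def field_simps)
      show "onorm (\<lambda>v. \<Sum>i\<in>UNIV. v $ i *\<^sub>R partial_deriv i h u) \<le> L"
      proof (rule onorm_le)
        fix v
        have "norm (\<Sum>i\<in>UNIV. v $ i *\<^sub>R partial_deriv i h u) \<le> B * norm v * wt N u"
          by (rule le_wt[OF B(2)])
        also have "\<dots> \<le> B * norm v * ((1 + norm y + norm z) ^ N * wt N x)"
          by (intro mult_left_mono *) (use B in auto)
        finally show "norm (\<Sum>i\<in>UNIV. v $ i *\<^sub>R partial_deriv i h u) \<le> L * norm v"
          by (simp add: L_def mult_ac)
      qed
    qed auto
    then have "(1 + norm x) ^ N * norm (h (x - y) - h (x - z)) \<le> (1 + norm x) ^ N * (L * norm (y - z))"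
      by (intro mult_left_mono) (auto simp: norm_minus_commute)
    also have "\<dots> = B * (norm (y - z) * (1 + norm y + norm z) ^ N) * (wt N x * (1 + norm x) ^ N)"
      by (simp add: L_def mult_ac)
    finally show ?thesis by (simp only: wt_mult_power mult_1_right)
  qed
  with B(1) show ?thesis by (rule that)
qed

lemma schwartz_shift_diff_bound_uniform:
  fixes h :: "real^'n::finite \<Rightarrow> complex"
  assumes "schwartz h"
  obtains K where "K \<ge> 0" "\<And>is x y z. length is \<le> N \<Longrightarrow>
      (1 + norm x) ^ N * norm (iter_partial is h (x - y) - iter_partial is h (x - z)) \<le>
      K * (norm (y - z) * (1 + norm y + norm z) ^ N)"
proof -
  have "\<exists>K\<ge>0. \<forall>x y z. (1 + norm x) ^ N * norm (iter_partial is h (x - y) - iter_partial is h (x - z)) \<le>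
      K * (norm (y - z) * (1 + norm y + norm z) ^ N)" for "is"
    using schwartz_shift_diff_bound[OF schwartz_iter_partial[OF assms]] by metis
  then obtain K where K: "\<And>is. K is \<ge> 0" "\<And>is x y z. (1 + norm x) ^ N *
      norm (iter_partial is h (x - y) - iter_partial is h (x - z)) \<le> K is * (norm (y - z) * (1 + norm y + norm z) ^ N)"
    by metis
  let ?S = "{is :: 'n list. length is \<le> N}"
  have fin: "finite ?S" using finite_lists_length_le[of "UNIV :: 'n set"] by simp
  have "(1 + norm x) ^ N * norm (iter_partial is h (x - y) - iter_partial is h (x - z)) \<le>
      sum K ?S * (norm (y - z) * (1 + norm y + norm z) ^ N)" if "length is \<le> N" for "is" x y z
  proof -
    have "K is \<le> sum K ?S" by (rule member_le_sum) (use that K(1) fin in auto)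
    from order_trans[OF K(2)[of x "is" y z] mult_right_mono[OF this]] show ?thesis by simp
  qed
  moreover have "sum K ?S \<ge> 0" by (intro sum_nonneg K)
  ultimately show ?thesis using that by blast
qed

lemma schwartz_bound_uniform:
  fixes h :: "real^'n::finite \<Rightarrow> complex"
  assumes "schwartz h"
  obtains K where "K \<ge> 0" "\<And>is x. length is \<le> N \<Longrightarrow> (1 + norm x) ^ N * norm (iter_partial is h x) \<le> K"
proof -
  have "\<exists>K\<ge>0. \<forall>x. (1 + norm x) ^ N * norm (iter_partial is h x) \<le> K" for "is"
    using schwartz_bound[OF schwartz_iter_partial[OF assms]] by metis
  then obtain K where K: "\<And>is. K is \<ge> 0" "\<And>is x. (1 + norm x) ^ N * norm (iter_partial is h x) \<le> K is"
    by metis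
  let ?S = "{is :: 'n list. length is \<le> N}"
  have fin: "finite ?S" using finite_lists_length_le[of "UNIV :: 'n set"] by simp
  have "(1 + norm x) ^ N * norm (iter_partial is h x) \<le> sum K ?S" if "length is \<le> N" for "is" x
  proof -
    have "K is \<le> sum K ?S" by (rule member_le_sum) (use that K(1) fin in auto)
    from order_trans[OF K(2)[of x "is"] this] show ?thesis .
  qed
  moreover have "sum K ?S \<ge> 0" by (intro sum_nonneg K)
  ultimately show ?thesis using that by blast
qed

text \<open>The convolution of \<open>T\<close> with the reflection of \<open>k\<close>.\<close>

definition mollify :: "'n::finite functional \<Rightarrow> (real^'n \<Rightarrow> complex) \<Rightarrow> real^'n \<Rightarrow> complex" where
  "mollify T k y = T (\<lambda>x. k (x - y))"

text \<open>Both estimates are the continuity bound of \<open>T\<close>, applied to a translate of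
  \<open>k\<close> and to a difference of two translates. The growth bound is for integrability and
  domination, the local Lipschitz bound for continuity.\<close>

lemma mollify_bounds:
  assumes T: "tempered_distribution T" and k: "schwartz k"
  obtains N A where "A \<ge> 0" "\<And>y. norm (mollify T k y) \<le> A * (1 + norm y) ^ N"
    "\<And>y z. norm (mollify T k y - mollify T k z) \<le> A * (norm (y - z) * (1 + norm y + norm z) ^ N)"
proof -
  obtain N C where C: "C \<ge> 0"
    "\<And>f B. schwartz f \<Longrightarrow> (\<And>is x. length is \<le> N \<Longrightarrow> (1 + norm x) ^ N * norm (iter_partial is f x) \<le> B) \<Longrightarrow>
      norm (T f) \<le> C * B" using tempered_distribution_bound[OF T] by metis
  obtain K where K: "K \<ge> 0" "\<And>is x. length is \<le> N \<Longrightarrow> (1 + norm x) ^ N * norm (iter_partial is k x) \<le> K"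
    using schwartz_bound_uniform[OF k] by metis
  obtain L where L: "L \<ge> 0" "\<And>is x y z. length is \<le> N \<Longrightarrow>
      (1 + norm x) ^ N * norm (iter_partial is k (x - y) - iter_partial is k (x - z)) \<le>
      L * (norm (y - z) * (1 + norm y + norm z) ^ N)"
    using schwartz_shift_diff_bound_uniform[OF k] by metis
  have 1: "norm (mollify T k y) \<le> C * (K * (1 + norm y) ^ N)" for y
    unfolding mollify_def
  proof (rule C(2)[OF schwartz_shift[OF k]])
    fix "is" :: "'a list" and x assume "length is \<le> N"
    have "(1 + norm x) ^ N * norm (iter_partial is k (x - y)) \<le>
        ((1 + norm (x - y)) ^ N * (1 + norm y) ^ N) * norm (iter_partial is k (x - y))"
      using peetre_power[of "x - y" y N] by (intro mult_right_mono) auto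
    also have "\<dots> \<le> K * (1 + norm y) ^ N"
      using mult_right_mono[OF K(2)[OF \<open>length is \<le> N\<close>, of "x - y"], of "(1 + norm y) ^ N"] by (simp add: mult_ac)
    finally show "(1 + norm x) ^ N * norm (iter_partial is (\<lambda>x. k (x - y)) x) \<le> K * (1 + norm y) ^ N"
      by (simp add: iter_partial_shift[OF k])
  qed
  have 2: "norm (mollify T k y - mollify T k z) \<le> C * (L * (norm (y - z) * (1 + norm y + norm z) ^ N))" for y z
    unfolding mollify_def tempered_distribution_diff[OF T schwartz_shift[OF k] schwartz_shift[OF k], symmetric]
    by (rule C(2)[OF schwartz_diff[OF schwartz_shift[OF k] schwartz_shift[OF k]]])
       (simp add: iter_partial_diff schwartz_shift k iter_partial_shift L)
  show ?thesis
  proof (rule that[of "C * (K + L)" N])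
    show "C * (K + L) \<ge> 0" using C K L by simp
    show "norm (mollify T k y) \<le> C * (K + L) * (1 + norm y) ^ N" for y
    proof -
      have "C * (K * (1 + norm y) ^ N) \<le> C * ((K + L) * (1 + norm y) ^ N)"
        by (intro mult_left_mono mult_right_mono) (use C(1) L(1) in auto)
      with 1[of y] show ?thesis unfolding mult.assoc by linarith
    qed
    show "norm (mollify T k y - mollify T k z) \<le> C * (K + L) * (norm (y - z) * (1 + norm y + norm z) ^ N)" for y z
    proof -
      have "C * (L * (norm (y - z) * (1 + norm y + norm z) ^ N)) \<le>
          C * ((K + L) * (norm (y - z) * (1 + norm y + norm z) ^ N))"
        by (intro mult_left_mono mult_right_mono) (use C(1) K(1) in auto)
      with 2[of y z] show ?thesis unfolding mult.assoc by linarith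
    qed
  qed
qed

lemma mollify_continuous:
  assumes T: "tempered_distribution T" and k: "schwartz k"
  shows "continuous_on UNIV (mollify T k)"
proof -
  obtain N A where A: "A \<ge> 0"
    "\<And>y z. norm (mollify T k y - mollify T k z) \<le> A * (norm (y - z) * (1 + norm y + norm z) ^ N)"
    using mollify_bounds[OF T k] by metis
  have "isCont (mollify T k) z" for z
    unfolding isCont_def
  proof (rule LIM_zero_cancel, rule Lim_null_comparison)
    show "\<forall>\<^sub>F y in at z. norm (mollify T k y - mollify T k z) \<le> A * (norm (y - z) * (1 + norm y + norm z) ^ N)"
      using A by (intro always_eventually) auto
    have "((\<lambda>y. A * (norm (y - z) * (1 + norm y + norm z) ^ N)) \<longlongrightarrow> A * (norm (z - z) * (1 + norm z + norm z) ^ N)) (at z)"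
      by (intro tendsto_intros)
    then show "((\<lambda>y. A * (norm (y - z) * (1 + norm y + norm z) ^ N)) \<longlongrightarrow> 0) (at z)" by simp
  qed
  then show ?thesis by (simp add: continuous_at_imp_continuous_on)
qed

text \<open>Used on both sides of linearity of \<open>T\<close>: with \<open>p\<close> a translate
  of the kernel it writes a discretised superposition as a finite sum, and with \<open>p\<close> the
  mollification it reassembles the image of that sum as an integral.\<close>

lemma integral_comp_simple_function:
  fixes g :: "real^'n::finite \<Rightarrow> complex" and p :: "real^'n \<Rightarrow> complex"
  assumes g: "integrable lborel g" and F: "simple_function lborel F"
  shows "(LINT y|lborel. g y * p (F y)) =
    (\<Sum>v\<in>range F. (LINT y|lborel. indicator (F -` {v}) y * g y) * p v)"
proof -
  have fin: "finite (range F)" using F by (auto simp: simple_function_def)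
  have meas: "F -` {v} \<in> sets borel" for v
    using simple_functionD(2)[OF F, of "{v}"] by simp
  have [measurable]: "g \<in> borel_measurable borel"
    using borel_measurable_integrable[OF g] by simp
  have int: "integrable lborel (\<lambda>y. indicator (F -` {v}) y * g y)" for v
    using integrable_mult_indicator[of "F -` {v}" lborel g] meas g
    by (simp add: scaleR_conv_of_real of_real_indicator)
  have "g y * p (F y) = (\<Sum>v\<in>range F. indicator (F -` {v}) y * g y * p v)" for y
  proof -
    have "(\<Sum>v\<in>range F. indicator (F -` {v}) y * g y * p v) = (\<Sum>v\<in>range F. if F y = v then g y * p v else 0)"
      by (intro sum.cong) (auto simp: indicator_def)
    then show ?thesis using fin by simp
  qed
  then have "(LINT y|lborel. g y * p (F y)) =
      (\<Sum>v\<in>range F. (LINT y|lborel. indicator (F -` {v}) y * g y * p v))"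
    using int by (simp add: Bochner_Integration.integral_sum)
  also have "\<dots> = (\<Sum>v\<in>range F. (LINT y|lborel. indicator (F -` {v}) y * g y) * p v)"
    by (simp only: integral_mult_left_zero)
  finally show ?thesis .
qed

text \<open>Superpositions along simple functions converging to the identity are finite sums and converge
  in every Schwartz seminorm.\<close>
lemma tempered_distribution_superpose:
  fixes k :: "real^'n::finite \<Rightarrow> complex"
  assumes T: "tempered_distribution T" and g: "schwartz g" and k: "schwartz k"
  shows "T (superpose g (\<lambda>y. y) k) = (LINT y|lborel. g y * mollify T k y)"
proof -
  \<comment> \<open>Approximating the identity with \<open>dist (F i y) 0\<close> at most
    \<open>2 * dist y 0\<close> keeps every estimate below dominated by a fixed polynomial in
    \<open>norm y\<close>, independently of \<open>i\<close>.\<close>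
  obtain F :: "nat \<Rightarrow> real^'n \<Rightarrow> real^'n" where F: "\<And>i. simple_function lborel (F i)"
    "\<And>y. (\<lambda>i. F i y) \<longlonglongrightarrow> y" and "\<And>i y. dist (F i y) 0 \<le> 2 * dist y 0"
    using borel_measurable_implies_sequence_metric[of "\<lambda>y::real^'n. y" lborel 0] by auto
  then have F2: "norm (F i y) \<le> 2 * norm y" for i y by simp
  have [measurable]: "F i \<in> borel_measurable borel" for i
    using borel_measurable_simple_function[OF F(1)[of i]] by simp
  note gi = schwartz_integrable[OF g]
  obtain N C where C: "C \<ge> 0"
    "\<And>f B. schwartz f \<Longrightarrow> (\<And>is x. length is \<le> N \<Longrightarrow> (1 + norm x) ^ N * norm (iter_partial is f x) \<le> B) \<Longrightarrow>
      norm (T f) \<le> C * B" using tempered_distribution_bound[OF T] by metis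
  obtain L where L: "L \<ge> 0" "\<And>is x y z. length is \<le> N \<Longrightarrow>
      (1 + norm x) ^ N * norm (iter_partial is k (x - y) - iter_partial is k (x - z)) \<le>
      L * (norm (y - z) * (1 + norm y + norm z) ^ N)"
    using schwartz_shift_diff_bound_uniform[OF k] by metis
  obtain M A where A: "A \<ge> 0" "\<And>y. norm (mollify T k y) \<le> A * (1 + norm y) ^ M"
    using mollify_bounds[OF T k] by metis
  have [measurable]: "g \<in> borel_measurable borel" "k \<in> borel_measurable borel" "mollify T k \<in> borel_measurable borel"
    by (intro schwartz_measurable g k borel_measurable_continuous_onI mollify_continuous T)+
  have poly_int: "integrable lborel (\<lambda>y. norm (g y) * (c * (1 + norm y) ^ m))" for c m
  proof -
    have "integrable lborel (\<lambda>y. norm (complex_of_real ((1 + norm y) ^ m) * g y) * c)"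
      by (intro integrable_mult_left integrable_norm schwartz_mult_integrable[OF g, where A=1 and N=m])
         (auto simp: norm_power intro!: power_mono order_trans[OF norm_triangle_ineq])
    moreover have "(\<lambda>y. norm (complex_of_real ((1 + norm y) ^ m) * g y) * c) = (\<lambda>y. norm (g y) * (c * (1 + norm y) ^ m))"
      unfolding norm_mult norm_of_real by (simp add: fun_eq_iff)
    ultimately show ?thesis by (simp only:)
  qed
  have le3: "1 + norm (F i y) + norm y \<le> 3 * (1 + norm y)" for i y using F2[of i y] by simp
  have id_le: "norm y \<le> 1 * norm y" for y :: "real^'n" by simp
  have sS: "schwartz (superpose g (F i) k)" for i
    by (rule schwartz_superpose[OF g _ F2 k]) simp
  have sI: "schwartz (superpose g (\<lambda>y. y) k)"
    by (rule schwartz_superpose[OF g _ id_le k]) simp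
  have T_S: "T (superpose g (F i) k) = (LINT y|lborel. g y * mollify T k (F i y))" for i
  proof -
    have fin: "finite (range (F i))" using F(1)[of i] by (auto simp: simple_function_def)
    have "superpose g (F i) k = (\<lambda>x. \<Sum>v\<in>range (F i). (LINT y|lborel. indicator (F i -` {v}) y * g y) * k (x - v))"
      unfolding superpose_def[abs_def] by (intro ext integral_comp_simple_function gi F)
    then have "T (superpose g (F i) k) = (\<Sum>v\<in>range (F i). (LINT y|lborel. indicator (F i -` {v}) y * g y) * mollify T k v)"
      by (simp add: tempered_distribution_sum[OF T fin] tempered_distribution_cmult[OF T]
          schwartz_cmult schwartz_shift k mollify_def)
    also have "\<dots> = (LINT y|lborel. g y * mollify T k (F i y))"
      by (intro integral_comp_simple_function[symmetric] gi F)
    finally show ?thesis .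
  qed
  have "(\<lambda>i. LINT y|lborel. g y * mollify T k (F i y)) \<longlonglongrightarrow> (LINT y|lborel. g y * mollify T k y)"
  proof (rule integral_dominated_convergence[where w="\<lambda>y. norm (g y) * (A * 2 ^ M * (1 + norm y) ^ M)"])
    show "AE y in lborel. (\<lambda>i. g y * mollify T k (F i y)) \<longlonglongrightarrow> g y * mollify T k y"
      by (intro AE_I2 tendsto_intros continuous_on_tendsto_compose[OF mollify_continuous[OF T k]] F) auto
    show "AE y in lborel. norm (g y * mollify T k (F i y)) \<le> norm (g y) * (A * 2 ^ M * (1 + norm y) ^ M)" for i
    proof (rule AE_I2)
      fix y
      have "norm (mollify T k (F i y)) \<le> A * (1 + norm (F i y)) ^ M" by (rule A)
      also have "\<dots> \<le> A * (2 * (1 + norm y)) ^ M"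
        using F2[of i y] by (intro mult_left_mono power_mono A) auto
      finally show "norm (g y * mollify T k (F i y)) \<le> norm (g y) * (A * 2 ^ M * (1 + norm y) ^ M)"
        unfolding norm_mult power_mult_distrib mult.assoc by (intro mult_left_mono) auto
    qed
  qed (use poly_int in auto)
  then have lim1: "(\<lambda>i. T (superpose g (F i) k)) \<longlonglongrightarrow> (LINT y|lborel. g y * mollify T k y)"
    by (simp add: T_S)
  \<comment> \<open>The integrand of an error bound that holds for all \<open>x\<close> and all
    derivatives up to order \<open>N\<close> at once; its integral therefore controls the seminorm
    of the discretisation error.\<close>
  define b where "b = (\<lambda>i y. norm (g y) * (L * (norm (F i y - y) * (1 + norm (F i y) + norm y) ^ N)))"
  have b_le: "b i y \<le> norm (g y) * (L * 3 ^ Suc N * (1 + norm y) ^ Suc N)" for i y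
  proof -
    have "norm (F i y - y) \<le> 3 * (1 + norm y)"
      using norm_triangle_ineq4[of "F i y" y] F2[of i y] by (smt (verit) norm_ge_zero)
    then have "norm (F i y - y) * (1 + norm (F i y) + norm y) ^ N \<le> (3 * (1 + norm y)) * (3 * (1 + norm y)) ^ N"
      by (intro mult_mono power_mono le3) auto
    then have "b i y \<le> norm (g y) * (L * ((3 * (1 + norm y)) * (3 * (1 + norm y)) ^ N))"
      unfolding b_def by (intro mult_left_mono L) auto
    also have "(3 * (1 + norm y)) * (3 * (1 + norm y)) ^ N = 3 ^ Suc N * (1 + norm y) ^ Suc N"
      by (simp only: power_mult_distrib power_Suc mult_ac)
    finally show ?thesis by (simp only: mult.assoc)
  qed
  have b_nonneg: "b i y \<ge> 0" for i y by (simp add: b_def L)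
  have [measurable]: "b i \<in> borel_measurable borel" for i unfolding b_def by measurable
  have b_int: "integrable lborel (b i)" for i
    by (rule Bochner_Integration.integrable_bound[OF poly_int[of "L * 3 ^ Suc N" "Suc N"]])
       (use b_le b_nonneg in \<open>auto intro!: AE_I2 order_trans[OF _ abs_ge_self] simp del: power_Suc\<close>)
  have b_lim: "(\<lambda>i. LINT y|lborel. b i y) \<longlonglongrightarrow> (LINT y::real^'n|lborel. 0)"
  proof (rule integral_dominated_convergence[where w="\<lambda>y. norm (g y) * (L * 3 ^ Suc N * (1 + norm y) ^ Suc N)"])
    show "AE y in lborel. norm (b i y) \<le> norm (g y) * (L * 3 ^ Suc N * (1 + norm y) ^ Suc N)" for i
      using b_le b_nonneg by (auto intro!: AE_I2 simp del: power_Suc)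
    have "(\<lambda>i. b i y) \<longlonglongrightarrow> norm (g y) * (L * (norm (y - y) * (1 + norm y + norm y) ^ N))" for y
      unfolding b_def by (intro tendsto_intros F)
    then show "AE y in lborel. (\<lambda>i. b i y) \<longlonglongrightarrow> 0" by simp
  qed (use poly_int in \<open>auto simp del: power_Suc\<close>)
  have diff: "norm (T (superpose g (F i) k) - T (superpose g (\<lambda>y. y) k)) \<le> C * (LINT y|lborel. b i y)" for i
    unfolding tempered_distribution_diff[OF T sS sI, symmetric]
  proof (rule C(2)[OF schwartz_diff[OF sS sI]])
    fix "is" :: "'n list" and x assume len: "length is \<le> N"
    let ?k = "iter_partial is k"
    have i1: "integrable lborel (\<lambda>y. g y * ?k (x - F i y))" and i2: "integrable lborel (\<lambda>y. g y * ?k (x - y))"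
      by (auto intro!: superpose_integrable gi schwartz_iter_partial k)
    have "norm ((1 + norm x) ^ N *\<^sub>R ((LINT y|lborel. g y * ?k (x - F i y)) - (LINT y|lborel. g y * ?k (x - y)))) =
        norm (LINT y|lborel. (1 + norm x) ^ N *\<^sub>R (g y * (?k (x - F i y) - ?k (x - y))))"
      using i1 i2 by (simp add: right_diff_distrib)
    also have "\<dots> \<le> (LINT y|lborel. norm ((1 + norm x) ^ N *\<^sub>R (g y * (?k (x - F i y) - ?k (x - y)))))"
      by (rule integral_norm_bound)
    also have "\<dots> \<le> (LINT y|lborel. b i y)"
    proof (rule integral_mono[OF _ b_int])
      show "integrable lborel (\<lambda>y. norm ((1 + norm x) ^ N *\<^sub>R (g y * (?k (x - F i y) - ?k (x - y)))))"
        using i1 i2 by (intro integrable_norm integrable_scaleR_right) (simp add: right_diff_distrib)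
      fix y
      have "norm ((1 + norm x) ^ N *\<^sub>R (g y * (?k (x - F i y) - ?k (x - y)))) =
          norm (g y) * ((1 + norm x) ^ N * norm (?k (x - F i y) - ?k (x - y)))"
        unfolding norm_scaleR norm_mult by simp
      also have "\<dots> \<le> b i y" unfolding b_def by (intro mult_left_mono L len) auto
      finally show "norm ((1 + norm x) ^ N *\<^sub>R (g y * (?k (x - F i y) - ?k (x - y)))) \<le> b i y" .
    qed
    finally show "(1 + norm x) ^ N * norm (iter_partial is (\<lambda>x. superpose g (F i) k x - superpose g (\<lambda>y. y) k x) x)
        \<le> (LINT y|lborel. b i y)"
      by (simp add: iter_partial_diff sS sI iter_partial_superpose gi k) (simp add: superpose_def)
  qed
  have "(\<lambda>i. T (superpose g (F i) k)) \<longlonglongrightarrow> T (superpose g (\<lambda>y. y) k)"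
  proof (rule LIM_zero_cancel, rule Lim_null_comparison)
    show "\<forall>\<^sub>F i in sequentially. norm (T (superpose g (F i) k) - T (superpose g (\<lambda>y. y) k)) \<le> C * (LINT y|lborel. b i y)"
      using diff by simp
    show "(\<lambda>i. C * (LINT y|lborel. b i y)) \<longlonglongrightarrow> 0" using tendsto_mult_left[OF b_lim, of C] by simp
  qed
  then show ?thesis by (rule LIMSEQ_unique[OF _ lim1])
qed

section \<open>Band-limited parts of a distribution\<close>

lemma fourier_mult_inv_fourier_superpose:
  assumes "schwartz b" "schwartz g"
  shows "fourier (\<lambda>\<xi>. b \<xi> * inv_fourier g \<xi>) = superpose g (\<lambda>y. y) (kernel b)"
proof
  fix x
  show "fourier (\<lambda>\<xi>. b \<xi> * inv_fourier g \<xi>) x = superpose g (\<lambda>y. y) (kernel b) x"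
    unfolding fourier_mult_inv_fourier[OF schwartz_integrable[OF assms(1)] schwartz_integrable[OF assms(2)]]
      superpose_def kernel_def ..
qed

text \<open>The function b(D)T given by an explicit formula. \<open>dist_fun_multiplier\<close>
  shows that it is the one selected by \<open>dist_fun\<close>, and all later estimates are made for
  it.\<close>

definition band :: "(real^'n::finite \<Rightarrow> real) \<Rightarrow> 'n functional \<Rightarrow> real^'n \<Rightarrow> complex" where
  "band b T = mollify T (kernel (\<lambda>\<xi>. complex_of_real (b \<xi>)))"

lemma band_continuous: "tempered_distribution T \<Longrightarrow> schwartz b \<Longrightarrow> continuous_on UNIV (band b T)"
  unfolding band_def by (intro mollify_continuous schwartz_kernel schwartz_of_real)

lemma band_poly_growth:
  assumes "tempered_distribution T" "schwartz b"
  obtains N A where "A \<ge> 0" "\<And>y. norm (band b T y) \<le> A * (1 + norm y) ^ N"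
  using mollify_bounds[OF assms(1) schwartz_kernel[OF schwartz_of_real[OF assms(2)]]]
  unfolding band_def by metis

text \<open>Unfolding the dualities leaves \<open>T\<close> applied to the Fourier transform of the
  symbol times \<open>inv_fourier g\<close>. That function is a superposition of translates of the
  kernel with density \<open>g\<close>, and \<open>T\<close> passes under the integral.\<close>

lemma represents_multiplier:
  assumes T: "tempered_distribution T" and b: "schwartz b"
  shows "represents (band b T) (multiplier b T)"
  unfolding represents_def
proof (intro allI impI conjI)
  fix g :: "real^'a \<Rightarrow> complex" assume g: "schwartz g"
  obtain N A where "A \<ge> 0" "\<And>y. norm (band b T y) \<le> A * (1 + norm y) ^ N"
    using band_poly_growth[OF T b] by metis
  then show "integrable lborel (\<lambda>x. band b T x * g x)"
    using band_continuous[OF T b] by (intro schwartz_mult_integrable[OF g]) (auto intro: borel_measurable_continuous_onI)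
  have "multiplier b T g = T (superpose g (\<lambda>y. y) (kernel (\<lambda>\<xi>. complex_of_real (b \<xi>))))"
    unfolding multiplier_def inv_fourier_dist_def mult_dist_def fourier_dist_def
    by (simp add: fourier_mult_inv_fourier_superpose schwartz_of_real b g)
  also have "\<dots> = (LINT y|lborel. g y * band b T y)"
    unfolding band_def by (intro tempered_distribution_superpose T g schwartz_kernel schwartz_of_real b)
  finally show "multiplier b T g = (LINT x|lborel. band b T x * g x)" by (simp add: mult.commute)
qed

section \<open>Uniqueness of the continuous representative\<close>

definition bump :: "(real^'n::finite \<Rightarrow> real) \<Rightarrow> bool" where
  "bump \<beta> \<longleftrightarrow> schwartz \<beta> \<and> (\<forall>\<xi>. 0 \<le> \<beta> \<xi>) \<and> (\<forall>\<xi>. norm \<xi> \<le> 1 \<longrightarrow> \<beta> \<xi> = 1) \<and> (\<forall>\<xi>. norm \<xi> > 3/2 \<longrightarrow> \<beta> \<xi> = 0)"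

text \<open>If \<open>d x0\<close> were nonzero, a nonnegative test function concentrated where
  \<open>d\<close> stays within half its modulus of \<open>d x0\<close> would have integral at most
  half of itself. The function \<open>\<beta>\<close>, in applications the first member of a
  resolution of unity, supplies such test functions by dilation.\<close>

lemma continuous_zero_if_annihilates_schwartz:
  fixes d :: "real^'n::finite \<Rightarrow> complex"
  assumes bump: "bump (\<beta> :: real^'n \<Rightarrow> real)" and d: "continuous_on UNIV d"
    and int: "\<And>g. schwartz g \<Longrightarrow> integrable lborel (\<lambda>x. d x * g x)"
    and zero: "\<And>g. schwartz g \<Longrightarrow> (LINT x|lborel. d x * g x) = 0"
  shows "d x0 = 0"
proof (rule ccontr)
  assume nz: "d x0 \<noteq> 0"
  have "isCont d x0" using d by (simp add: continuous_on_eq_continuous_at)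
  then obtain \<delta> where \<delta>: "\<delta> > 0" "\<And>y. dist y x0 < \<delta> \<Longrightarrow> dist (d y) (d x0) < norm (d x0) / 2"
    using nz unfolding continuous_at_eps_delta by (metis half_gt_zero zero_less_norm_iff)
  \<comment> \<open>The dilated bump vanishes outside radius \<open>3/2 * r\<close>, which for this
    \<open>r\<close> is less than \<open>\<delta>\<close>.\<close>
  define r where "r = \<delta> / 2"
  have r: "r > 0" using \<delta> by (simp add: r_def)
  define h where "h = (\<lambda>y. \<beta> ((1 / r) *\<^sub>R y + (- (1 / r) *\<^sub>R x0)))"
  have h_eq: "h y = \<beta> ((1 / r) *\<^sub>R (y - x0))" for y by (simp add: h_def algebra_simps)
  have h: "schwartz h" unfolding h_def by (rule schwartz_affine) (use bump r in \<open>auto simp: bump_def\<close>)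
  note hi = schwartz_integrable[OF h]
  note hc = schwartz_of_real[OF h]
  have h0: "h y \<ge> 0" for y using bump by (simp add: h_def bump_def)
  have h1: "h y = 1" if "y \<in> ball x0 r" for y
    using that bump r by (simp add: h_eq bump_def dist_norm norm_minus_commute)
  have h_supp: "dist y x0 < \<delta>" if "h y \<noteq> 0" for y
  proof -
    have "norm ((1 / r) *\<^sub>R (y - x0)) \<le> 3/2"
      using that bump unfolding h_eq bump_def by force
    then have "1 / r * norm (y - x0) \<le> 3/2" unfolding norm_scaleR using r by simp
    then have "norm (y - x0) \<le> 3/2 * r" using r by (simp add: field_simps)
    also have "\<dots> < \<delta>" using \<delta> by (simp add: r_def)
    finally show ?thesis by (simp add: dist_norm)
  qed
  have "measure lborel (ball x0 r) \<le> (LINT y|lborel. h y)"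
  proof -
    have "measure lborel (ball x0 r) = (LINT y|lborel. indicator (ball x0 r) y)" by simp
    also have "\<dots> \<le> (LINT y|lborel. h y)"
    proof (rule integral_mono[OF _ hi])
      show "integrable lborel (indicator (ball x0 r) :: real^'n \<Rightarrow> real)"
        by (rule integrable_real_indicator) (use emeasure_bounded_finite[OF bounded_ball, of x0 r] in simp_all)
      show "indicator (ball x0 r) y \<le> h y" for y
        using h1[of y] h0[of y] by (auto simp: indicator_def)
    qed
    finally show ?thesis .
  qed
  moreover have "measure lborel (ball x0 r) > 0" using content_ball_pos[OF r] .
  ultimately have pos: "(LINT y|lborel. h y) > 0" by linarith
  have 1: "integrable lborel (\<lambda>y. d x0 * complex_of_real (h y))"
    by (intro integrable_mult_right schwartz_integrable hc)
  have "norm (d x0) * (LINT y|lborel. h y) = norm (d x0 * (LINT y|lborel. complex_of_real (h y)))"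
    using pos by (simp add: norm_mult)
  also have "\<dots> = norm (LINT y|lborel. d x0 * complex_of_real (h y) - d y * complex_of_real (h y))"
    using 1 by (simp add: int[OF hc] zero[OF hc])
  also have "\<dots> \<le> (LINT y|lborel. norm (d x0 * complex_of_real (h y) - d y * complex_of_real (h y)))"
    by (rule integral_norm_bound)
  also have "\<dots> \<le> (LINT y|lborel. norm (d x0) / 2 * h y)"
  proof (rule integral_mono)
    show "integrable lborel (\<lambda>y. norm (d x0 * complex_of_real (h y) - d y * complex_of_real (h y)))"
      by (intro integrable_norm Bochner_Integration.integrable_diff 1 int hc)
    show "integrable lborel (\<lambda>y. norm (d x0) / 2 * h y)" by (intro integrable_mult_right hi)
    fix y
    show "norm (d x0 * complex_of_real (h y) - d y * complex_of_real (h y)) \<le> norm (d x0) / 2 * h y"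
    proof (cases "h y = 0")
      case False
      from \<delta>(2)[OF h_supp[OF False]] have "norm (d x0 - d y) * h y \<le> norm (d x0) / 2 * h y"
        by (intro mult_right_mono h0) (simp add: dist_norm norm_minus_commute)
      then show ?thesis using h0[of y] by (simp add: left_diff_distrib[symmetric] norm_mult)
    qed simp
  qed
  also have "\<dots> = norm (d x0) / 2 * (LINT y|lborel. h y)" by simp
  finally show False using pos nz by (simp add: field_simps)
qed

lemma dist_fun_multiplier:
  fixes T :: "'n::finite functional"
  assumes bump: "bump (\<beta> :: real^'n \<Rightarrow> real)" and T: "tempered_distribution T" and b: "schwartz b"
  shows "dist_fun (multiplier b T) = band b T"
  unfolding dist_fun_def
proof (rule the_equality)
  show 1: "continuous_on UNIV (band b T) \<and> represents (band b T) (multiplier b T)"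
    using band_continuous represents_multiplier T b by blast
  fix u assume u: "continuous_on UNIV u \<and> represents u (multiplier b T)"
  have "u x - band b T x = 0" for x
  proof (rule continuous_zero_if_annihilates_schwartz[OF bump, of "\<lambda>x. u x - band b T x"])
    show "continuous_on UNIV (\<lambda>x. u x - band b T x)" using u 1 by (intro continuous_intros) auto
    fix g :: "real^'n \<Rightarrow> complex" assume g: "schwartz g"
    have i: "integrable lborel (\<lambda>x. u x * g x)" "integrable lborel (\<lambda>x. band b T x * g x)"
      and e: "(LINT x|lborel. u x * g x) = (LINT x|lborel. band b T x * g x)"
      using u 1 g unfolding represents_def by metis+
    show "integrable lborel (\<lambda>x. (u x - band b T x) * g x)"
      using i by (simp add: left_diff_distrib)
    show "(LINT x|lborel. (u x - band b T x) * g x) = 0"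
      using i e by (simp add: left_diff_distrib)
  qed
  then show "u = band b T" by (simp add: fun_eq_iff)
qed

section \<open>Products of symbols as convolutions\<close>

text \<open>Test the representation of \<open>band b T\<close> against \<open>inv_fourier a (x - \<cdot>)\<close>, whose inverse
  Fourier transform is a modulation of \<open>a\<close>.\<close>
lemma superpose_kernel_mult:
  fixes a b :: "real^'n::finite \<Rightarrow> complex"
  assumes a: "schwartz a" and b: "schwartz b"
  shows "superpose (\<lambda>y. inv_fourier a (x - y)) (\<lambda>y. y) (kernel b) = (\<lambda>z. kernel (\<lambda>\<xi>. a \<xi> * b \<xi>) (z - x))"
proof
  fix z
  define c :: complex where "c = 1 / (2 * pi) ^ CARD('n)"
  have g: "schwartz (\<lambda>y. inv_fourier a (x - y))"
    using schwartz_affine[OF schwartz_inv_fourier[OF a], of "-1" x] by simp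
  have [measurable]: "inv_fourier a \<in> borel_measurable borel"
    by (intro schwartz_measurable schwartz_inv_fourier a)
  have inv: "inv_fourier (\<lambda>y. inv_fourier a (x - y)) \<xi> = c * (exp (\<i> * complex_of_real (x \<bullet> \<xi>)) * a \<xi>)" for \<xi>
  proof -
    have "inv_fourier (\<lambda>y. inv_fourier a (x - y)) \<xi> =
        c * (LINT y|lborel. inv_fourier a (x - y) * exp (- (\<i> * complex_of_real (y \<bullet> - \<xi>))))"
      by (simp add: inv_fourier_eq_fourier[of "\<lambda>y. inv_fourier a (x - y)"] c_def fourier_altdef[of "\<lambda>y. inv_fourier a (x - y)"])
    also have "(LINT y|lborel. inv_fourier a (x - y) * exp (- (\<i> * complex_of_real (y \<bullet> - \<xi>)))) =
        (LINT y|lborel. inv_fourier a (x - (x - y)) * exp (- (\<i> * complex_of_real ((x - y) \<bullet> - \<xi>))))"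
      by (rule integral_shift(2)[symmetric]) measurable
    also have "\<dots> = (LINT y|lborel. exp (\<i> * complex_of_real (x \<bullet> \<xi>)) * (inv_fourier a y * exp (- (\<i> * complex_of_real (y \<bullet> \<xi>)))))"
      by (intro Bochner_Integration.integral_cong)
         (simp_all add: inner_diff_left right_diff_distrib exp_diff exp_minus field_simps)
    also have "\<dots> = exp (\<i> * complex_of_real (x \<bullet> \<xi>)) * fourier (inv_fourier a) \<xi>"
      unfolding fourier_altdef by (rule integral_mult_right_zero)
    finally show ?thesis by (simp add: fourier_inv_fourier[OF a])
  qed
  have "superpose (\<lambda>y. inv_fourier a (x - y)) (\<lambda>y. y) (kernel b) z =
      fourier (\<lambda>\<xi>. b \<xi> * (c * (exp (\<i> * complex_of_real (x \<bullet> \<xi>)) * a \<xi>))) z"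
    unfolding fourier_mult_inv_fourier_superpose[OF b g, symmetric] inv ..
  also have "\<dots> = c * fourier (\<lambda>\<xi>. exp (\<i> * complex_of_real (x \<bullet> \<xi>)) * (a \<xi> * b \<xi>)) z"
    unfolding fourier_cmult[symmetric] by (simp add: mult_ac)
  also have "fourier (\<lambda>\<xi>. exp (\<i> * complex_of_real (x \<bullet> \<xi>)) * (a \<xi> * b \<xi>)) z = fourier (\<lambda>\<xi>. a \<xi> * b \<xi>) (z - x)"
    unfolding fourier_altdef
    by (intro Bochner_Integration.integral_cong)
       (simp_all add: inner_diff_right inner_commute[of x] right_diff_distrib exp_diff exp_minus field_simps)
  finally show "superpose (\<lambda>y. inv_fourier a (x - y)) (\<lambda>y. y) (kernel b) z = kernel (\<lambda>\<xi>. a \<xi> * b \<xi>) (z - x)"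
    unfolding kernel_def[of "\<lambda>\<xi>. a \<xi> * b \<xi>"] c_def .
qed

text \<open>By the case \<open>x = 0\<close> of the preceding identity the kernel of a product is a
  convolution of two Schwartz functions. This bypasses closure of the Schwartz space under pointwise
  multiplication.\<close>

lemma schwartz_kernel_mult:
  fixes a b :: "real^'n::finite \<Rightarrow> complex"
  assumes a: "schwartz a" and b: "schwartz b"
  shows "schwartz (kernel (\<lambda>\<xi>. a \<xi> * b \<xi>))"
proof -
  have "schwartz (\<lambda>y. inv_fourier a (0 - y))"
    using schwartz_affine[OF schwartz_inv_fourier[OF a], of "-1" 0] by simp
  moreover have "norm y \<le> 1 * norm y" for y :: "real^'n" by simp
  ultimately have "schwartz (superpose (\<lambda>y. inv_fourier a (0 - y)) (\<lambda>y. y) (kernel b))"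
    by (intro schwartz_superpose[where A=1] schwartz_kernel b) auto
  then show ?thesis unfolding superpose_kernel_mult[OF a b] by simp
qed

lemma mollify_kernel_mult:
  fixes a b :: "real^'n::finite \<Rightarrow> complex"
  assumes T: "tempered_distribution T" and a: "schwartz a" and b: "schwartz b"
  shows "mollify T (kernel (\<lambda>\<xi>. a \<xi> * b \<xi>)) x = (LINT t|lborel. inv_fourier a t * mollify T (kernel b) (x - t))"
proof -
  have g: "schwartz (\<lambda>y. inv_fourier a (x - y))"
    using schwartz_affine[OF schwartz_inv_fourier[OF a], of "-1" x] by simp
  have [measurable]: "inv_fourier a \<in> borel_measurable borel" "mollify T (kernel b) \<in> borel_measurable borel"
    by (intro schwartz_measurable schwartz_inv_fourier a borel_measurable_continuous_onI
        mollify_continuous T schwartz_kernel b)+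
  have "mollify T (kernel (\<lambda>\<xi>. a \<xi> * b \<xi>)) x = (LINT y|lborel. inv_fourier a (x - y) * mollify T (kernel b) y)"
    using tempered_distribution_superpose[OF T g schwartz_kernel[OF b]]
    unfolding superpose_kernel_mult[OF a b] mollify_def[of T "kernel (\<lambda>\<xi>. a \<xi> * b \<xi>)"] .
  also have "\<dots> = (LINT t|lborel. inv_fourier a (x - (x - t)) * mollify T (kernel b) (x - t))"
    by (rule integral_shift(2)[symmetric]) measurable
  finally show ?thesis by simp
qed

lemma inv_fourier_scaled:
  fixes a :: "real^'n::finite \<Rightarrow> complex"
  assumes "r > 0" "a \<in> borel_measurable borel"
  shows "inv_fourier a t = r ^ CARD('n) *\<^sub>R inv_fourier (\<lambda>\<xi>. a (r *\<^sub>R \<xi>)) (r *\<^sub>R t)"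
proof -
  have [measurable]: "a \<in> borel_measurable borel" by fact
  have "fourier a (- t) = r ^ CARD('n) *\<^sub>R (LINT x|lborel. a (0 + r *\<^sub>R x) * exp (- (\<i> * complex_of_real ((0 + r *\<^sub>R x) \<bullet> - t))))"
    unfolding fourier_altdef using assms by (subst integral_affine[where c=r and t=0]) auto
  also have "\<dots> = r ^ CARD('n) *\<^sub>R fourier (\<lambda>\<xi>. a (r *\<^sub>R \<xi>)) (- (r *\<^sub>R t))"
    unfolding fourier_altdef by simp
  finally show ?thesis by (simp add: inv_fourier_eq_fourier)
qed

text \<open>The substitution \<open>t\<close> to \<open>r *\<^sub>R t\<close> shifts the dilation
  from the kernel to the argument of \<open>band b T\<close>. The kernel then no longer depends on
  \<open>r\<close>, which is the source of constants uniform in the dyadic level.\<close>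

lemma band_mult:
  fixes a b :: "real^'n::finite \<Rightarrow> real"
  assumes T: "tempered_distribution T" and a: "schwartz a" and b: "schwartz b" and r: "r > 0"
  shows "band (\<lambda>\<xi>. a (r *\<^sub>R \<xi>) * b \<xi>) T x =
    (LINT t|lborel. inv_fourier (\<lambda>\<xi>. complex_of_real (a \<xi>)) t * band b T (x - r *\<^sub>R t))"
proof -
  let ?a = "\<lambda>\<xi>. complex_of_real (a \<xi>)" and ?b = "\<lambda>\<xi>. complex_of_real (b \<xi>)"
  have ar: "schwartz (\<lambda>\<xi>. complex_of_real (a (r *\<^sub>R \<xi>)))"
    using schwartz_affine[OF schwartz_of_real[OF a], of r 0] r by simp
  have [measurable]: "inv_fourier (\<lambda>\<xi>. complex_of_real (a (r *\<^sub>R \<xi>))) \<in> borel_measurable borel"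
    "band b T \<in> borel_measurable borel" "?a \<in> borel_measurable borel"
    by (intro schwartz_measurable schwartz_inv_fourier ar schwartz_of_real a borel_measurable_continuous_onI
        band_continuous T b)+
  have "band (\<lambda>\<xi>. a (r *\<^sub>R \<xi>) * b \<xi>) T x =
      (LINT t|lborel. inv_fourier (\<lambda>\<xi>. complex_of_real (a (r *\<^sub>R \<xi>))) t * band b T (x - t))"
    using mollify_kernel_mult[OF T ar schwartz_of_real[OF b], of x] by (simp add: band_def)
  also have "\<dots> = \<bar>r\<bar> ^ DIM(real^'n) *\<^sub>R (LINT t|lborel.
      inv_fourier (\<lambda>\<xi>. complex_of_real (a (r *\<^sub>R \<xi>))) (0 + r *\<^sub>R t) * band b T (x - (0 + r *\<^sub>R t)))"
    by (rule integral_affine) (use r in auto)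
  also have "\<dots> = (LINT t|lborel. \<bar>r\<bar> ^ DIM(real^'n) *\<^sub>R (
      inv_fourier (\<lambda>\<xi>. complex_of_real (a (r *\<^sub>R \<xi>))) (0 + r *\<^sub>R t) * band b T (x - (0 + r *\<^sub>R t))))"
    by (rule integral_scaleR_right[symmetric])
  also have "\<dots> = (LINT t|lborel. inv_fourier ?a t * band b T (x - r *\<^sub>R t))"
    using r by (simp add: inv_fourier_scaled[OF r, of ?a])
  finally show ?thesis .
qed

text \<open>The assumptions concern integrability and the kernels, not the symbols being Schwartz,
  because the summands will be products of two symbols, for which exactly these facts are at
  hand.\<close>

lemma band_sum:
  fixes a :: "'i \<Rightarrow> real^'n::finite \<Rightarrow> real"
  assumes T: "tempered_distribution T" and "finite I" "I \<noteq> {}"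
    and int: "\<And>i. i \<in> I \<Longrightarrow> integrable lborel (a i)"
    and sch: "\<And>i. i \<in> I \<Longrightarrow> schwartz (kernel (\<lambda>\<xi>. complex_of_real (a i \<xi>)))"
  shows "band (\<lambda>\<xi>. \<Sum>i\<in>I. a i \<xi>) T x = (\<Sum>i\<in>I. band (a i) T x)"
proof -
  have "fourier (\<lambda>\<xi>. \<Sum>i\<in>I. complex_of_real (a i \<xi>)) z = (\<Sum>i\<in>I. fourier (\<lambda>\<xi>. complex_of_real (a i \<xi>)) z)" for z
    unfolding fourier_altdef sum_distrib_right
    by (intro Bochner_Integration.integral_sum integrable_mult_kernel integrable_of_real int)
  then have "kernel (\<lambda>\<xi>. complex_of_real (\<Sum>i\<in>I. a i \<xi>)) = (\<lambda>z. \<Sum>i\<in>I. kernel (\<lambda>\<xi>. complex_of_real (a i \<xi>)) z)"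
    by (simp add: kernel_def fun_eq_iff sum_divide_distrib)
  then show ?thesis
    unfolding band_def mollify_def
    by (simp add: tempered_distribution_sum[OF T assms(2,3)] schwartz_shift sch)
qed

lemma schwartz_product_integrable:
  fixes a b :: "real^'n::finite \<Rightarrow> real"
  assumes "schwartz a" "schwartz b"
  shows "integrable lborel (\<lambda>\<xi>. a \<xi> * b \<xi>)"
proof -
  obtain B where B: "\<And>x. norm (a x) \<le> B" using schwartz_bound[OF assms(1), of 0] by auto
  have [measurable]: "a \<in> borel_measurable borel" "b \<in> borel_measurable borel"
    by (intro schwartz_measurable assms)+
  have le: "\<bar>a x * b x\<bar> \<le> B * \<bar>b x\<bar>" for x
    using mult_right_mono[OF B[of x], of "\<bar>b x\<bar>"] by (simp add: abs_mult)
  show ?thesis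
    by (rule Bochner_Integration.integrable_bound[OF integrable_mult_right[OF integrable_norm[OF schwartz_integrable[OF assms(2)]], of B]])
       (use le in \<open>auto intro!: AE_I2 order_trans[OF le abs_ge_self]\<close>)
qed

section \<open>Supports and overlaps of resolutions of unity\<close>

lemma sum_resolution_of_unity:
  assumes "resolution_of_unity \<phi>"
  shows "(\<Sum>i\<le>m. \<phi> i \<xi>) = \<phi> 0 ((1/2) ^ m *\<^sub>R \<xi>)"
proof (induction m)
  case (Suc m)
  have "\<phi> (Suc m) \<xi> = \<phi> 0 ((1/2) ^ Suc m *\<^sub>R \<xi>) - \<phi> 0 ((1/2) ^ m *\<^sub>R \<xi>)"
    using assms unfolding resolution_of_unity_def Let_def by simp
  with Suc show ?case by simp
qed simp

lemma bump_resolution_of_unity: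
  fixes \<phi> :: "nat \<Rightarrow> real^'n::finite \<Rightarrow> real"
  assumes "resolution_of_unity \<phi>"
  shows "bump (\<phi> 0)"
proof -
  have "\<phi> 0 \<xi> = 0" if "norm \<xi> > 3/2" for \<xi>
  proof (rule ccontr)
    assume "\<phi> 0 \<xi> \<noteq> 0"
    then have "\<xi> \<in> closure {\<xi>. \<phi> 0 \<xi> \<noteq> 0}" using closure_subset by fastforce
    with assms that show False unfolding resolution_of_unity_def by force
  qed
  then show ?thesis using assms unfolding bump_def resolution_of_unity_def by blast
qed

text \<open>The symbol of level \<open>j\<close> with its dilation removed. Only two functions occur
  as \<open>j\<close> varies, so a constant depending on the symbol can be made independent of
  \<open>j\<close> by a maximum of two.\<close>

definition ring_symbol :: "(nat \<Rightarrow> real^'n::finite \<Rightarrow> real) \<Rightarrow> nat \<Rightarrow> real^'n \<Rightarrow> real" where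
  "ring_symbol \<phi> j \<xi> = (if j = 0 then \<phi> 0 \<xi> else \<phi> 0 \<xi> - \<phi> 0 (2 *\<^sub>R \<xi>))"

lemma resolution_of_unity_dilation:
  assumes "resolution_of_unity \<phi>"
  shows "\<phi> j \<xi> = ring_symbol \<phi> j ((1/2) ^ j *\<^sub>R \<xi>)"
  using assms unfolding resolution_of_unity_def Let_def ring_symbol_def by (cases j) auto

lemma schwartz_ring_symbol:
  assumes "resolution_of_unity \<phi>"
  shows "schwartz (ring_symbol \<phi> j)"
proof -
  have s: "schwartz (\<phi> 0)" using bump_resolution_of_unity[OF assms] by (simp add: bump_def)
  then have "schwartz (\<lambda>\<xi>. \<phi> 0 \<xi> - \<phi> 0 (2 *\<^sub>R \<xi>))"
    using schwartz_affine[OF s, of 2 0] by (intro schwartz_diff) auto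
  with s show ?thesis unfolding ring_symbol_def[abs_def] by (cases j) auto
qed

lemma schwartz_resolution_of_unity:
  assumes "resolution_of_unity \<phi>"
  shows "schwartz (\<phi> j)"
proof -
  have eq: "\<phi> j = (\<lambda>\<xi>. ring_symbol \<phi> j ((1/2) ^ j *\<^sub>R \<xi>))"
    by (rule ext) (rule resolution_of_unity_dilation[OF assms])
  show ?thesis
    using schwartz_affine[OF schwartz_ring_symbol[OF assms, of j], of "(1/2) ^ j" 0]
    by (subst eq) simp
qed

lemma resolution_of_unity_support:
  assumes "resolution_of_unity \<phi>" "\<phi> j \<xi> \<noteq> 0"
  shows "norm \<xi> \<le> 3/2 * 2 ^ j" and "j \<ge> 1 \<Longrightarrow> 2 ^ j \<le> 2 * norm \<xi>"
proof -
  have b: "\<And>\<xi>. norm \<xi> \<le> 1 \<Longrightarrow> \<phi> 0 \<xi> = 1" "\<And>\<xi>. norm \<xi> > 3/2 \<Longrightarrow> \<phi> 0 \<xi> = 0"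
    using bump_resolution_of_unity[OF assms(1)] by (auto simp: bump_def)
  let ?\<eta> = "(1/2) ^ j *\<^sub>R \<xi>"
  have r: "ring_symbol \<phi> j ?\<eta> \<noteq> 0" using assms resolution_of_unity_dilation by metis
  have n: "norm ?\<eta> = norm \<xi> / 2 ^ j" by (simp add: power_one_over)
  have "norm ?\<eta> \<le> 3/2"
  proof (rule ccontr)
    assume "\<not> ?thesis"
    then have "norm ?\<eta> > 3/2" "norm (2 *\<^sub>R ?\<eta>) > 3/2" by (auto simp del: norm_ge_zero)
    then show False using r b(2) unfolding ring_symbol_def by (metis diff_zero)
  qed
  then show "norm \<xi> \<le> 3/2 * 2 ^ j" unfolding n by (simp add: field_simps)
  assume j: "j \<ge> 1"
  have "norm (2 *\<^sub>R ?\<eta>) > 1"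
  proof (rule ccontr)
    assume "\<not> ?thesis"
    then have "norm ?\<eta> \<le> 1" "norm (2 *\<^sub>R ?\<eta>) \<le> 1" by auto
    then have "\<phi> 0 ?\<eta> = 1" "\<phi> 0 (2 *\<^sub>R ?\<eta>) = 1" using b(1) by blast+
    with r j show False unfolding ring_symbol_def by simp
  qed
  moreover have "norm (2 *\<^sub>R ?\<eta>) = 2 * (norm \<xi> / 2 ^ j)" by (simp add: power_one_over)
  ultimately have "2 * (norm \<xi> / 2 ^ j) > 1" by simp
  then show "2 ^ j \<le> 2 * norm \<xi>" by (simp add: field_simps)
qed

text \<open>Where \<open>\<phi> j\<close> is nonzero, \<open>norm \<xi>\<close> is at most
  \<open>3/2 * 2 ^ j\<close>, so the telescoped sum of \<open>\<psi>\<close> up to level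
  \<open>j + 1\<close> is 1. For \<open>j\<close> at least 2, \<open>norm \<xi>\<close> also exceeds
  \<open>3/2 * 2 ^ (j - 2)\<close>, so the sum up to level \<open>j - 2\<close> vanishes; for
  smaller \<open>j\<close> that sum is empty, and for \<open>j = 0\<close> truncated subtraction
  leaves the levels 0 and 1.\<close>

lemma resolution_of_unity_overlap:
  assumes \<phi>: "resolution_of_unity \<phi>" and \<psi>: "resolution_of_unity \<psi>"
  shows "\<phi> j \<xi> = (\<Sum>i\<in>{j - 1..j + 1}. \<phi> j \<xi> * \<psi> i \<xi>)"
proof (cases "\<phi> j \<xi> = 0")
  case False
  note sup = resolution_of_unity_support[OF \<phi> False]
  have b: "\<And>\<xi>. norm \<xi> \<le> 1 \<Longrightarrow> \<psi> 0 \<xi> = 1" "\<And>\<xi>. norm \<xi> > 3/2 \<Longrightarrow> \<psi> 0 \<xi> = 0"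
    using bump_resolution_of_unity[OF \<psi>] by (auto simp: bump_def)
  have n: "norm ((1/2) ^ m *\<^sub>R \<xi>) = norm \<xi> / 2 ^ m" for m by (simp add: power_one_over)
  have "norm \<xi> \<le> 2 * 2 ^ j" using sup(1) zero_less_power[of "2::real" j] by linarith
  then have "norm \<xi> / 2 ^ (j + 1) \<le> 1" by (simp add: field_simps)
  then have top: "(\<Sum>i\<le>j + 1. \<psi> i \<xi>) = 1"
    unfolding sum_resolution_of_unity[OF \<psi>] by (intro b(1)) (simp only: n)
  have low: "(\<Sum>i<j - 1. \<psi> i \<xi>) = 0"
  proof (cases "j \<le> 1")
    case False
    then obtain m where m: "j = Suc (Suc m)" by (metis Suc_diff_Suc diff_zero less_Suc0 linorder_not_le not_less_eq One_nat_def Suc_lessD)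
    have "2 * 2 ^ m \<le> norm \<xi>" using sup(2) m by simp
    then have "3/2 * 2 ^ m < norm \<xi>" using zero_less_power[of "2::real" m] by linarith
    then have "norm \<xi> / 2 ^ m > 3/2" by (simp add: field_simps)
    then have "(\<Sum>i\<le>m. \<psi> i \<xi>) = 0"
      unfolding sum_resolution_of_unity[OF \<psi>] by (intro b(2)) (simp only: n)
    then show ?thesis by (simp add: m lessThan_Suc_atMost)
  qed auto
  have "(\<Sum>i\<le>j + 1. \<psi> i \<xi>) = (\<Sum>i<j - 1. \<psi> i \<xi>) + (\<Sum>i\<in>{j - 1..j + 1}. \<psi> i \<xi>)"
  proof -
    have "{..j + 1} = {..<j - 1} \<union> {j - 1..j + 1}" by auto
    then show ?thesis by (simp only:) (rule sum.union_disjoint; auto)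
  qed
  with top low have "(\<Sum>i\<in>{j - 1..j + 1}. \<psi> i \<xi>) = 1" by simp
  then show ?thesis unfolding sum_distrib_left[symmetric] by simp
qed simp

text \<open>The support of \<open>\<psi> i\<close> lies in the ball of radius
  \<open>3/2 * 2 ^ (j + 1)\<close>, hence in that of radius \<open>4 * 2 ^ j\<close>; this is the
  origin of \<open>1/4\<close>. The dilation follows \<open>j\<close> and not \<open>i\<close>, so
  that the reproducing formula and the decomposition of \<open>\<phi> j\<close> live at the same
  scale.\<close>

lemma resolution_of_unity_reproduce:
  assumes \<psi>: "resolution_of_unity \<psi>" and "i \<le> j + 1"
  shows "\<psi> i \<xi> = \<psi> 0 ((1/4) *\<^sub>R ((1/2) ^ j *\<^sub>R \<xi>)) * \<psi> i \<xi>"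
proof (cases "\<psi> i \<xi> = 0")
  case False
  have "norm \<xi> \<le> 3/2 * 2 ^ i" by (rule resolution_of_unity_support[OF \<psi> False])
  also have "\<dots> \<le> 3/2 * 2 ^ (j + 1)" using assms(2) by (intro mult_left_mono power_increasing) auto
  also have "\<dots> \<le> 4 * 2 ^ j" by simp
  finally have "norm ((1/4) *\<^sub>R ((1/2) ^ j *\<^sub>R \<xi>)) \<le> 1" by (simp add: power_one_over field_simps)
  then have "\<psi> 0 ((1/4) *\<^sub>R ((1/2) ^ j *\<^sub>R \<xi>)) = 1"
    using bump_resolution_of_unity[OF \<psi>] unfolding bump_def by blast
  then show ?thesis by simp
qed simp

lemma band_decompose:
  assumes T: "tempered_distribution T" and \<phi>: "resolution_of_unity \<phi>" and \<psi>: "resolution_of_unity \<psi>"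
  shows "band (\<phi> j) T x = (\<Sum>i\<in>{j - 1..j + 1}. (LINT t|lborel.
    inv_fourier (\<lambda>\<xi>. complex_of_real (ring_symbol \<phi> j \<xi>)) t * band (\<psi> i) T (x - (1/2) ^ j *\<^sub>R t)))"
proof -
  note s = schwartz_resolution_of_unity
  have "band (\<phi> j) T x = band (\<lambda>\<xi>. \<Sum>i\<in>{j - 1..j + 1}. \<phi> j \<xi> * \<psi> i \<xi>) T x"
    using resolution_of_unity_overlap[OF \<phi> \<psi>, of j] by (metis (no_types))
  also have "\<dots> = (\<Sum>i\<in>{j - 1..j + 1}. band (\<lambda>\<xi>. \<phi> j \<xi> * \<psi> i \<xi>) T x)"
    by (rule band_sum[OF T])
       (auto intro!: schwartz_product_integrable s \<phi> \<psi> schwartz_kernel_mult schwartz_of_real)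
  also have "\<dots> = (\<Sum>i\<in>{j - 1..j + 1}. band (\<lambda>\<xi>. ring_symbol \<phi> j ((1/2) ^ j *\<^sub>R \<xi>) * \<psi> i \<xi>) T x)"
    by (simp add: resolution_of_unity_dilation[OF \<phi>, symmetric])
  also have "\<dots> = (\<Sum>i\<in>{j - 1..j + 1}. (LINT t|lborel.
    inv_fourier (\<lambda>\<xi>. complex_of_real (ring_symbol \<phi> j \<xi>)) t * band (\<psi> i) T (x - (1/2) ^ j *\<^sub>R t)))"
    by (intro sum.cong refl band_mult T schwartz_ring_symbol \<phi> s \<psi>) simp
  finally show ?thesis .
qed

lemma band_reproduce:
  fixes \<psi> :: "nat \<Rightarrow> real^'n::finite \<Rightarrow> real"
  assumes T: "tempered_distribution T" and \<psi>: "resolution_of_unity \<psi>" and "i \<le> j + 1"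
  shows "band (\<psi> i) T x = (LINT t|lborel.
    inv_fourier (\<lambda>\<xi>. complex_of_real (\<psi> 0 ((1/4) *\<^sub>R \<xi>))) t * band (\<psi> i) T (x - (1/2) ^ j *\<^sub>R t))"
proof -
  have "band (\<psi> i) T x = band (\<lambda>\<xi>. \<psi> 0 ((1/4) *\<^sub>R ((1/2) ^ j *\<^sub>R \<xi>)) * \<psi> i \<xi>) T x"
    using resolution_of_unity_reproduce[OF \<psi> assms(3)] by (metis (no_types))
  also have "\<dots> = (LINT t|lborel.
    inv_fourier (\<lambda>\<xi>. complex_of_real (\<psi> 0 ((1/4) *\<^sub>R \<xi>))) t * band (\<psi> i) T (x - (1/2) ^ j *\<^sub>R t))"
    using schwartz_affine[OF schwartz_resolution_of_unity[OF \<psi>, of 0], of "1/4" 0]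
    by (intro band_mult[where a="\<lambda>\<xi>. \<psi> 0 ((1/4) *\<^sub>R \<xi>)", OF T _ schwartz_resolution_of_unity[OF \<psi>]]) auto
  finally show ?thesis .
qed

section \<open>Convolution estimates for all positive exponents\<close>

text \<open>The tangent line of the convex function \<open>f powr q\<close> at \<open>a\<close>,
  solved for \<open>f\<close>, with equality at \<open>f = a\<close>. Being linear in
  \<open>f powr q\<close>, it can be integrated termwise even when integrals are infinite.\<close>

lemma Youngs_tangent:
  fixes a f q :: real
  assumes "q \<ge> 1" "a > 0" "f \<ge> 0"
  shows "f \<le> a powr (1 - q) * f powr q / q + (1 - 1 / q) * a"
proof (cases "f = 0")
  case True
  then show ?thesis using assms by (simp add: field_simps)
next
  case False
  have "(f powr q) powr (1 / q) * (a powr q) powr (1 - 1 / q) \<le> 1 / q * f powr q + (1 - 1 / q) * a powr q"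
    by (rule Youngs_inequality_0) (use assms False in \<open>auto simp: field_simps\<close>)
  also have "(f powr q) powr (1 / q) * (a powr q) powr (1 - 1 / q) = f * a powr (q - 1)"
    using assms False by (simp add: powr_powr right_diff_distrib)
  finally have "(f * a powr (q - 1)) * a powr (1 - q) \<le> (1 / q * f powr q + (1 - 1 / q) * a powr q) * a powr (1 - q)"
    by (rule mult_right_mono) simp
  also have "(f * a powr (q - 1)) * a powr (1 - q) = f"
    using assms by (simp add: mult.assoc flip: powr_add)
  also have "(1 / q * f powr q + (1 - 1 / q) * a powr q) * a powr (1 - q) =
      a powr (1 - q) * f powr q / q + (1 - 1 / q) * (a powr q * a powr (1 - q))"
    by (simp add: algebra_simps)
  also have "a powr q * a powr (1 - q) = a" using assms by (simp flip: powr_add)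
  finally show ?thesis .
qed

text \<open>Jensen's inequality for the measure with density \<open>w\<close>, of which
  \<open>I\<close> bounds the mass. The real number \<open>F\<close> stands below the possibly
  infinite integral of \<open>f\<close>, which is how norms of convolution integrals will
  enter.\<close>

lemma powr_nn_integral_le:
  fixes w f :: "'a \<Rightarrow> real"
  assumes q: "q \<ge> 1" and [measurable]: "w \<in> borel_measurable M" "f \<in> borel_measurable M"
    and w: "\<And>x. w x \<ge> 0" and f: "\<And>x. f x \<ge> 0"
    and I: "integrable M w" "(LINT x|M. w x) \<le> I" "I > 0" and F: "F \<ge> 0" "ennreal F \<le> (\<integral>\<^sup>+x. ennreal (w x * f x) \<partial>M)"
  shows "ennreal (F powr q) \<le> ennreal (I powr (q - 1)) * (\<integral>\<^sup>+x. ennreal (w x * f x powr q) \<partial>M)"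
proof (cases "F = 0 \<or> (\<integral>\<^sup>+x. ennreal (w x * f x powr q) \<partial>M) = \<infinity>")
  case True
  then show ?thesis using q I by (auto simp: ennreal_mult_top)
next
  case False
  then have Fp: "F > 0" using F by simp
  define P where "P = (\<integral>\<^sup>+x. ennreal (w x * f x powr q) \<partial>M)"
  obtain p where p: "P = ennreal p" "p \<ge> 0" using False unfolding P_def by (metis ennreal_cases infinity_ennreal_def)
  \<comment> \<open>The tangent is taken at the mean value. Its constant term then integrates to at
    most \<open>(1 - 1 / q) * F\<close>, which is absorbed on the left.\<close>
  define a where "a = F / I"
  have a: "a > 0" using Fp I by (simp add: a_def)
  have c: "a powr (1 - q) / q \<ge> 0" "(1 - 1 / q) * a \<ge> 0" using q a by auto
  have "ennreal F \<le> (\<integral>\<^sup>+x. ennreal (w x * f x) \<partial>M)" by (rule F)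
  also have "\<dots> \<le> (\<integral>\<^sup>+x. ennreal (a powr (1 - q) / q) * ennreal (w x * f x powr q) + ennreal ((1 - 1 / q) * a) * ennreal (w x) \<partial>M)"
  proof (rule nn_integral_mono)
    fix x
    have "w x * f x \<le> w x * (a powr (1 - q) * f x powr q / q + (1 - 1 / q) * a)"
      by (intro mult_left_mono Youngs_tangent q a f w)
    also have "\<dots> = a powr (1 - q) / q * (w x * f x powr q) + ((1 - 1 / q) * a) * w x"
      by (simp add: algebra_simps)
    finally have "ennreal (w x * f x) \<le> ennreal (a powr (1 - q) / q * (w x * f x powr q) + ((1 - 1 / q) * a) * w x)"
      by (rule ennreal_leI)
    also have "\<dots> = ennreal (a powr (1 - q) / q) * ennreal (w x * f x powr q) + ennreal ((1 - 1 / q) * a) * ennreal (w x)"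
      unfolding ennreal_mult'[OF c(1), symmetric] ennreal_mult'[OF c(2), symmetric]
      by (rule ennreal_plus) (use c w[of x] in \<open>auto simp del: times_divide_eq_left\<close>)
    finally show "ennreal (w x * f x) \<le> ennreal (a powr (1 - q) / q) * ennreal (w x * f x powr q) + ennreal ((1 - 1 / q) * a) * ennreal (w x)" .
  qed
  also have "\<dots> = ennreal (a powr (1 - q) / q) * P + ennreal ((1 - 1 / q) * a) * ennreal (LINT x|M. w x)"
    using nn_integral_eq_integral[OF I(1)] w
    by (subst nn_integral_add) (auto simp: nn_integral_cmult P_def)
  also have "\<dots> \<le> ennreal (a powr (1 - q) / q) * ennreal p + ennreal ((1 - 1 / q) * a) * ennreal I"
    unfolding p by (intro add_left_mono mult_left_mono ennreal_leI I) simp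
  also have "\<dots> = ennreal (a powr (1 - q) / q * p + (1 - 1 / q) * a * I)"
    unfolding ennreal_mult'[OF c(1), symmetric] ennreal_mult'[OF c(2), symmetric]
    by (rule ennreal_plus[symmetric]) (use c p I in \<open>auto simp del: times_divide_eq_left\<close>)
  finally have "F \<le> a powr (1 - q) / q * p + (1 - 1 / q) * a * I"
    using q a p I by (subst (asm) ennreal_le_iff) (auto intro!: add_nonneg_nonneg mult_nonneg_nonneg)
  also have "(1 - 1 / q) * a * I = (1 - 1 / q) * F" using I by (simp add: a_def)
  finally have "F \<le> a powr (1 - q) * p" using q by (simp add: field_simps)
  then have "F * a powr (q - 1) \<le> a powr (1 - q) * p * a powr (q - 1)"
    by (rule mult_right_mono) simp
  also have "\<dots> = p" using a by (simp add: mult.commute mult.left_commute flip: powr_add)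
  finally have "F * a powr (q - 1) * I powr (q - 1) \<le> p * I powr (q - 1)" by (rule mult_right_mono) simp
  moreover have "F * a powr (q - 1) * I powr (q - 1) = F powr q"
    using Fp I(3) by (simp add: a_def powr_divide powr_diff)
  ultimately have "ennreal (F powr q) \<le> ennreal (I powr (q - 1) * p)" by (intro ennreal_leI) (simp add: mult.commute)
  then show ?thesis using p by (simp add: P_def[symmetric] ennreal_mult')
qed

definition poly_growth :: "(real^'n::finite \<Rightarrow> complex) \<Rightarrow> bool" where
  "poly_growth v \<longleftrightarrow> (\<exists>N A. \<forall>x. norm (v x) \<le> A * (1 + norm x) ^ N)"

lemma poly_growth_mono:
  assumes "norm (v x) \<le> A * (1 + norm x) ^ N" "N \<le> M"
  shows "norm (v x) \<le> \<bar>A\<bar> * (1 + norm x) ^ M"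
proof -
  have "norm (v x) \<le> \<bar>A\<bar> * (1 + norm x) ^ N" using assms(1) abs_ge_self[of A]
    by (meson mult_right_mono one_plus_norm_power_pos order_trans less_imp_le)
  also have "\<dots> \<le> \<bar>A\<bar> * (1 + norm x) ^ M" by (intro mult_left_mono power_increasing assms) auto
  finally show ?thesis .
qed

lemma conv_integrable:
  fixes \<kappa> :: "real^'n::finite \<Rightarrow> complex"
  assumes \<kappa>: "schwartz \<kappa>" and v: "continuous_on UNIV v" "poly_growth v"
  shows "integrable lborel (\<lambda>t. \<kappa> t * v (x - t))"
proof -
  obtain N A where A: "\<And>x. norm (v x) \<le> A * (1 + norm x) ^ N" using v(2) unfolding poly_growth_def by blast
  have A0: "A \<ge> 0" using A[of 0] by (simp add: order_trans[OF norm_ge_zero])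
  have [measurable]: "v \<in> borel_measurable borel" using v(1) by (rule borel_measurable_continuous_onI)
  have "integrable lborel (\<lambda>t. v (x - t) * \<kappa> t)"
  proof (rule schwartz_mult_integrable[OF \<kappa>, where A="A * (1 + norm x) ^ N" and N=N])
    fix t
    have "norm (v (x - t)) \<le> A * (1 + norm (x + (- t))) ^ N" using A by simp
    also have "\<dots> \<le> A * ((1 + norm x) ^ N * (1 + norm (- t)) ^ N)"
      by (intro mult_left_mono peetre_power A0)
    finally show "norm (v (x - t)) \<le> A * (1 + norm x) ^ N * (1 + norm t) ^ N" by (simp add: mult.assoc)
  qed measurable
  then show ?thesis by (simp add: mult.commute)
qed

lemma norm_conv_le:
  fixes \<kappa> :: "real^'n::finite \<Rightarrow> complex"
  assumes \<kappa>: "schwartz \<kappa>" and v: "continuous_on UNIV v" "poly_growth v"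
    and B: "\<And>t. norm (\<kappa> t) \<le> B * wt M t"
  shows "ennreal (norm (LINT t|lborel. \<kappa> t * v (x - t))) \<le> (\<integral>\<^sup>+t. ennreal (B * (wt M t * norm (v (x - t)))) \<partial>lborel)"
proof -
  have "ennreal (norm (LINT t|lborel. \<kappa> t * v (x - t))) \<le> (\<integral>\<^sup>+t. ennreal (norm (\<kappa> t * v (x - t))) \<partial>lborel)"
    by (rule integral_norm_bound_ennreal[OF conv_integrable[OF \<kappa> v]])
  also have "\<dots> \<le> (\<integral>\<^sup>+t. ennreal (B * (wt M t * norm (v (x - t)))) \<partial>lborel)"
    unfolding norm_mult mult.assoc[symmetric] by (intro nn_integral_mono ennreal_leI mult_right_mono B) auto
  finally show ?thesis .
qed

text \<open>The decay of \<open>\<kappa>\<close> is split: the integrable weight of exponent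
  \<open>2 * CARD('n)\<close> serves as the measure in Jensen's inequality, and \<open>wt L\<close>
  joins the integrand. There \<open>wt L t powr q\<close> is at most \<open>wt L t\<close>, because
  weights do not exceed 1.\<close>

lemma conv_powr_bound_ge_1:
  fixes \<kappa> :: "real^'n::finite \<Rightarrow> complex"
  assumes \<kappa>: "schwartz \<kappa>" and q: "q \<ge> 1"
  obtains C where "C > 0" "\<And>v x. continuous_on UNIV v \<Longrightarrow> poly_growth v \<Longrightarrow>
     ennreal (norm (LINT t|lborel. \<kappa> t * v (x - t)) powr q) \<le>
     ennreal C * (\<integral>\<^sup>+t. ennreal (wt L t * norm (v (x - t)) powr q) \<partial>lborel)"
proof -
  let ?n = "2 * CARD('n)"
  obtain B0 where B0: "\<And>t. norm (\<kappa> t) \<le> B0 * wt (?n + L) t" using schwartz_wt_bound[OF \<kappa>] by metis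
  define B where "B = max 1 B0"
  have B: "B > 0" "norm (\<kappa> t) \<le> B * wt (?n + L) t" for t
    using B0[of t] mult_right_mono[of B0 B "wt (?n + L) t"] by (auto simp: B_def)
  \<comment> \<open>The summand 1 gives positivity, as the mean value in Jensen's inequality divides
    by \<open>I\<close>.\<close>
  define I where "I = 1 + (LINT t::real^'n|lborel. wt ?n t)"
  have I: "I > 0" unfolding I_def by (intro add_pos_nonneg integral_nonneg_AE) auto
  show ?thesis
  proof (rule that[of "I powr (q - 1) * B powr q"])
    show "I powr (q - 1) * B powr q > 0" using I B by simp
    fix v :: "real^'n \<Rightarrow> complex" and x assume v: "continuous_on UNIV v" "poly_growth v"
    have [measurable]: "v \<in> borel_measurable borel" using v(1) by (rule borel_measurable_continuous_onI)
    let ?f = "\<lambda>t. B * (wt L t * norm (v (x - t)))"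
    have "ennreal (norm (LINT t|lborel. \<kappa> t * v (x - t)) powr q) \<le>
      ennreal (I powr (q - 1)) * (\<integral>\<^sup>+t. ennreal (wt ?n t * ?f t powr q) \<partial>lborel)"
    proof (rule powr_nn_integral_le[OF q])
      show "?f t \<ge> 0" for t using B by simp
      show "integrable lborel (wt ?n :: real^'n \<Rightarrow> real)" by (rule wt_integrable)
      show "ennreal (norm (LINT t|lborel. \<kappa> t * v (x - t))) \<le> (\<integral>\<^sup>+t. ennreal (wt ?n t * ?f t) \<partial>lborel)"
        using norm_conv_le[OF \<kappa> v B(2), of x] by (simp add: wt_add mult_ac)
    qed (use I in \<open>auto simp: I_def\<close>)
    also have "\<dots> \<le> ennreal (I powr (q - 1)) * (\<integral>\<^sup>+t. ennreal (B powr q) * ennreal (wt L t * norm (v (x - t)) powr q) \<partial>lborel)"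
    proof (intro mult_left_mono nn_integral_mono)
      fix t
      have "wt ?n t * ?f t powr q = B powr q * (wt ?n t * (wt L t powr q) * norm (v (x - t)) powr q)"
        using B by (simp add: powr_mult)
      also have "\<dots> \<le> B powr q * (1 * (wt L t powr 1) * norm (v (x - t)) powr q)"
        by (intro mult_left_mono mult_right_mono mult_mono powr_mono' wt_le_1 q) auto
      finally have "ennreal (wt ?n t * ?f t powr q) \<le> ennreal (B powr q * (wt L t * norm (v (x - t)) powr q))"
        by (intro ennreal_leI) (simp add: abs_of_nonneg)
      then show "ennreal (wt ?n t * ?f t powr q) \<le> ennreal (B powr q) * ennreal (wt L t * norm (v (x - t)) powr q)"
        by (simp add: ennreal_mult')
    qed simp
    also have "\<dots> = ennreal (I powr (q - 1) * B powr q) * (\<integral>\<^sup>+t. ennreal (wt L t * norm (v (x - t)) powr q) \<partial>lborel)"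
      by (subst nn_integral_cmult) (auto simp: ennreal_mult' mult.assoc)
    finally show "ennreal (norm (LINT t|lborel. \<kappa> t * v (x - t)) powr q) \<le>
      ennreal (I powr (q - 1) * B powr q) * (\<integral>\<^sup>+t. ennreal (wt L t * norm (v (x - t)) powr q) \<partial>lborel)" .
  qed
qed

section \<open>Exponents at most one: Peetre's maximal function\<close>

definition peetre_integral :: "(real^'n::finite \<Rightarrow> complex) \<Rightarrow> real \<Rightarrow> nat \<Rightarrow> real^'n \<Rightarrow> ennreal" where
  "peetre_integral v q M x = (\<integral>\<^sup>+z. ennreal ((wt M z * norm (v (x - z))) powr q) \<partial>lborel)"

text \<open>With \<open>S\<close> the supremum of \<open>h z = wt M z * norm (v (x - z))\<close>, the reproducing formula gives
  \<open>S \<le> B \<integral> h \<le> B S\<^bsup>1-q\<^esup> \<integral> h\<^bsup>q\<^esup>\<close>; the finiteness of \<open>S\<close> is needed to divide.\<close>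
lemma peetre_maximal_bound:
  fixes \<kappa> :: "real^'n::finite \<Rightarrow> complex"
  assumes \<kappa>: "schwartz \<kappa>" and q: "0 < q" "q \<le> 1" and B: "B \<ge> 0" "\<And>t. norm (\<kappa> t) \<le> B * wt M t"
    and v: "continuous_on UNIV v" "poly_growth v"
    and rep: "\<And>x. v x = (LINT t|lborel. \<kappa> t * v (x - t))"
    and bdd: "\<And>z. wt M z * norm (v (x - z)) \<le> S0"
    and J: "peetre_integral v q M x = ennreal J" "J \<ge> 0"
  shows "(wt M y * norm (v (x - y))) powr q \<le> B * J"
proof -
  have [measurable]: "v \<in> borel_measurable borel" using v(1) by (rule borel_measurable_continuous_onI)
  define h where "h = (\<lambda>z. wt M z * norm (v (x - z)))"
  have [measurable]: "h \<in> borel_measurable borel" unfolding h_def by measurable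
  have h0: "h z \<ge> 0" for z by (simp add: h_def)
  define S where "S = (SUP z. h z)"
  have bddh: "bdd_above (range h)" using bdd by (auto simp: h_def intro!: bdd_aboveI[of _ S0])
  have hS: "h z \<le> S" for z unfolding S_def by (rule cSUP_upper[OF UNIV_I bddh])
  have S0: "S \<ge> 0" using h0[of 0] hS[of 0] by linarith
  have key: "h y \<le> B * S powr (1 - q) * J" for y
  proof -
    have "ennreal (h y) = ennreal (wt M y) * ennreal (norm (LINT t|lborel. \<kappa> t * v (x - y - t)))"
      unfolding h_def by (subst rep) (simp add: ennreal_mult')
    also have "\<dots> \<le> ennreal (wt M y) * (\<integral>\<^sup>+t. ennreal (B * (wt M t * norm (v (x - y - t)))) \<partial>lborel)"
      by (intro mult_left_mono norm_conv_le \<kappa> v B) simp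
    also have "\<dots> = (\<integral>\<^sup>+t. ennreal (wt M y) * ennreal (B * (wt M t * norm (v (x - y - t)))) \<partial>lborel)"
      by (rule nn_integral_cmult[symmetric]) measurable
    also have "\<dots> \<le> (\<integral>\<^sup>+t. ennreal (B * h (y + t)) \<partial>lborel)"
    proof (rule nn_integral_mono)
      fix t
      have "wt M t * wt M y \<le> wt M (t + y)" using wt_shift(1)[of M "t + y" "- y"] by (simp add: wt_def)
      then have "B * norm (v (x - y - t)) * (wt M t * wt M y) \<le> B * norm (v (x - y - t)) * wt M (t + y)"
        by (intro mult_left_mono) (use B in auto)
      then have "wt M y * (B * (wt M t * norm (v (x - y - t)))) \<le> B * h (y + t)"
        by (simp add: h_def mult_ac add.commute diff_diff_eq)
      then show "ennreal (wt M y) * ennreal (B * (wt M t * norm (v (x - y - t)))) \<le> ennreal (B * h (y + t))"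
        by (subst ennreal_mult'[symmetric]) (auto intro: ennreal_leI)
    qed
    also have "\<dots> = (\<integral>\<^sup>+z. ennreal (B * h z) \<partial>lborel)" by (rule nn_integral_shift(1)) measurable
    also have "\<dots> \<le> (\<integral>\<^sup>+z. ennreal (B * S powr (1 - q)) * ennreal (h z powr q) \<partial>lborel)"
    proof (rule nn_integral_mono)
      fix z
      have "h z = h z powr (1 - q) * h z powr q" using h0[of z] q by (simp flip: powr_add)
      also have "\<dots> \<le> S powr (1 - q) * h z powr q"
        by (intro mult_right_mono powr_mono2 hS h0) (use q in auto)
      finally have "B * h z \<le> B * S powr (1 - q) * h z powr q" using B by (simp add: mult_left_mono mult.assoc)
      then show "ennreal (B * h z) \<le> ennreal (B * S powr (1 - q)) * ennreal (h z powr q)"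
        by (subst ennreal_mult'[symmetric]) (use B in \<open>auto intro: ennreal_leI\<close>)
    qed
    also have "\<dots> = ennreal (B * S powr (1 - q)) * ennreal J"
      by (subst nn_integral_cmult) (auto simp: J(1)[symmetric] peetre_integral_def h_def)
    also have "\<dots> = ennreal (B * S powr (1 - q) * J)"
      using B by (intro ennreal_mult'[symmetric]) auto
    finally show ?thesis using B J by (subst (asm) ennreal_le_iff) auto
  qed
  have "S \<le> B * S powr (1 - q) * J" unfolding S_def by (rule cSUP_least) (use key S_def in auto)
  have "S powr q \<le> B * J"
  proof (cases "S = 0")
    case False
    then have Sp: "S > 0" using S0 by simp
    have "S powr (1 - q) * S powr q = S" using Sp by (simp flip: powr_add)
    also have "\<dots> \<le> S powr (1 - q) * (B * J)" using \<open>S \<le> B * S powr (1 - q) * J\<close> by (simp add: mult_ac)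
    finally show ?thesis using Sp by (subst (asm) mult_le_cancel_left_pos) auto
  qed (use B J in simp)
  moreover have "h y powr q \<le> S powr q" by (intro powr_mono2 hS h0) (use q in auto)
  ultimately show ?thesis by (simp add: h_def)
qed

lemma peetre_integral_antimono:
  assumes "q > 0" "M \<le> N"
  shows "peetre_integral v q N x \<le> peetre_integral v q M x"
  unfolding peetre_integral_def using assms
  by (intro nn_integral_mono ennreal_leI powr_mono2 mult_right_mono wt_mono) auto

text \<open>Moving the centre costs a polynomial in the displacement. This makes finiteness at the
  single point \<open>x\<close> yield quantitative finiteness at every \<open>x - y\<close>.\<close>

lemma peetre_integral_shift:
  assumes q: "q > 0" and v: "continuous_on UNIV v"
  shows "peetre_integral v q M (x - y) \<le> ennreal (((1 + norm y) ^ M) powr q) * peetre_integral v q M x"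
proof -
  have [measurable]: "v \<in> borel_measurable borel" using v by (rule borel_measurable_continuous_onI)
  have "peetre_integral v q M (x - y) = (\<integral>\<^sup>+z. ennreal ((wt M ((y + z) - y) * norm (v (x - (y + z)))) powr q) \<partial>lborel)"
    unfolding peetre_integral_def by (simp add: diff_diff_eq)
  also have "\<dots> = (\<integral>\<^sup>+z. ennreal ((wt M (z - y) * norm (v (x - z))) powr q) \<partial>lborel)"
    by (rule nn_integral_shift(1)) measurable
  also have "\<dots> \<le> (\<integral>\<^sup>+z. ennreal (((1 + norm y) ^ M) powr q) * ennreal ((wt M z * norm (v (x - z))) powr q) \<partial>lborel)"
  proof (rule nn_integral_mono)
    fix z
    have "(wt M (z - y) * norm (v (x - z))) powr q \<le> ((1 + norm y) ^ M * (wt M z * norm (v (x - z)))) powr q"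
      using wt_shift(2)[of M z "-y"] q unfolding mult.assoc[symmetric]
      by (intro powr_mono2 mult_right_mono) auto
    also have "\<dots> = ((1 + norm y) ^ M) powr q * (wt M z * norm (v (x - z))) powr q" by (rule powr_mult)
    finally show "ennreal ((wt M (z - y) * norm (v (x - z))) powr q) \<le>
        ennreal (((1 + norm y) ^ M) powr q) * ennreal ((wt M z * norm (v (x - z))) powr q)"
      by (subst ennreal_mult'[symmetric]) (auto intro: ennreal_leI)
  qed
  also have "\<dots> = ennreal (((1 + norm y) ^ M) powr q) * peetre_integral v q M x"
    unfolding peetre_integral_def by (rule nn_integral_cmult) measurable
  finally show ?thesis .
qed

text \<open>The maximal bound needs a finite supremum, and \<open>v\<close> may outgrow the weight
  of exponent \<open>a\<close>. It is applied at every \<open>x - y\<close> with an exponent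
  \<open>N\<close> exceeding the growth of \<open>v\<close>; the constant \<open>D\<close> then
  depends on \<open>v\<close>, but the outcome, \<open>norm (v (x - y)) powr q\<close> bounded by a
  multiple of \<open>(1 + norm y) ^ a\<close> to the power \<open>q\<close>, proves the supremum for
  exponent \<open>a\<close> finite. A second application, with exponent \<open>a\<close>, has the
  constant \<open>B'\<close>, which depends only on \<open>\<kappa>'\<close>.\<close>

lemma conv_powr_bound_le_1:
  fixes \<kappa> \<kappa>' :: "real^'n::finite \<Rightarrow> complex"
  assumes \<kappa>: "schwartz \<kappa>" and \<kappa>': "schwartz \<kappa>'" and q: "0 < q" "q \<le> 1"
  obtains C where "C > 0" "\<And>v x. continuous_on UNIV v \<Longrightarrow> poly_growth v \<Longrightarrow>
     (\<And>x. v x = (LINT t|lborel. \<kappa>' t * v (x - t))) \<Longrightarrow>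
     ennreal (norm (LINT t|lborel. \<kappa> t * v (x - t)) powr q) \<le>
     ennreal C * (\<integral>\<^sup>+t. ennreal (wt L t * norm (v (x - t)) powr q) \<partial>lborel)"
proof -
  let ?n = "2 * CARD('n)"
  \<comment> \<open>Large enough that the \<open>q\<close>-th power of \<open>wt a\<close> is at
    most \<open>wt L\<close>, as \<open>q\<close> may be small.\<close>
  define a where "a = nat \<lceil>real L / q\<rceil>"
  have aL: "real L \<le> real a * q"
  proof -
    have "real L / q \<le> real a" unfolding a_def by linarith
    then show ?thesis using q by (simp add: field_simps)
  qed
  \<comment> \<open>Of the decay of \<open>\<kappa>\<close>, the part of exponent \<open>a\<close>
    pairs with \<open>v\<close> to form the maximal function, and the part of exponent
    \<open>2 * CARD('n)\<close> makes the integral converge.\<close>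
  obtain B where B: "B \<ge> 0" "\<And>t. norm (\<kappa> t) \<le> B * wt (a + ?n) t" using schwartz_wt_bound[OF \<kappa>] by metis
  obtain B' where B': "B' \<ge> 0" "\<And>t. norm (\<kappa>' t) \<le> B' * wt a t" using schwartz_wt_bound[OF \<kappa>'] by metis
  define I where "I = (LINT t::real^'n|lborel. wt ?n t)"
  have I: "I \<ge> 0" unfolding I_def by (intro integral_nonneg_AE) auto
  have Iw: "integral\<^sup>N lborel (\<lambda>t::real^'n. ennreal (wt ?n t)) = ennreal I"
    unfolding I_def by (rule nn_integral_eq_integral[OF wt_integrable]) simp
  define C where "C = 1 + (B * I) powr q * B'"
  have C: "C > 0" using B B' I by (simp add: C_def add_pos_nonneg)
  show ?thesis
  proof (rule that[OF C])
    fix v :: "real^'n \<Rightarrow> complex" and x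
    assume v: "continuous_on UNIV v" "poly_growth v" and rep: "\<And>x. v x = (LINT t|lborel. \<kappa>' t * v (x - t))"
    have [measurable]: "v \<in> borel_measurable borel" using v(1) by (rule borel_measurable_continuous_onI)
    let ?J = "\<integral>\<^sup>+t. ennreal (wt L t * norm (v (x - t)) powr q) \<partial>lborel"
    have le_J: "peetre_integral v q a x \<le> ?J"
      unfolding peetre_integral_def
    proof (intro nn_integral_mono ennreal_leI)
      fix t :: "real^'n"
      have "wt a t powr q \<le> wt L t"
      proof -
        have p: "1 + norm t > 0" by (rule add_pos_nonneg) auto
        have "(1 + norm t) ^ L = (1 + norm t) powr real L" using p by (simp add: powr_realpow)
        also have "\<dots> \<le> (1 + norm t) powr (real a * q)" by (intro powr_mono aL) simp
        also have "\<dots> = ((1 + norm t) ^ a) powr q" using p by (simp add: powr_powr[symmetric] powr_realpow)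
        finally show ?thesis by (simp add: wt_def powr_divide frac_le)
      qed
      then show "(wt a t * norm (v (x - t))) powr q \<le> wt L t * norm (v (x - t)) powr q"
        by (simp add: powr_mult mult_right_mono)
    qed
    show "ennreal (norm (LINT t|lborel. \<kappa> t * v (x - t)) powr q) \<le> ennreal C * ?J"
    proof (cases "?J = \<infinity>")
      case True
      then show ?thesis using C by (simp add: ennreal_mult_top)
    next
      case False
      then obtain J where J: "peetre_integral v q a x = ennreal J" "J \<ge> 0"
        using le_J by (metis ennreal_cases infinity_ennreal_def neq_top_trans)
      obtain N0 A0 where A0: "\<And>x. norm (v x) \<le> A0 * (1 + norm x) ^ N0" using v(2) unfolding poly_growth_def by blast
      define N where "N = max a N0"
      define A where "A = \<bar>A0\<bar>"
      have A: "A \<ge> 0" "norm (v x) \<le> A * (1 + norm x) ^ N" for x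
        unfolding A_def N_def by (simp, rule poly_growth_mono[of v x A0 N0, OF A0 max.cobounded2])
      obtain D where D: "D \<ge> 0" "\<And>t. norm (\<kappa>' t) \<le> D * wt N t" using schwartz_wt_bound[OF \<kappa>'] by metis
      have first: "norm (v (x - y)) powr q \<le> D * (((1 + norm y) ^ a) powr q * J)" for y
      proof -
        have fin: "peetre_integral v q N (x - y) \<le> ennreal (((1 + norm y) ^ a) powr q * J)"
        proof -
          have "peetre_integral v q N (x - y) \<le> peetre_integral v q a (x - y)" by (rule peetre_integral_antimono[OF q(1)]) (simp add: N_def)
          also have "\<dots> \<le> ennreal (((1 + norm y) ^ a) powr q) * ennreal J"
            unfolding J(1)[symmetric] by (rule peetre_integral_shift[OF q(1) v(1)])
          also have "\<dots> = ennreal (((1 + norm y) ^ a) powr q * J)" by (rule ennreal_mult'[symmetric]) simp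
          finally show ?thesis .
        qed
        then have "peetre_integral v q N (x - y) \<noteq> top" by (auto simp: top_unique)
        then obtain J' where J': "peetre_integral v q N (x - y) = ennreal J'" "J' \<ge> 0"
          by (cases "peetre_integral v q N (x - y)") auto
        have "wt N z * norm (v (x - y - z)) \<le> A * (1 + norm (x - y)) ^ N" for z
        proof -
          have "norm (v (x - y - z)) \<le> A * (1 + norm ((x - y) + (- z))) ^ N" using A(2)[of "x - y - z"] by simp
          also have "\<dots> \<le> A * ((1 + norm (x - y)) ^ N * (1 + norm (- z)) ^ N)"
            by (intro mult_left_mono peetre_power A(1))
          finally have "wt N z * norm (v (x - y - z)) \<le> wt N z * (A * ((1 + norm (x - y)) ^ N * (1 + norm z) ^ N))"
            by (intro mult_left_mono) auto
          also have "\<dots> = A * (1 + norm (x - y)) ^ N * (wt N z * (1 + norm z) ^ N)" by simp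
          finally show ?thesis by (simp only: wt_mult_power mult_1_right)
        qed
        \<comment> \<open>The centre is \<open>x - y\<close> and the displacement 0, where the
          weight equals 1.\<close>
        from peetre_maximal_bound[OF \<kappa>' q D v rep this J', of 0]
        have "norm (v (x - y)) powr q \<le> D * J'" by (simp add: wt_def)
        also have "\<dots> \<le> D * (((1 + norm y) ^ a) powr q * J)"
          using fin J' J by (intro mult_left_mono D) (simp add: ennreal_le_iff)
        finally show ?thesis .
      qed
      have "wt a z * norm (v (x - z)) \<le> (D * J) powr (1 / q)" for z
      proof -
        have "(wt a z * norm (v (x - z))) powr q = wt a z powr q * norm (v (x - z)) powr q"
          by (simp add: powr_mult)
        also have "\<dots> \<le> wt a z powr q * (D * (((1 + norm z) ^ a) powr q * J))"
          by (intro mult_left_mono first) simp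
        also have "\<dots> = D * J * (wt a z * (1 + norm z) ^ a) powr q" by (simp add: powr_mult)
        finally have "(wt a z * norm (v (x - z))) powr q \<le> D * J" by (simp add: wt_mult_power)
        then have "((wt a z * norm (v (x - z))) powr q) powr (1 / q) \<le> (D * J) powr (1 / q)"
          using q by (intro powr_mono2) auto
        then show ?thesis using q by (simp add: powr_powr)
      qed
      note fin = this
      have sup: "wt a y * norm (v (x - y)) \<le> (B' * J) powr (1 / q)" for y
      proof -
        have "((wt a y * norm (v (x - y))) powr q) powr (1 / q) \<le> (B' * J) powr (1 / q)"
          using q by (intro powr_mono2 peetre_maximal_bound[OF \<kappa>' q B' v rep fin J]) auto
        then show ?thesis using q by (simp add: powr_powr)
      qed
      have "ennreal (norm (LINT t|lborel. \<kappa> t * v (x - t))) \<le>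
          (\<integral>\<^sup>+t. ennreal (B * (wt (a + ?n) t * norm (v (x - t)))) \<partial>lborel)"
        by (rule norm_conv_le[OF \<kappa> v B(2)])
      also have "\<dots> \<le> integral\<^sup>N lborel (\<lambda>t::real^'n. ennreal (B * (B' * J) powr (1 / q)) * ennreal (wt ?n t))"
      proof (rule nn_integral_mono)
        fix t
        have "B * (wt (a + ?n) t * norm (v (x - t))) = (B * wt ?n t) * (wt a t * norm (v (x - t)))"
          by (simp add: wt_add)
        also have "\<dots> \<le> (B * wt ?n t) * (B' * J) powr (1 / q)"
          by (intro mult_left_mono sup) (simp add: B)
        finally have "B * (wt (a + ?n) t * norm (v (x - t))) \<le> B * (B' * J) powr (1 / q) * wt ?n t"
          by (simp add: mult_ac)
        then show "ennreal (B * (wt (a + ?n) t * norm (v (x - t)))) \<le> ennreal (B * (B' * J) powr (1 / q)) * ennreal (wt ?n t)"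
          by (subst ennreal_mult'[symmetric]) (use B in \<open>auto intro: ennreal_leI\<close>)
      qed
      also have "\<dots> = ennreal (B * (B' * J) powr (1 / q)) * ennreal I"
        by (subst nn_integral_cmult) (auto simp: Iw)
      also have "\<dots> = ennreal (B * (B' * J) powr (1 / q) * I)"
        using B by (intro ennreal_mult'[symmetric]) auto
      finally have "norm (LINT t|lborel. \<kappa> t * v (x - t)) \<le> B * (B' * J) powr (1 / q) * I"
        using B I by (subst (asm) ennreal_le_iff) auto
      then have "norm (LINT t|lborel. \<kappa> t * v (x - t)) powr q \<le> (B * (B' * J) powr (1 / q) * I) powr q"
        using q by (intro powr_mono2) auto
      also have "\<dots> = (B * I) powr q * (B' * J)"
        using B I B' J q by (simp add: powr_mult powr_powr)
      also have "\<dots> \<le> C * J" unfolding C_def using J by (simp add: distrib_right)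
      finally have "ennreal (norm (LINT t|lborel. \<kappa> t * v (x - t)) powr q) \<le> ennreal (C * J)" by (rule ennreal_leI)
      also have "\<dots> \<le> ennreal C * ?J"
        using C le_J J by (simp add: ennreal_mult' mult_left_mono)
      finally show ?thesis .
    qed
  qed
qed

text \<open>Both ranges of \<open>q\<close> are applied to
  \<open>\<lambda>y. v (r *\<^sub>R y)\<close> at the point \<open>x /\<^sub>R r\<close>. The
  dilated function satisfies the undilated reproducing formula, hence \<open>C\<close> does not
  depend on \<open>r\<close>, that is, on the dyadic level.\<close>

lemma conv_powr_bound:
  fixes \<kappa> \<kappa>' :: "real^'n::finite \<Rightarrow> complex"
  assumes \<kappa>: "schwartz \<kappa>" and \<kappa>': "schwartz \<kappa>'" and q: "0 < q"
  obtains C where "C > 0" "\<And>v r x. continuous_on UNIV v \<Longrightarrow> poly_growth v \<Longrightarrow> 0 < r \<Longrightarrow> r \<le> 1 \<Longrightarrow>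
     (\<And>x. v x = (LINT t|lborel. \<kappa>' t * v (x - r *\<^sub>R t))) \<Longrightarrow>
     ennreal (norm (LINT t|lborel. \<kappa> t * v (x - r *\<^sub>R t)) powr q) \<le>
     ennreal C * (\<integral>\<^sup>+t. ennreal (wt L t * norm (v (x - r *\<^sub>R t)) powr q) \<partial>lborel)"
proof -
  obtain C where C: "C > 0" "\<And>v x. continuous_on UNIV v \<Longrightarrow> poly_growth v \<Longrightarrow>
     (\<And>x. v x = (LINT t|lborel. \<kappa>' t * v (x - t))) \<Longrightarrow>
     ennreal (norm (LINT t|lborel. \<kappa> t * v (x - t)) powr q) \<le>
     ennreal C * (\<integral>\<^sup>+t. ennreal (wt L t * norm (v (x - t)) powr q) \<partial>lborel)"
  proof (cases "q \<le> 1")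
    case True
    show ?thesis by (rule conv_powr_bound_le_1[OF \<kappa> \<kappa>' q True, where L=L]) (fact that)
  next
    case False
    then have "q \<ge> 1" by simp
    have "\<exists>C>0. \<forall>v x. continuous_on UNIV v \<longrightarrow> poly_growth v \<longrightarrow>
       ennreal (norm (LINT t|lborel. \<kappa> t * v (x - t)) powr q) \<le>
       ennreal C * (\<integral>\<^sup>+t. ennreal (wt L t * norm (v (x - t)) powr q) \<partial>lborel)"
      by (rule conv_powr_bound_ge_1[OF \<kappa> \<open>q \<ge> 1\<close>, where L=L]) blast
    then obtain C where C: "C > 0" "\<And>v x. continuous_on UNIV v \<Longrightarrow> poly_growth v \<Longrightarrow>
       ennreal (norm (LINT t|lborel. \<kappa> t * v (x - t)) powr q) \<le>
       ennreal C * (\<integral>\<^sup>+t. ennreal (wt L t * norm (v (x - t)) powr q) \<partial>lborel)" by blast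
    show ?thesis by (rule that[OF C(1)]) (rule C(2))
  qed
  show ?thesis
  proof (rule that[OF C(1)])
    fix v :: "real^'n \<Rightarrow> complex" and r :: real and x
    assume v: "continuous_on UNIV v" "poly_growth v" and r: "0 < r" "r \<le> 1"
      and rep: "\<And>x. v x = (LINT t|lborel. \<kappa>' t * v (x - r *\<^sub>R t))"
    obtain N A where A: "\<And>x. norm (v x) \<le> A * (1 + norm x) ^ N" using v(2) unfolding poly_growth_def by blast
    have A0: "A \<ge> 0" using A[of 0] by (simp add: order_trans[OF norm_ge_zero])
    have "ennreal (norm (LINT t|lborel. \<kappa> t * v (r *\<^sub>R (x /\<^sub>R r - t))) powr q) \<le>
      ennreal C * (\<integral>\<^sup>+t. ennreal (wt L t * norm (v (r *\<^sub>R (x /\<^sub>R r - t))) powr q) \<partial>lborel)"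
    proof (rule C(2)[of "\<lambda>y. v (r *\<^sub>R y)"])
      show "continuous_on UNIV (\<lambda>y. v (r *\<^sub>R y))"
        by (intro continuous_on_compose2[OF v(1)] continuous_intros) auto
      show "poly_growth (\<lambda>y. v (r *\<^sub>R y))"
        unfolding poly_growth_def
      proof (intro exI allI)
        fix y
        have "norm (v (r *\<^sub>R y)) \<le> A * (1 + norm (r *\<^sub>R y)) ^ N" by (rule A)
        also have "\<dots> \<le> A * (1 + norm y) ^ N"
          using r mult_right_mono[of r 1 "norm y"] by (intro mult_left_mono power_mono A0) auto
        finally show "norm (v (r *\<^sub>R y)) \<le> A * (1 + norm y) ^ N" .
      qed
      show "v (r *\<^sub>R y) = (LINT t|lborel. \<kappa>' t * v (r *\<^sub>R (y - t)))" for y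
        using rep[of "r *\<^sub>R y"] by (simp add: scaleR_diff_right)
    qed
    then show "ennreal (norm (LINT t|lborel. \<kappa> t * v (x - r *\<^sub>R t)) powr q) \<le>
      ennreal C * (\<integral>\<^sup>+t. ennreal (wt L t * norm (v (x - r *\<^sub>R t)) powr q) \<partial>lborel)"
      using r by (simp add: scaleR_diff_right)
  qed
qed

section \<open>Dyadic cubes\<close>

lemma vec_nth_measurable [measurable]: "(\<lambda>x::real^'n::finite. x $ i) \<in> borel_measurable borel"
  by (intro borel_measurable_continuous_onI continuous_intros)

lemma dyadic_cube_sets [measurable]: "dyadic_cube k m \<in> sets borel"
  unfolding dyadic_cube_def by measurable

text \<open>The half-open cube lies between the open and the closed box with the same corners, and
  these have equal measure.\<close>

lemma emeasure_dyadic_cube: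
  fixes m :: "int^'n::finite"
  shows "emeasure lborel (dyadic_cube k m) = ennreal (((1/2) ^ k) ^ CARD('n))"
proof -
  define l u :: "real^'n" where "l = (\<chi> i. (1/2) ^ k * of_int (m $ i))" and "u = (\<chi> i. (1/2) ^ k * (of_int (m $ i) + 1))"
  have d: "(u - l) \<bullet> b = (1/2) ^ k" and le: "l \<bullet> b \<le> u \<bullet> b" if "b \<in> Basis" for b
  proof -
    have "\<exists>i. b = axis i 1" using that by (auto simp: Basis_vec_def)
    then obtain i where "b = axis i 1" by blast
    then show "(u - l) \<bullet> b = (1/2) ^ k" by (simp add: inner_axis l_def u_def algebra_simps)
    then have "u \<bullet> b - l \<bullet> b = (1/2) ^ k" by (simp add: inner_diff_left)
    moreover have "(0::real) \<le> (1/2) ^ k" by simp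
    ultimately show "l \<bullet> b \<le> u \<bullet> b" by linarith
  qed
  have "(\<Prod>b\<in>Basis. (u - l) \<bullet> b) = ((1/2) ^ k) ^ CARD('n)" using d by simp
  then have "emeasure lborel (box l u) = ennreal (((1/2) ^ k) ^ CARD('n))"
    "emeasure lborel (cbox l u) = ennreal (((1/2) ^ k) ^ CARD('n))"
    using le by (simp_all only: emeasure_lborel_box emeasure_lborel_cbox)
  moreover have "emeasure lborel (box l u) \<le> emeasure lborel (dyadic_cube k m)"
    by (rule emeasure_mono) (auto simp: mem_box_cart dyadic_cube_def l_def u_def less_imp_le)
  moreover have "emeasure lborel (dyadic_cube k m) \<le> emeasure lborel (cbox l u)"
    by (rule emeasure_mono) (auto simp: mem_box_cart dyadic_cube_def l_def u_def less_imp_le)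
  ultimately show ?thesis by simp
qed

text \<open>Needed because the estimate at level \<open>k\<close> involves level
  \<open>k - 1\<close>, which the energy of a cube of side \<open>2^(-k)\<close> does not include
  but that of its parent does. Integer division rounds down, so negative indices are
  covered.\<close>

lemma dyadic_cube_parent:
  "dyadic_cube (Suc k) m \<subseteq> dyadic_cube k (\<chi> i. m $ i div 2)"
proof
  fix x assume x: "x \<in> dyadic_cube (Suc k) m"
  show "x \<in> dyadic_cube k (\<chi> i. m $ i div 2)"
    unfolding dyadic_cube_def mem_Collect_eq
  proof
    fix i
    have "2 * (m $ i div 2) \<le> m $ i" "m $ i + 1 \<le> 2 * (m $ i div 2 + 1)" by presburger+
    then have "of_int (2 * (m $ i div 2)) \<le> (of_int (m $ i) :: real)"
      "of_int (m $ i + 1) \<le> (of_int (2 * (m $ i div 2 + 1)) :: real)"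
      unfolding of_int_le_iff .
    then have "2 * of_int (m $ i div 2) \<le> (of_int (m $ i) :: real)"
      "of_int (m $ i) + 1 \<le> 2 * (of_int (m $ i div 2) + 1 :: real)" by simp_all
    then have "(1/2) ^ Suc k * (2 * of_int (m $ i div 2)) \<le> (1/2) ^ Suc k * (of_int (m $ i) :: real)"
      "(1/2) ^ Suc k * (of_int (m $ i) + 1) \<le> (1/2) ^ Suc k * (2 * (of_int (m $ i div 2) + 1 :: real))"
      by (intro mult_left_mono; simp)+
    moreover have "(1/2) ^ Suc k * of_int (m $ i) \<le> x $ i" "x $ i < (1/2) ^ Suc k * (of_int (m $ i) + 1)"
      using x unfolding dyadic_cube_def by blast+
    ultimately have "(1/2) ^ Suc k * (2 * of_int (m $ i div 2)) \<le> x $ i"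
      "x $ i < (1/2) ^ Suc k * (2 * (of_int (m $ i div 2) + 1 :: real))" by linarith+
    moreover have "(1/2) ^ Suc k * (2 * z) = (1/2) ^ k * z" for z :: real by simp
    ultimately show "(1/2) ^ k * of_int ((\<chi> i. m $ i div 2) $ i) \<le> x $ i \<and>
        x $ i < (1/2) ^ k * (of_int ((\<chi> i. m $ i div 2) $ i) + 1)"
      by (simp only: vec_lambda_beta)
  qed
qed

definition near_cubes :: "nat \<Rightarrow> int^'n::finite \<Rightarrow> (int^'n) set" where
  "near_cubes R m = {l. \<forall>i. \<bar>l $ i - m $ i\<bar> \<le> int R}"

lemma near_cubes_card:
  fixes m :: "int^'n::finite"
  shows "finite (near_cubes R m)" "card (near_cubes R m) \<le> (2 * R + 1) ^ CARD('n)"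
proof -
  let ?P = "\<Pi>\<^sub>E i\<in>UNIV. {m $ i - int R..m $ i + int R}"
  have sub: "near_cubes R m \<subseteq> (\<lambda>f. \<chi> i. f i) ` ?P"
  proof
    fix l assume "l \<in> near_cubes R m"
    then have "(\<lambda>i. l $ i) \<in> ?P" by (auto simp: near_cubes_def abs_le_iff algebra_simps)
    then show "l \<in> (\<lambda>f. \<chi> i. f i) ` ?P" by (intro image_eqI[of _ _ "\<lambda>i. l $ i"]) auto
  qed
  have fin: "finite ?P" by (intro finite_PiE) auto
  then show "finite (near_cubes R m)" using sub by (meson finite_surj)
  have "card (near_cubes R m) \<le> card ?P" using sub fin by (meson card_image_le card_mono finite_imageI order_trans)
  also have "card ?P = (2 * R + 1) ^ CARD('n)"
  proof -
    have "card {m $ i - int R..m $ i + int R} = 2 * R + 1" for i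
      unfolding card_atLeastAtMost_int by linarith
    then show ?thesis by (simp add: card_PiE)
  qed
  finally show "card (near_cubes R m) \<le> (2 * R + 1) ^ CARD('n)" .
qed

lemma near_cubes_cover:
  fixes x y :: "real^'n::finite"
  assumes x: "x \<in> dyadic_cube k m" and y: "norm y \<le> (1/2) ^ k * real R"
  shows "\<exists>l\<in>near_cubes R m. x - y \<in> dyadic_cube k l"
proof -
  define l :: "int^'n" where "l = (\<chi> i. \<lfloor>2 ^ k * (x - y) $ i\<rfloor>)"
  have p: "(1/2) ^ k * 2 ^ k = (1::real)" and p': "2 ^ k * (1/2) ^ k = (1::real)" by (simp_all add: power_one_over)
  have "x - y \<in> dyadic_cube k l"
    unfolding dyadic_cube_def mem_Collect_eq
  proof
    fix i
    have "of_int (l $ i) \<le> 2 ^ k * (x - y) $ i" "2 ^ k * (x - y) $ i < of_int (l $ i) + 1"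
      unfolding l_def vec_lambda_beta by (rule of_int_floor_le, rule real_of_int_floor_add_one_gt)
    then have "(1/2) ^ k * of_int (l $ i) \<le> (1/2) ^ k * (2 ^ k * (x - y) $ i)"
       "(1/2) ^ k * (2 ^ k * (x - y) $ i) < (1/2) ^ k * (of_int (l $ i) + 1)"
      by (intro mult_left_mono mult_strict_left_mono; simp)+
    then show "(1/2) ^ k * of_int (l $ i) \<le> (x - y) $ i \<and> (x - y) $ i < (1/2) ^ k * (of_int (l $ i) + 1)"
      unfolding mult.assoc[symmetric] p by simp
  qed
  moreover have "l \<in> near_cubes R m"
    unfolding near_cubes_def mem_Collect_eq
  proof
    fix i
    have "\<bar>y $ i\<bar> \<le> (1/2) ^ k * real R" using component_le_norm_cart[of y i] y by linarith
    moreover have "(1/2) ^ k * of_int (m $ i) \<le> x $ i" "x $ i < (1/2) ^ k * (of_int (m $ i) + 1)"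
      using x unfolding dyadic_cube_def by blast+
    ultimately have "(1/2) ^ k * (of_int (m $ i) - real R) \<le> (x - y) $ i" "(x - y) $ i < (1/2) ^ k * (of_int (m $ i) + 1 + real R)"
      by (auto simp: algebra_simps abs_le_iff)
    then have "2 ^ k * ((1/2) ^ k * (of_int (m $ i) - real R)) \<le> 2 ^ k * (x - y) $ i"
       "2 ^ k * (x - y) $ i < 2 ^ k * ((1/2) ^ k * (of_int (m $ i) + 1 + real R))"
      by (intro mult_left_mono mult_strict_left_mono; simp)+
    then have "of_int (m $ i) - real R \<le> 2 ^ k * (x - y) $ i" "2 ^ k * (x - y) $ i < of_int (m $ i) + 1 + real R"
      unfolding mult.assoc[symmetric] p' by simp_all
    \<comment> \<open>The upper bound is strict because cubes are half open; over the integers it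
      yields \<open>l $ i\<close> at most \<open>m $ i + int R\<close>, so no further layer of cubes
      is needed.\<close>
    then have "m $ i - int R \<le> l $ i" "l $ i < m $ i + 1 + int R"
      unfolding l_def by (simp_all add: le_floor_iff floor_less_iff del: vector_minus_component)
    then show "\<bar>l $ i - m $ i\<bar> \<le> int R" by linarith
  qed
  ultimately show ?thesis by blast
qed

text \<open>The translate of a cube \<open>Q\<close> by \<open>2\<^bsup>-j\<^esup> t\<close>, where \<open>2\<^bsup>-j\<^esup>\<close> is at most the side length, is covered
  by a number of cubes of the same size that is polynomial in \<open>t\<close> and, together with the cubes
  themselves, independent of \<open>j\<close>.\<close>
lemma nn_integral_cube_translates:
  fixes H :: "nat \<Rightarrow> real^'n::finite \<Rightarrow> ennreal"
  assumes H [measurable]: "\<And>i. H i \<in> borel_measurable borel"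
    and A: "\<And>l. (\<integral>\<^sup>+x\<in>dyadic_cube k l. (\<Sum>i. H i x) \<partial>lborel) \<le> A" and t: "norm t \<le> real R"
  shows "(\<integral>\<^sup>+x\<in>dyadic_cube k m. (\<Sum>i. H i (x - (1/2) ^ (k + i) *\<^sub>R t)) \<partial>lborel) \<le> of_nat ((2 * R + 1) ^ CARD('n)) * A"
proof -
  let ?Q = "dyadic_cube k m" and ?c = "\<lambda>i. (1/2::real) ^ (k + i)"
  have "(\<integral>\<^sup>+x\<in>?Q. (\<Sum>i. H i (x - ?c i *\<^sub>R t)) \<partial>lborel) = (\<integral>\<^sup>+x. (\<Sum>i. H i (x - ?c i *\<^sub>R t) * indicator ?Q x) \<partial>lborel)"
    by simp
  also have "\<dots> = (\<Sum>i. (\<integral>\<^sup>+x. H i (x - ?c i *\<^sub>R t) * indicator ?Q x \<partial>lborel))"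
    by (rule nn_integral_suminf) measurable
  also have "\<dots> \<le> (\<Sum>i. (\<integral>\<^sup>+x. (\<Sum>l\<in>near_cubes R m. H i x * indicator (dyadic_cube k l) x) \<partial>lborel))"
  proof (intro suminf_le allI summableI)
    fix i
    have "(\<integral>\<^sup>+x. H i (x - ?c i *\<^sub>R t) * indicator ?Q x \<partial>lborel) =
        (\<integral>\<^sup>+x. H i ((?c i *\<^sub>R t + x) - ?c i *\<^sub>R t) * indicator ?Q (?c i *\<^sub>R t + x) \<partial>lborel)"
      by (rule nn_integral_shift(1)[symmetric]) measurable
    also have "\<dots> = (\<integral>\<^sup>+x. H i x * indicator ?Q (?c i *\<^sub>R t + x) \<partial>lborel)" by simp
    also have "\<dots> \<le> (\<integral>\<^sup>+x. (\<Sum>l\<in>near_cubes R m. H i x * indicator (dyadic_cube k l) x) \<partial>lborel)"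
    proof (rule nn_integral_mono)
      fix x
      show "H i x * indicator ?Q (?c i *\<^sub>R t + x) \<le> (\<Sum>l\<in>near_cubes R m. H i x * indicator (dyadic_cube k l) x)"
      proof (cases "?c i *\<^sub>R t + x \<in> ?Q")
        case True
        have "norm (?c i *\<^sub>R t) \<le> (1/2) ^ k * real R"
        proof -
          have "norm (?c i *\<^sub>R t) = (1/2) ^ k * ((1/2) ^ i * norm t)" by (simp add: power_add)
          also have "\<dots> \<le> (1/2) ^ k * (1 * real R)"
            by (intro mult_left_mono mult_mono t) (auto simp: power_le_one)
          finally show ?thesis by simp
        qed
        from near_cubes_cover[OF True this] obtain l where l: "l \<in> near_cubes R m" "x \<in> dyadic_cube k l" by auto
        then have "H i x * indicator ?Q (?c i *\<^sub>R t + x) = H i x * indicator (dyadic_cube k l) x" using True by simp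
        also have "\<dots> \<le> (\<Sum>l\<in>near_cubes R m. H i x * indicator (dyadic_cube k l) x)"
          by (rule member_le_sum[OF l(1)]) (auto intro: near_cubes_card)
        finally show ?thesis .
      qed simp
    qed
    finally show "(\<integral>\<^sup>+x. H i (x - ?c i *\<^sub>R t) * indicator ?Q x \<partial>lborel) \<le>
        (\<integral>\<^sup>+x. (\<Sum>l\<in>near_cubes R m. H i x * indicator (dyadic_cube k l) x) \<partial>lborel)" .
  qed
  also have "\<dots> = (\<integral>\<^sup>+x. (\<Sum>i. (\<Sum>l\<in>near_cubes R m. H i x * indicator (dyadic_cube k l) x)) \<partial>lborel)"
    by (rule nn_integral_suminf[symmetric]) measurable
  also have "\<dots> = (\<integral>\<^sup>+x. (\<Sum>l\<in>near_cubes R m. (\<Sum>i. H i x) * indicator (dyadic_cube k l) x) \<partial>lborel)"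
    by (subst suminf_sum) (auto intro: summableI)
  also have "\<dots> = (\<Sum>l\<in>near_cubes R m. (\<integral>\<^sup>+x\<in>dyadic_cube k l. (\<Sum>i. H i x) \<partial>lborel))"
    by (rule nn_integral_sum) measurable
  also have "\<dots> \<le> (\<Sum>l\<in>near_cubes R m. A)" by (intro sum_mono A)
  also have "\<dots> \<le> of_nat ((2 * R + 1) ^ CARD('n)) * A"
    using near_cubes_card(2)[of R m] by (simp add: mult_right_mono del: of_nat_power of_nat_add of_nat_mult)
  finally show ?thesis .
qed

text \<open>The exponent \<open>4 * CARD('n)\<close> consists of two halves. With \<open>R\<close>
  at most \<open>1 + norm t\<close> there are at most
  \<open>3 ^ CARD('n) * (1 + norm t) ^ CARD('n)\<close> covering cubes, a growth that one half
  outweighs; the other half is integrable.\<close>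

lemma nn_integral_cube_convolution:
  fixes H :: "nat \<Rightarrow> real^'n::finite \<Rightarrow> ennreal"
  assumes H [measurable]: "\<And>i. H i \<in> borel_measurable borel"
    and A: "\<And>l. (\<integral>\<^sup>+x\<in>dyadic_cube k l. (\<Sum>i. H i x) \<partial>lborel) \<le> A"
  shows "(\<integral>\<^sup>+x\<in>dyadic_cube k m. (\<Sum>i. (\<integral>\<^sup>+t. ennreal (wt (4 * CARD('n)) t) * H i (x - (1/2) ^ (k + i) *\<^sub>R t) \<partial>lborel)) \<partial>lborel)
     \<le> ennreal (3 ^ CARD('n) * (LINT t::real^'n|lborel. wt (2 * CARD('n)) t)) * A"
proof -
  let ?Q = "dyadic_cube k m" and ?c = "\<lambda>i. (1/2::real) ^ (k + i)" and ?w = "wt (4 * CARD('n)) :: real^'n \<Rightarrow> real"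
  have "(\<integral>\<^sup>+x\<in>?Q. (\<Sum>i. (\<integral>\<^sup>+t. ennreal (?w t) * H i (x - ?c i *\<^sub>R t) \<partial>lborel)) \<partial>lborel) =
      (\<integral>\<^sup>+x. (\<integral>\<^sup>+t. ennreal (?w t) * ((\<Sum>i. H i (x - ?c i *\<^sub>R t)) * indicator ?Q x) \<partial>lborel) \<partial>lborel)"
  proof (rule nn_integral_cong)
    fix x
    have "(\<Sum>i. (\<integral>\<^sup>+t. ennreal (?w t) * H i (x - ?c i *\<^sub>R t) \<partial>lborel)) =
        (\<integral>\<^sup>+t. (\<Sum>i. ennreal (?w t) * H i (x - ?c i *\<^sub>R t)) \<partial>lborel)"
      by (rule nn_integral_suminf[symmetric]) measurable
    also have "\<dots> * indicator ?Q x = (\<integral>\<^sup>+t. (\<Sum>i. ennreal (?w t) * H i (x - ?c i *\<^sub>R t)) * indicator ?Q x \<partial>lborel)"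
      by (rule nn_integral_multc[symmetric]) measurable
    finally show "(\<Sum>i. (\<integral>\<^sup>+t. ennreal (?w t) * H i (x - ?c i *\<^sub>R t) \<partial>lborel)) * indicator ?Q x =
        (\<integral>\<^sup>+t. ennreal (?w t) * ((\<Sum>i. H i (x - ?c i *\<^sub>R t)) * indicator ?Q x) \<partial>lborel)"
      by (simp add: mult.assoc)
  qed
  also have "\<dots> = (\<integral>\<^sup>+t. (\<integral>\<^sup>+x. ennreal (?w t) * ((\<Sum>i. H i (x - ?c i *\<^sub>R t)) * indicator ?Q x) \<partial>lborel) \<partial>lborel)"
    by (rule lborel_pair.Fubini') measurable
  also have "\<dots> = (\<integral>\<^sup>+t. ennreal (?w t) * (\<integral>\<^sup>+x\<in>?Q. (\<Sum>i. H i (x - ?c i *\<^sub>R t)) \<partial>lborel) \<partial>lborel)"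
    by (intro nn_integral_cong nn_integral_cmult) measurable
  also have "\<dots> \<le> integral\<^sup>N lborel (\<lambda>t::real^'n. (ennreal (3 ^ CARD('n)) * A) * ennreal (wt (2 * CARD('n)) t))"
  proof (rule nn_integral_mono)
    fix t :: "real^'n"
    define R where "R = nat \<lceil>norm t\<rceil>"
    have R: "norm t \<le> real R" "real R \<le> 1 + norm t" unfolding R_def using norm_ge_zero[of t] by linarith+
    have "ennreal (?w t) * (\<integral>\<^sup>+x\<in>?Q. (\<Sum>i. H i (x - ?c i *\<^sub>R t)) \<partial>lborel) \<le>
        ennreal (?w t) * (of_nat ((2 * R + 1) ^ CARD('n)) * A)"
      by (intro mult_left_mono nn_integral_cube_translates H A R) simp
    also have "\<dots> = ennreal (?w t * real ((2 * R + 1) ^ CARD('n))) * A"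
      by (simp add: ennreal_mult' ennreal_of_nat_eq_real_of_nat mult.assoc del: of_nat_power of_nat_add of_nat_mult)
    also have "\<dots> \<le> ennreal (3 ^ CARD('n) * wt (2 * CARD('n)) t) * A"
    proof (intro mult_right_mono ennreal_leI)
      have "0 \<le> norm t" by simp
      with R(2) have R3: "2 * real R + 1 \<le> 3 * (1 + norm t)" unfolding distrib_left by linarith
      have "real ((2 * R + 1) ^ CARD('n)) = (2 * real R + 1) ^ CARD('n)" by (simp add: add.commute)
      also have "\<dots> \<le> (3 * (1 + norm t)) ^ CARD('n)" using R3 by (intro power_mono) simp_all
      also have "\<dots> = 3 ^ CARD('n) * (1 + norm t) ^ CARD('n)" by (rule power_mult_distrib)
      also have "\<dots> \<le> 3 ^ CARD('n) * (1 + norm t) ^ (2 * CARD('n))"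
        by (intro mult_left_mono power_increasing) auto
      finally have "?w t * real ((2 * R + 1) ^ CARD('n)) \<le>
          (wt (2 * CARD('n)) t * wt (2 * CARD('n)) t) * (3 ^ CARD('n) * (1 + norm t) ^ (2 * CARD('n)))"
        unfolding wt_add[symmetric] by (simp add: mult_left_mono flip: mult_2)
      also have "\<dots> = 3 ^ CARD('n) * wt (2 * CARD('n)) t * (wt (2 * CARD('n)) t * (1 + norm t) ^ (2 * CARD('n)))"
        by simp
      finally show "?w t * real ((2 * R + 1) ^ CARD('n)) \<le> 3 ^ CARD('n) * wt (2 * CARD('n)) t"
        by (simp only: wt_mult_power mult_1_right)
    qed simp
    also have "\<dots> = (ennreal (3 ^ CARD('n)) * A) * ennreal (wt (2 * CARD('n)) t)"
      by (subst ennreal_mult') (auto simp: mult_ac)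
    finally show "ennreal (?w t) * (\<integral>\<^sup>+x\<in>?Q. (\<Sum>i. H i (x - ?c i *\<^sub>R t)) \<partial>lborel) \<le>
      (ennreal (3 ^ CARD('n)) * A) * ennreal (wt (2 * CARD('n)) t)" .
  qed
  also have "\<dots> = (ennreal (3 ^ CARD('n)) * A) * ennreal (LINT t::real^'n|lborel. wt (2 * CARD('n)) t)"
    by (subst nn_integral_cmult) (auto simp: nn_integral_eq_integral[OF wt_integrable])
  also have "\<dots> = ennreal (3 ^ CARD('n) * (LINT t::real^'n|lborel. wt (2 * CARD('n)) t)) * A"
    by (subst ennreal_mult') (auto simp: mult_ac)
  finally show ?thesis .
qed

section \<open>Weights and sums over neighbouring levels\<close>

text \<open>For \<open>j\<close> at least 1, \<open>Suc j\<close> lies between \<open>j\<close> and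
  \<open>2 * j\<close>, so monotonicity passes the doubling condition on to consecutive levels. At
  \<open>j = 0\<close> that condition compares \<open>w 1\<close> with itself, which is why
  \<open>\<rho>\<close> contains the two quotients of \<open>a 0\<close> and
  \<open>a 1\<close>.\<close>

lemma admissible_ratio:
  assumes "admissible w"
  obtains \<rho> where "\<rho> \<ge> 1" "\<And>j. w ((1/2) ^ Suc j) \<le> \<rho> * w ((1/2) ^ j)" "\<And>j. w ((1/2) ^ j) \<le> \<rho> * w ((1/2) ^ Suc j)"
proof -
  define a where "a = (\<lambda>j::nat. w ((1/2) ^ j))"
  have mem: "(1/2::real) ^ j \<in> {0<..1}" for j by (simp add: power_le_one)
  have pos: "a j > 0" for j using assms mem[of j] unfolding admissible_def a_def by blast
  obtain c d where cd: "c > 0" "d > 0" "\<And>j. c * a j \<le> a (2 * j)" "\<And>j. a (2 * j) \<le> d * a j"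
    using assms unfolding admissible_def a_def by blast
  have dec: "(1/2::real) ^ i \<le> (1/2) ^ j" if "j \<le> i" for i j using that by (intro power_decreasing) auto
  have mono: "(\<forall>i j. j \<le> i \<longrightarrow> a i \<le> a j) \<or> (\<forall>i j. j \<le> i \<longrightarrow> a j \<le> a i)"
    using assms dec mem unfolding admissible_def monotone_on_def a_def by blast
  define \<rho> where "\<rho> = 1 + 1 / c + d + a 0 / a 1 + a 1 / a 0"
  have \<rho>: "1 \<le> \<rho>" "1 / c \<le> \<rho>" "d \<le> \<rho>" "a 0 / a 1 \<le> \<rho>" "a 1 / a 0 \<le> \<rho>"
    unfolding \<rho>_def using cd(1,2) pos[of 0] pos[of 1] by (auto intro!: add_increasing add_increasing2 add_nonneg_nonneg)
  have "a (Suc j) \<le> \<rho> * a j \<and> a j \<le> \<rho> * a (Suc j)" for j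
  proof -
    have one: "a i \<le> \<rho> * a i" for i using mult_right_mono[OF \<rho>(1), of "a i"] pos[of i] by simp
    show ?thesis
    proof (cases "j = 0")
      case True
      have "a 1 / a 0 * a 0 \<le> \<rho> * a 0" "a 0 / a 1 * a 1 \<le> \<rho> * a 1"
        by (intro mult_right_mono \<rho>; use pos in \<open>simp add: less_imp_le\<close>)+
      then show ?thesis using True pos[of 0] pos[of 1] by simp
    next
      case False
      then have j: "Suc j \<le> 2 * j" by simp
      from mono show ?thesis
      proof
        assume m: "\<forall>i j. j \<le> i \<longrightarrow> a i \<le> a j"
        have "c * a j \<le> a (Suc j)" using cd(3)[of j] m j by (meson order_trans)
        then have "a j \<le> 1 / c * a (Suc j)" using cd(1) by (simp add: field_simps)
        also have "\<dots> \<le> \<rho> * a (Suc j)" by (intro mult_right_mono \<rho>) (use pos in \<open>simp add: less_imp_le\<close>)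
        finally have "a j \<le> \<rho> * a (Suc j)" .
        moreover have "a (Suc j) \<le> a j" using m by simp
        ultimately show ?thesis using one[of j] by linarith
      next
        assume m: "\<forall>i j. j \<le> i \<longrightarrow> a j \<le> a i"
        have "a (Suc j) \<le> d * a j" using cd(4)[of j] m j by (meson order_trans)
        also have "\<dots> \<le> \<rho> * a j" by (intro mult_right_mono \<rho>) (use pos in \<open>simp add: less_imp_le\<close>)
        finally have "a (Suc j) \<le> \<rho> * a j" .
        moreover have "a j \<le> a (Suc j)" using m by simp
        ultimately show ?thesis using one[of "Suc j"] by linarith
      qed
    qed
  qed
  then show ?thesis using that[OF \<rho>(1)] unfolding a_def by blast
qed

definition level_weight :: "real \<Rightarrow> (real \<Rightarrow> real) \<Rightarrow> real \<Rightarrow> nat \<Rightarrow> real" where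
  "level_weight s w q j = 2 powr (s * real j * q) * w ((1/2) ^ j) powr q"

lemma level_weight_pos:
  assumes "admissible w"
  shows "level_weight s w q j > 0"
proof -
  have "(1/2::real) ^ j \<in> {0<..1}" by (simp add: power_le_one)
  then have "w ((1/2) ^ j) > 0" using assms unfolding admissible_def by blast
  then show ?thesis by (simp add: level_weight_def)
qed

lemma level_weight_ratio:
  assumes w: "admissible w" and q: "q > 0"
  obtains \<rho> where "\<rho> \<ge> 1" "\<And>i j. i \<in> {j - 1..j + 1} \<Longrightarrow> level_weight s w q j \<le> \<rho> * level_weight s w q i"
proof -
  obtain r where r: "r \<ge> 1" "\<And>j. w ((1/2) ^ Suc j) \<le> r * w ((1/2) ^ j)" "\<And>j. w ((1/2) ^ j) \<le> r * w ((1/2) ^ Suc j)"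
    using admissible_ratio[OF w] by metis
  have pos: "w ((1/2) ^ j) > 0" for j
  proof -
    have "(1/2::real) ^ j \<in> {0<..1}" by (simp add: power_le_one)
    then show ?thesis using w unfolding admissible_def by blast
  qed
  define \<rho> where "\<rho> = 2 powr (\<bar>s\<bar> * q) * r powr q"
  have \<rho>: "\<rho> \<ge> 1"
  proof -
    have "1 * 1 \<le> 2 powr (\<bar>s\<bar> * q) * r powr q"
      using q r(1) by (intro mult_mono ge_one_powr_ge_zero) auto
    then show ?thesis by (simp add: \<rho>_def)
  qed
  have aux: "level_weight s w q j \<le> \<rho> * level_weight s w q i"
    if "s * real j \<le> s * real i + \<bar>s\<bar>" "w ((1/2) ^ j) \<le> r * w ((1/2) ^ i)" for i j
  proof -
    have "s * real j * q \<le> \<bar>s\<bar> * q + s * real i * q"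
      using mult_right_mono[OF that(1), of q] q by (simp add: distrib_right)
    then have "2 powr (s * real j * q) \<le> 2 powr (\<bar>s\<bar> * q + s * real i * q)" by (intro powr_mono) auto
    moreover have "w ((1/2) ^ j) powr q \<le> (r * w ((1/2) ^ i)) powr q"
      using q pos[of j] by (intro powr_mono2 that) auto
    ultimately have "level_weight s w q j \<le> 2 powr (\<bar>s\<bar> * q + s * real i * q) * (r * w ((1/2) ^ i)) powr q"
      unfolding level_weight_def by (intro mult_mono) auto
    also have "\<dots> = \<rho> * level_weight s w q i"
      by (simp add: \<rho>_def level_weight_def powr_add powr_mult mult_ac)
    finally show ?thesis .
  qed
  have "level_weight s w q j \<le> \<rho> * level_weight s w q i" if "i \<in> {j - 1..j + 1}" for i j
  proof -
    have "i = j \<or> i = Suc j \<or> j = Suc i" using that by auto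
    then consider "i = j" | "i = Suc j" | "j = Suc i" by blast
    then show ?thesis
    proof cases
      case 1
      then show ?thesis using mult_right_mono[OF \<rho>, of "level_weight s w q j"] level_weight_pos[OF w, of s q j] by simp
    next
      case 2
      show ?thesis by (rule aux) (use 2 r(3)[of j] in \<open>auto simp: distrib_left\<close>)
    next
      case 3
      show ?thesis by (rule aux) (use 3 r(2)[of i] in \<open>auto simp: distrib_left\<close>)
    qed
  qed
  with \<rho> show ?thesis using that by blast
qed

text \<open>Bounding the sum by the number of terms times the largest one treats all positive
  exponents alike, convex or concave.\<close>

lemma powr_sum_le:
  fixes a :: "'i \<Rightarrow> real"
  assumes "finite I" "\<And>i. i \<in> I \<Longrightarrow> a i \<ge> 0" "q > 0"
  shows "(\<Sum>i\<in>I. a i) powr q \<le> real (card I) powr q * (\<Sum>i\<in>I. a i powr q)"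
proof (cases "I = {}")
  case False
  define M where "M = Max (a ` I)"
  have M: "M \<in> a ` I" unfolding M_def using assms(1) False by (intro Max_in) auto
  then obtain k where k: "k \<in> I" "M = a k" by auto
  have "(\<Sum>i\<in>I. a i) \<le> (\<Sum>i\<in>I. M)" unfolding M_def using assms(1) by (intro sum_mono Max_ge) auto
  then have "(\<Sum>i\<in>I. a i) powr q \<le> (real (card I) * M) powr q"
    using assms by (intro powr_mono2 sum_nonneg) auto
  also have "\<dots> = real (card I) powr q * a k powr q" by (simp add: powr_mult k)
  also have "\<dots> \<le> real (card I) powr q * (\<Sum>i\<in>I. a i powr q)"
    using assms k by (intro mult_left_mono member_le_sum) auto
  finally show ?thesis .
qed simp

lemma suminf_reindex_le:
  fixes f :: "nat \<Rightarrow> ennreal"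
  assumes "inj_on h {i. P i}"
  shows "(\<Sum>i. if P i then f (h i) else 0) \<le> (\<Sum>i. f i)"
proof (rule suminf_le_const[OF summableI])
  fix n
  have "(\<Sum>i<n. if P i then f (h i) else 0) = (\<Sum>i\<in>{i. i < n \<and> P i}. f (h i))"
    by (intro sum.mono_neutral_cong_right) auto
  also have "\<dots> = sum f (h ` {i. i < n \<and> P i})"
    using assms by (subst sum.reindex) (auto simp: inj_on_def)
  also have "\<dots> \<le> (\<Sum>i. f i)" by (intro sum_le_suminf summableI) auto
  finally show "(\<Sum>i<n. if P i then f (h i) else 0) \<le> (\<Sum>i. f i)" .
qed

text \<open>Each level is a neighbour of at most three others. The sum on the right starts one level
  lower, at the level of the parent cube, or at 0 when \<open>k = 0\<close>.\<close>

lemma suminf_neighbours_le: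
  fixes g :: "nat \<Rightarrow> ennreal"
  shows "(\<Sum>i. (\<Sum>l\<in>{k + i - 1..k + i + 1}. g l)) \<le> 3 * (\<Sum>i. g (k - 1 + i))"
proof -
  let ?G = "\<lambda>i. g (k - 1 + i)"
  \<comment> \<open>The three summands are the lower, equal and upper neighbours, each an injective
    reindexing of one series. Removing the lower neighbour when \<open>k + i = 0\<close> is
    essential: for \<open>k = 0\<close>, truncated subtraction would send both \<open>i = 0\<close>
    and \<open>i = 1\<close> to index 0. The trivial conditions fit the others to
    \<open>suminf_reindex_le\<close>.\<close>
  have "(\<Sum>i. (\<Sum>l\<in>{k + i - 1..k + i + 1}. g l)) \<le>
    (\<Sum>i. (if k + i \<noteq> 0 then ?G (k + i - 1 - (k - 1)) else 0) + (if True then ?G (k + i - (k - 1)) else 0)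
       + (if True then ?G (k + i + 1 - (k - 1)) else 0))"
  proof (intro suminf_le allI summableI)
    fix i
    show "(\<Sum>l\<in>{k + i - 1..k + i + 1}. g l) \<le>
      (if k + i \<noteq> 0 then ?G (k + i - 1 - (k - 1)) else 0) + (if True then ?G (k + i - (k - 1)) else 0)
       + (if True then ?G (k + i + 1 - (k - 1)) else 0)"
    proof (cases "k + i = 0")
      case True
      then have "{k + i - 1..k + i + 1} = {0, 1}" by auto
      then show ?thesis using True by simp
    next
      case False
      then have "{k + i - 1..k + i + 1} = {k + i - 1, k + i, k + i + 1}" by auto
      then have "(\<Sum>l\<in>{k + i - 1..k + i + 1}. g l) = g (k + i - 1) + g (k + i) + g (k + i + 1)"
      proof -
        obtain p where p: "k + i = Suc p" using False not0_implies_Suc by blast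
        have "{p..Suc (Suc p)} = {p, Suc p, Suc (Suc p)}" by auto
        then show ?thesis by (simp add: p add.assoc)
      qed
      moreover have "k - 1 + (k + i - 1 - (k - 1)) = k + i - 1" "k - 1 + (k + i - (k - 1)) = k + i"
        "k - 1 + (k + i + 1 - (k - 1)) = k + i + 1" by auto
      ultimately show ?thesis using False by (simp only: if_True simp_thms if_not_P order_refl)
    qed
  qed
  also have "\<dots> = (\<Sum>i. (if k + i \<noteq> 0 then ?G (k + i - 1 - (k - 1)) else 0)) + (\<Sum>i. if True then ?G (k + i - (k - 1)) else 0)
       + (\<Sum>i. if True then ?G (k + i + 1 - (k - 1)) else 0)"
    by (simp only: suminf_add[OF summableI summableI, symmetric])
  also have "\<dots> \<le> (\<Sum>i. ?G i) + (\<Sum>i. ?G i) + (\<Sum>i. ?G i)"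
  proof (intro add_mono)
    show "(\<Sum>i. (if k + i \<noteq> 0 then ?G (k + i - 1 - (k - 1)) else 0)) \<le> (\<Sum>i. ?G i)"
      by (rule suminf_reindex_le[where f="?G" and h="\<lambda>i. k + i - 1 - (k - 1)"]) (auto simp: inj_on_def)
    show "(\<Sum>i. if True then ?G (k + i - (k - 1)) else 0) \<le> (\<Sum>i. ?G i)"
      by (rule suminf_reindex_le[where f="?G" and h="\<lambda>i. k + i - (k - 1)"]) (auto simp: inj_on_def)
    show "(\<Sum>i. if True then ?G (k + i + 1 - (k - 1)) else 0) \<le> (\<Sum>i. ?G i)"
      by (rule suminf_reindex_le[where f="?G" and h="\<lambda>i. k + i + 1 - (k - 1)"]) (auto simp: inj_on_def)
  qed
  also have "\<dots> = (1 + 1 + 1) * (\<Sum>i. ?G i)" by (simp only: distrib_right mult_1_left)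
  also have "(1 + 1 + 1 :: ennreal) = 3" by simp
  finally show ?thesis .
qed

section \<open>Comparison of the local energies\<close>

definition energy :: "real \<Rightarrow> (real \<Rightarrow> real) \<Rightarrow> real \<Rightarrow> (nat \<Rightarrow> real^'n::finite \<Rightarrow> complex) \<Rightarrow> nat \<Rightarrow> int^'n \<Rightarrow> ennreal" where
  "energy s w q v k m =
     (\<integral>\<^sup>+x\<in>dyadic_cube k m. (\<Sum>i. ennreal (level_weight s w q (k + i) * norm (v (k + i) x) powr q)) \<partial>lborel)"

lemma F_norm_eq:
  assumes "resolution_of_unity \<phi>" "tempered_distribution f"
  shows "F_norm s w q \<phi> f = esssup lborel (\<lambda>x. ennreal (norm (band (\<phi> 0) f x))) +
    (SUP (k, m) \<in> UNIV. ennreal_powr (energy s w q (\<lambda>j. band (\<phi> j) f) k m / emeasure lborel (dyadic_cube k m)) (1 / q))"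
proof -
  have "dist_fun (multiplier (\<phi> j) f) = band (\<phi> j) f" for j
    by (rule dist_fun_multiplier[OF bump_resolution_of_unity[OF assms(1)] assms(2) schwartz_resolution_of_unity[OF assms(1)]])
  then show ?thesis unfolding F_norm_def energy_def level_weight_def Let_def by (simp only:)
qed

lemma band_measurable:
  "tempered_distribution T \<Longrightarrow> schwartz b \<Longrightarrow> band b T \<in> borel_measurable borel"
  by (intro borel_measurable_continuous_onI band_continuous)

text \<open>The order of quantifiers is the point: one \<open>C\<close> for all \<open>f\<close>,
  \<open>j\<close> and \<open>i\<close>. The reproducing kernel is the same at every level, and
  \<open>ring_symbol \<phi> j\<close> depends only on whether \<open>j\<close> is 0, so
  \<open>D\<close> is a maximum of two constants.\<close>

lemma conv_band_powr_bound:
  fixes \<phi> \<psi> :: "nat \<Rightarrow> real^'n::finite \<Rightarrow> real"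
  assumes q: "0 < q" and \<phi>: "resolution_of_unity \<phi>" and \<psi>: "resolution_of_unity \<psi>"
  shows "\<exists>C>0. \<forall>f j i x. tempered_distribution f \<longrightarrow> i \<le> j + 1 \<longrightarrow>
    ennreal (norm (LINT t|lborel. inv_fourier (\<lambda>\<xi>. complex_of_real (ring_symbol \<phi> j \<xi>)) t * band (\<psi> i) f (x - (1/2) ^ j *\<^sub>R t)) powr q) \<le>
     ennreal C * (\<integral>\<^sup>+t. ennreal (wt L t * norm (band (\<psi> i) f (x - (1/2) ^ j *\<^sub>R t)) powr q) \<partial>lborel)"
proof -
  let ?\<kappa> = "\<lambda>j. inv_fourier (\<lambda>\<xi>. complex_of_real (ring_symbol \<phi> j \<xi>))"
  let ?\<kappa>' = "inv_fourier (\<lambda>\<xi>. complex_of_real (\<psi> 0 ((1/4) *\<^sub>R \<xi>)))"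
  have "schwartz (\<lambda>\<xi>. \<psi> 0 ((1/4) *\<^sub>R \<xi>))"
    using schwartz_affine[OF schwartz_resolution_of_unity[OF \<psi>, of 0], of "1/4" 0] by simp
  then have \<kappa>': "schwartz ?\<kappa>'" by (intro schwartz_inv_fourier schwartz_of_real)
  have \<kappa>: "schwartz (?\<kappa> j)" for j
    by (intro schwartz_inv_fourier schwartz_of_real schwartz_ring_symbol \<phi>)
  have ex: "\<forall>j. \<exists>C>0. \<forall>v r x. continuous_on UNIV v \<longrightarrow> poly_growth v \<longrightarrow> 0 < r \<longrightarrow> r \<le> 1 \<longrightarrow>
     (\<forall>x. v x = (LINT t|lborel. ?\<kappa>' t * v (x - r *\<^sub>R t))) \<longrightarrow>
     ennreal (norm (LINT t|lborel. ?\<kappa> j t * v (x - r *\<^sub>R t)) powr q) \<le>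
     ennreal C * (\<integral>\<^sup>+t. ennreal (wt L t * norm (v (x - r *\<^sub>R t)) powr q) \<partial>lborel)"
    by (rule allI, rule conv_powr_bound[OF \<kappa> \<kappa>' q, where L=L]) blast
  obtain C where C: "\<And>j. C j > 0" "\<And>j v r x. continuous_on UNIV v \<Longrightarrow> poly_growth v \<Longrightarrow> 0 < r \<Longrightarrow> r \<le> 1 \<Longrightarrow>
     (\<forall>x. v x = (LINT t|lborel. ?\<kappa>' t * v (x - r *\<^sub>R t))) \<Longrightarrow>
     ennreal (norm (LINT t|lborel. ?\<kappa> j t * v (x - r *\<^sub>R t)) powr q) \<le>
     ennreal (C j) * (\<integral>\<^sup>+t. ennreal (wt L t * norm (v (x - r *\<^sub>R t)) powr q) \<partial>lborel)"
    using choice[OF ex] by blast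
  define D where "D = max (C 0) (C 1)"
  have "ennreal (norm (LINT t|lborel. ?\<kappa> j t * band (\<psi> i) f (x - (1/2) ^ j *\<^sub>R t)) powr q) \<le>
     ennreal D * (\<integral>\<^sup>+t. ennreal (wt L t * norm (band (\<psi> i) f (x - (1/2) ^ j *\<^sub>R t)) powr q) \<partial>lborel)"
    if f: "tempered_distribution f" and ij: "i \<le> j + 1" for f j i x
  proof -
    define j' :: nat where "j' = (if j = 0 then 0 else 1)"
    have r: "ring_symbol \<phi> j = ring_symbol \<phi> j'" by (auto simp: fun_eq_iff ring_symbol_def j'_def)
    note s = schwartz_resolution_of_unity[OF \<psi>, of i]
    have pg: "poly_growth (band (\<psi> i) f)"
      using band_poly_growth[OF f s] unfolding poly_growth_def by metis
    have rep: "\<forall>x. band (\<psi> i) f x = (LINT t|lborel. ?\<kappa>' t * band (\<psi> i) f (x - (1/2) ^ j *\<^sub>R t))"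
      using band_reproduce[OF f \<psi> ij] by blast
    have "ennreal (norm (LINT t|lborel. ?\<kappa> j' t * band (\<psi> i) f (x - (1/2) ^ j *\<^sub>R t)) powr q) \<le>
     ennreal (C j') * (\<integral>\<^sup>+t. ennreal (wt L t * norm (band (\<psi> i) f (x - (1/2) ^ j *\<^sub>R t)) powr q) \<partial>lborel)"
      by (rule C(2)[OF band_continuous[OF f s] pg _ _ rep]) (simp_all add: power_le_one)
    also have "\<dots> \<le> ennreal D * (\<integral>\<^sup>+t. ennreal (wt L t * norm (band (\<psi> i) f (x - (1/2) ^ j *\<^sub>R t)) powr q) \<partial>lborel)"
      by (intro mult_right_mono ennreal_leI) (auto simp: D_def j'_def)
    finally show ?thesis unfolding r .
  qed
  moreover have "D > 0" using C(1) by (simp add: D_def less_max_iff_disj)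
  ultimately show ?thesis by blast
qed

definition neighbours :: "real \<Rightarrow> (real \<Rightarrow> real) \<Rightarrow> real \<Rightarrow> (nat \<Rightarrow> real^'n::finite \<Rightarrow> complex) \<Rightarrow> nat \<Rightarrow> real^'n \<Rightarrow> ennreal" where
  "neighbours s w q v j z = (\<Sum>i\<in>{j - 1..j + 1}. ennreal (level_weight s w q i * norm (v i z) powr q))"

lemma neighbours_measurable:
  assumes [measurable]: "\<And>i. v i \<in> borel_measurable borel"
  shows "neighbours s w q v j \<in> borel_measurable borel"
  unfolding neighbours_def[abs_def] by measurable

lemma band_level_bound:
  fixes \<phi> \<psi> :: "nat \<Rightarrow> real^'n::finite \<Rightarrow> real"
  assumes q: "0 < q" and w: "admissible w" and \<phi>: "resolution_of_unity \<phi>" and \<psi>: "resolution_of_unity \<psi>"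
  obtains K where "K > 0" "\<And>f j x. tempered_distribution f \<Longrightarrow>
    ennreal (level_weight s w q j * norm (band (\<phi> j) f x) powr q) \<le>
    ennreal K * (\<integral>\<^sup>+t. ennreal (wt L t) * neighbours s w q (\<lambda>i. band (\<psi> i) f) j (x - (1/2) ^ j *\<^sub>R t) \<partial>lborel)"
proof -
  obtain \<rho> where \<rho>: "\<rho> \<ge> 1" "\<And>i j. i \<in> {j - 1..j + 1} \<Longrightarrow> level_weight s w q j \<le> \<rho> * level_weight s w q i"
    using level_weight_ratio[OF w q] by metis
  obtain C where C: "C > 0" "\<And>f j i x. tempered_distribution f \<Longrightarrow> i \<le> j + 1 \<Longrightarrow>
    ennreal (norm (LINT t|lborel. inv_fourier (\<lambda>\<xi>. complex_of_real (ring_symbol \<phi> j \<xi>)) t * band (\<psi> i) f (x - (1/2) ^ j *\<^sub>R t)) powr q) \<le>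
     ennreal C * (\<integral>\<^sup>+t. ennreal (wt L t * norm (band (\<psi> i) f (x - (1/2) ^ j *\<^sub>R t)) powr q) \<partial>lborel)"
    using conv_band_powr_bound[OF q \<phi> \<psi>, of L] by blast
  let ?D = "level_weight s w q"
  have D0: "?D j \<ge> 0" for j using level_weight_pos[OF w, of s q j] by simp
  show ?thesis
  \<comment> \<open>The factor \<open>3 powr q\<close> comes from the power of a sum of at most
    three terms, \<open>C\<close> from each convolution, and \<open>\<rho>\<close> from replacing
    the weight of level \<open>j\<close> by that of a neighbour.\<close>
  proof (rule that[of "3 powr q * C * \<rho>"])
    show "3 powr q * C * \<rho> > 0" using C \<rho> by simp
    fix f :: "'n functional" and j :: nat and x assume f: "tempered_distribution f"
    have [measurable]: "band (\<psi> i) f \<in> borel_measurable borel" for i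
      by (intro band_measurable f schwartz_resolution_of_unity \<psi>)
    define J where "J = {j - 1..j + 1}"
    have J: "finite J" "real (card J) \<le> 3" "\<And>i. i \<in> J \<Longrightarrow> i \<le> j + 1"
      "\<And>i. i \<in> J \<Longrightarrow> ?D j \<le> \<rho> * ?D i"
      using \<rho>(2) by (auto simp: J_def)
    let ?I = "\<lambda>i. (LINT t|lborel. inv_fourier (\<lambda>\<xi>. complex_of_real (ring_symbol \<phi> j \<xi>)) t * band (\<psi> i) f (x - (1/2) ^ j *\<^sub>R t))"
    let ?v = "\<lambda>i t. norm (band (\<psi> i) f (x - (1/2) ^ j *\<^sub>R t)) powr q"
    have "norm (band (\<phi> j) f x) powr q \<le> (\<Sum>i\<in>J. norm (?I i)) powr q"
      unfolding band_decompose[OF f \<phi> \<psi>] J_def[symmetric] by (intro powr_mono2 norm_sum) (use q in auto)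
    also have "\<dots> \<le> real (card J) powr q * (\<Sum>i\<in>J. norm (?I i) powr q)"
      by (intro powr_sum_le q J) auto
    also have "\<dots> \<le> 3 powr q * (\<Sum>i\<in>J. norm (?I i) powr q)"
      by (intro mult_right_mono powr_mono2 sum_nonneg J) (use q in auto)
    finally have "?D j * norm (band (\<phi> j) f x) powr q \<le> ?D j * (3 powr q * (\<Sum>i\<in>J. norm (?I i) powr q))"
      by (rule mult_left_mono[OF _ D0])
    also have "\<dots> = (\<Sum>i\<in>J. (3 powr q * ?D j) * norm (?I i) powr q)"
      by (simp only: sum_distrib_left mult_ac)
    also have "\<dots> \<le> (\<Sum>i\<in>J. (3 powr q * (\<rho> * ?D i)) * norm (?I i) powr q)"
      by (intro sum_mono mult_right_mono mult_left_mono J) auto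
    finally have "ennreal (?D j * norm (band (\<phi> j) f x) powr q) \<le>
        ennreal (\<Sum>i\<in>J. (3 powr q * (\<rho> * ?D i)) * norm (?I i) powr q)" by (rule ennreal_leI)
    also have "\<dots> = (\<Sum>i\<in>J. ennreal ((3 powr q * (\<rho> * ?D i)) * norm (?I i) powr q))"
      using D0 \<rho>(1) by (intro sum_ennreal[symmetric]) auto
    also have "\<dots> = (\<Sum>i\<in>J. ennreal (3 powr q * (\<rho> * ?D i)) * ennreal (norm (?I i) powr q))"
      using D0 \<rho>(1) by (intro sum.cong refl ennreal_mult') auto
    also have "\<dots> \<le> (\<Sum>i\<in>J. ennreal (3 powr q * (\<rho> * ?D i)) * (ennreal C * (\<integral>\<^sup>+t. ennreal (wt L t * ?v i t) \<partial>lborel)))"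
      by (intro sum_mono mult_left_mono C f J) simp_all
    also have "\<dots> = (\<Sum>i\<in>J. ennreal (3 powr q * C * \<rho>) * (\<integral>\<^sup>+t. ennreal (wt L t) * ennreal (?D i * ?v i t) \<partial>lborel))"
    proof (intro sum.cong refl)
      fix i
      have "ennreal (3 powr q * (\<rho> * ?D i)) * (ennreal C * (\<integral>\<^sup>+t. ennreal (wt L t * ?v i t) \<partial>lborel)) =
        ennreal (3 powr q * C * \<rho>) * (ennreal (?D i) * (\<integral>\<^sup>+t. ennreal (wt L t * ?v i t) \<partial>lborel))"
        using C(1) \<rho>(1) D0[of i] by (simp add: ennreal_mult' ennreal_mult'' mult_ac)
      also have "ennreal (?D i) * (\<integral>\<^sup>+t. ennreal (wt L t * ?v i t) \<partial>lborel) =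
        (\<integral>\<^sup>+t. ennreal (?D i) * ennreal (wt L t * ?v i t) \<partial>lborel)"
        by (rule nn_integral_cmult[symmetric]) measurable
      also have "\<dots> = (\<integral>\<^sup>+t. ennreal (wt L t) * ennreal (?D i * ?v i t) \<partial>lborel)"
        using D0[of i] by (intro nn_integral_cong) (simp add: ennreal_mult' mult_ac)
      finally show "ennreal (3 powr q * (\<rho> * ?D i)) * (ennreal C * (\<integral>\<^sup>+t. ennreal (wt L t * ?v i t) \<partial>lborel)) =
        ennreal (3 powr q * C * \<rho>) * (\<integral>\<^sup>+t. ennreal (wt L t) * ennreal (?D i * ?v i t) \<partial>lborel)" .
    qed
    also have "\<dots> = ennreal (3 powr q * C * \<rho>) * (\<integral>\<^sup>+t. (\<Sum>i\<in>J. ennreal (wt L t) * ennreal (?D i * ?v i t)) \<partial>lborel)"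
      by (subst nn_integral_sum) (auto simp: sum_distrib_left)
    finally show "ennreal (?D j * norm (band (\<phi> j) f x) powr q) \<le> ennreal (3 powr q * C * \<rho>) *
      (\<integral>\<^sup>+t. ennreal (wt L t) * neighbours s w q (\<lambda>i. band (\<psi> i) f) j (x - (1/2) ^ j *\<^sub>R t) \<partial>lborel)"
      by (simp only: neighbours_def sum_distrib_left J_def)
  qed
qed

text \<open>The factor 3 counts how often a level occurs as a neighbour, and
  \<open>2 ^ CARD('n)\<close> compares the volume of a cube with that of its parent.\<close>

lemma neighbours_energy_bound:
  fixes v :: "nat \<Rightarrow> real^'n::finite \<Rightarrow> complex"
  assumes [measurable]: "\<And>i. v i \<in> borel_measurable borel" and B: "B \<ge> 0"
    and le: "\<And>k m. energy s w q v k m \<le> ennreal (B * ((1/2) ^ k) ^ CARD('n))"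
  shows "(\<integral>\<^sup>+x\<in>dyadic_cube k m. (\<Sum>i. neighbours s w q v (k + i) x) \<partial>lborel) \<le>
    ennreal (3 * 2 ^ CARD('n) * B * ((1/2) ^ k) ^ CARD('n))"
proof -
  let ?g = "\<lambda>x i. ennreal (level_weight s w q i * norm (v i x) powr q)"
  \<comment> \<open>For \<open>k = 0\<close>, truncated subtraction makes the cube its own parent,
    in agreement with level 0 having no lower neighbour.\<close>
  have parent: "\<exists>m'. dyadic_cube k m \<subseteq> dyadic_cube (k - 1) m'"
    using dyadic_cube_parent[of "k - 1" m] by (cases k) auto
  then obtain m' where m': "dyadic_cube k m \<subseteq> dyadic_cube (k - 1) m'" by blast
  have "(\<integral>\<^sup>+x\<in>dyadic_cube k m. (\<Sum>i. neighbours s w q v (k + i) x) \<partial>lborel) \<le>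
      (\<integral>\<^sup>+x. 3 * ((\<Sum>i. ?g x (k - 1 + i)) * indicator (dyadic_cube (k - 1) m') x) \<partial>lborel)"
  proof (rule nn_integral_mono)
    fix x
    have "(\<Sum>i. neighbours s w q v (k + i) x) * indicator (dyadic_cube k m) x \<le>
        (3 * (\<Sum>i. ?g x (k - 1 + i))) * indicator (dyadic_cube (k - 1) m') x"
      unfolding neighbours_def by (intro mult_mono suminf_neighbours_le) (use m' in \<open>auto simp: indicator_def\<close>)
    then show "(\<Sum>i. neighbours s w q v (k + i) x) * indicator (dyadic_cube k m) x \<le>
        3 * ((\<Sum>i. ?g x (k - 1 + i)) * indicator (dyadic_cube (k - 1) m') x)" by (simp add: mult.assoc)
  qed
  also have "\<dots> = 3 * energy s w q v (k - 1) m'"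
    unfolding energy_def by (rule nn_integral_cmult) measurable
  also have "\<dots> \<le> 3 * ennreal (B * ((1/2) ^ (k - 1)) ^ CARD('n))" by (intro mult_left_mono le) simp
  also have "\<dots> = ennreal (3 * (B * ((1/2) ^ (k - 1)) ^ CARD('n)))" by (subst ennreal_mult') auto
  also have "\<dots> \<le> ennreal (3 * 2 ^ CARD('n) * B * ((1/2) ^ k) ^ CARD('n))"
  proof (rule ennreal_leI)
    have "((1/2::real) ^ (k - 1)) ^ CARD('n) \<le> (2 * (1/2) ^ k) ^ CARD('n)"
      by (intro power_mono) (cases k; simp)+
    also have "\<dots> = 2 ^ CARD('n) * ((1/2) ^ k) ^ CARD('n)" by (rule power_mult_distrib)
    finally have "(3 * B) * ((1/2::real) ^ (k - 1)) ^ CARD('n) \<le> (3 * B) * (2 ^ CARD('n) * ((1/2) ^ k) ^ CARD('n))"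
      using B by (intro mult_left_mono) auto
    then show "3 * (B * ((1/2) ^ (k - 1)) ^ CARD('n)) \<le> 3 * 2 ^ CARD('n) * B * ((1/2) ^ k) ^ CARD('n)"
      by (simp only: mult_ac)
  qed
  finally show ?thesis .
qed

lemma dyadic_unit_cube:
  fixes x :: "real^'n::finite"
  shows "x \<in> dyadic_cube 0 (\<chi> i. \<lfloor>x $ i\<rfloor>)"
    and "y \<in> dyadic_cube 0 m \<Longrightarrow> x \<in> dyadic_cube 0 m \<Longrightarrow> norm (x - y) \<le> real CARD('n)"
proof -
  show "x \<in> dyadic_cube 0 (\<chi> i. \<lfloor>x $ i\<rfloor>)"
    by (simp add: dyadic_cube_def real_of_int_floor_add_one_gt)
  assume a: "y \<in> dyadic_cube 0 m" "x \<in> dyadic_cube 0 m"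
  have "norm (x - y) \<le> (\<Sum>i\<in>UNIV. \<bar>(x - y) $ i\<bar>)" by (rule norm_le_l1_cart)
  also have "\<dots> \<le> (\<Sum>i\<in>(UNIV::'n set). 1)"
  proof (rule sum_mono)
    fix i
    have "of_int (m $ i) \<le> x $ i" "x $ i < of_int (m $ i) + 1" "of_int (m $ i) \<le> y $ i" "y $ i < of_int (m $ i) + 1"
      using a by (simp_all add: dyadic_cube_def)
    then show "\<bar>(x - y) $ i\<bar> \<le> 1" by simp
  qed
  finally show "norm (x - y) \<le> real CARD('n)" by simp
qed

text \<open>A weighted average over all of space varies slowly: its values at two points of a unit
  cube are comparable. Thus an integral over the cube bounds it pointwise.\<close>

lemma nn_integral_wt_shift:
  fixes H :: "real^'n::finite \<Rightarrow> ennreal"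
  assumes [measurable]: "H \<in> borel_measurable borel"
  shows "(\<integral>\<^sup>+t. ennreal (wt L t) * H (x - t) \<partial>lborel) \<le>
    ennreal ((1 + norm (x - y)) ^ L) * (\<integral>\<^sup>+t. ennreal (wt L t) * H (y - t) \<partial>lborel)"
proof -
  have "(\<integral>\<^sup>+t. ennreal (wt L t) * H (x - t) \<partial>lborel) = (\<integral>\<^sup>+t. ennreal (wt L ((x - y) + t)) * H (x - ((x - y) + t)) \<partial>lborel)"
    by (rule nn_integral_shift(1)[symmetric]) measurable
  also have "\<dots> \<le> (\<integral>\<^sup>+t. ennreal ((1 + norm (x - y)) ^ L) * (ennreal (wt L t) * H (y - t)) \<partial>lborel)"
  proof (rule nn_integral_mono)
    fix t
    have shift: "x - ((x - y) + t) = y - t" by simp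
    have "ennreal (wt L ((x - y) + t)) \<le> ennreal ((1 + norm (x - y)) ^ L * wt L t)"
      using wt_shift(2)[of L t "x - y"] by (intro ennreal_leI) (simp add: add.commute)
    also have "\<dots> = ennreal ((1 + norm (x - y)) ^ L) * ennreal (wt L t)" by (rule ennreal_mult') simp
    finally have "ennreal (wt L ((x - y) + t)) * H (y - t) \<le> ennreal ((1 + norm (x - y)) ^ L) * ennreal (wt L t) * H (y - t)"
      by (rule mult_right_mono) simp
    then show "ennreal (wt L ((x - y) + t)) * H (x - ((x - y) + t)) \<le> ennreal ((1 + norm (x - y)) ^ L) * (ennreal (wt L t) * H (y - t))"
      by (simp only: mult.assoc shift)
  qed
  also have "\<dots> = ennreal ((1 + norm (x - y)) ^ L) * (\<integral>\<^sup>+t. ennreal (wt L t) * H (y - t) \<partial>lborel)"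
    by (rule nn_integral_cmult) measurable
  finally show ?thesis .
qed

text \<open>The hypothesis is a Carleson-type bound, energy at most \<open>B\<close> times volume on
  all cubes simultaneously. A single cube would not do, since the tails of the kernels reach cubes
  at every distance.\<close>

lemma energy_comparison:
  fixes \<phi> \<psi> :: "nat \<Rightarrow> real^'n::finite \<Rightarrow> real"
  assumes q: "0 < q" and w: "admissible w" and \<phi>: "resolution_of_unity \<phi>" and \<psi>: "resolution_of_unity \<psi>"
  shows "\<exists>K>0. \<forall>f B. tempered_distribution f \<longrightarrow> 0 \<le> B \<longrightarrow>
    (\<forall>k m. energy s w q (\<lambda>j. band (\<psi> j) f) k m \<le> ennreal (B * ((1/2) ^ k) ^ CARD('n))) \<longrightarrow>
    (\<forall>k m. energy s w q (\<lambda>j. band (\<phi> j) f) k m \<le> ennreal (K * B * ((1/2) ^ k) ^ CARD('n))) \<and>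
    (\<forall>x. norm (band (\<phi> 0) f x) powr q \<le> K * B)"
proof -
  let ?L = "4 * CARD('n)"
  obtain K0 where K0: "K0 > 0" "\<And>f j x. tempered_distribution f \<Longrightarrow>
    ennreal (level_weight s w q j * norm (band (\<phi> j) f x) powr q) \<le>
    ennreal K0 * (\<integral>\<^sup>+t. ennreal (wt ?L t) * neighbours s w q (\<lambda>i. band (\<psi> i) f) j (x - (1/2) ^ j *\<^sub>R t) \<partial>lborel)"
    using band_level_bound[OF q w \<phi> \<psi>] by blast
  define C where "C = 3 ^ CARD('n) * (LINT t::real^'n|lborel. wt (2 * CARD('n)) t)"
  have C: "C \<ge> 0" unfolding C_def by (intro mult_nonneg_nonneg integral_nonneg_AE) auto
  define P where "P = (1 + real CARD('n)) ^ ?L"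
  have P: "P > 0" by (simp add: P_def add_pos_nonneg)
  define K1 where "K1 = K0 * (C * (3 * 2 ^ CARD('n)))"
  \<comment> \<open>For the supremum at level 0: \<open>P\<close> compares the averages at two
    points of a unit cube, whose distance is at most the dimension, and the division removes the
    weight of level 0.\<close>
  define K2 where "K2 = P * K1 / level_weight s w q 0"
  have K1: "K1 \<ge> 0" using K0 C by (simp add: K1_def)
  have K2: "K2 \<ge> 0" using K1 P level_weight_pos[OF w, of s q 0] by (simp add: K2_def)
  define K where "K = 1 + K1 + K2"
  have K: "K > 0" using K1 K2 by (simp add: K_def)
  have main: "(\<forall>k m. energy s w q (\<lambda>j. band (\<phi> j) f) k m \<le> ennreal (K * B * ((1/2) ^ k) ^ CARD('n))) \<and>
    (\<forall>x. norm (band (\<phi> 0) f x) powr q \<le> K * B)"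
    if f: "tempered_distribution f" and B: "0 \<le> B"
      and le: "\<forall>k m. energy s w q (\<lambda>j. band (\<psi> j) f) k m \<le> ennreal (B * ((1/2) ^ k) ^ CARD('n))" for f B
  proof -
    have [measurable]: "band (\<psi> i) f \<in> borel_measurable borel" for i
      by (intro band_measurable f schwartz_resolution_of_unity \<psi>)
    let ?H = "neighbours s w q (\<lambda>i. band (\<psi> i) f)"
    have [measurable]: "?H j \<in> borel_measurable borel" for j by (rule neighbours_measurable) measurable
    define N where "N = (\<lambda>j x. \<integral>\<^sup>+t. ennreal (wt ?L t) * ?H j (x - (1/2) ^ j *\<^sub>R t) \<partial>lborel)"
    have [measurable]: "N j \<in> borel_measurable borel" for j unfolding N_def by measurable
    have NQ: "(\<integral>\<^sup>+x\<in>dyadic_cube k m. (\<Sum>i. N (k + i) x) \<partial>lborel) \<le> ennreal (C * (3 * 2 ^ CARD('n)) * B * ((1/2) ^ k) ^ CARD('n))" for k m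
    proof -
      have "(\<integral>\<^sup>+x\<in>dyadic_cube k m. (\<Sum>i. N (k + i) x) \<partial>lborel) \<le>
        ennreal C * ennreal (3 * 2 ^ CARD('n) * B * ((1/2) ^ k) ^ CARD('n))"
        unfolding N_def C_def
        by (rule nn_integral_cube_convolution[where H="\<lambda>i. ?H (k + i)"])
           (measurable, rule neighbours_energy_bound, measurable, use B le in auto)
      also have "\<dots> = ennreal (C * (3 * 2 ^ CARD('n) * B * ((1/2) ^ k) ^ CARD('n)))"
        using C by (rule ennreal_mult'[symmetric])
      finally show ?thesis by (simp only: mult.assoc)
    qed
    have point: "ennreal (level_weight s w q j * norm (band (\<phi> j) f x) powr q) \<le> ennreal K0 * N j x" for j x
      unfolding N_def by (rule K0(2)[OF f])
    have e: "energy s w q (\<lambda>j. band (\<phi> j) f) k m \<le> ennreal (K * B * ((1/2) ^ k) ^ CARD('n))" for k m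
    proof -
      have "energy s w q (\<lambda>j. band (\<phi> j) f) k m \<le>
          (\<integral>\<^sup>+x. ennreal K0 * ((\<Sum>i. N (k + i) x) * indicator (dyadic_cube k m) x) \<partial>lborel)"
        unfolding energy_def
      proof (rule nn_integral_mono)
        fix x
        have "(\<Sum>i. ennreal (level_weight s w q (k + i) * norm (band (\<phi> (k + i)) f x) powr q)) \<le> (\<Sum>i. ennreal K0 * N (k + i) x)"
          by (intro suminf_le allI point summableI)
        also have "\<dots> = ennreal K0 * (\<Sum>i. N (k + i) x)" by simp
        finally show "(\<Sum>i. ennreal (level_weight s w q (k + i) * norm (band (\<phi> (k + i)) f x) powr q)) * indicator (dyadic_cube k m) x
            \<le> ennreal K0 * ((\<Sum>i. N (k + i) x) * indicator (dyadic_cube k m) x)"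
          unfolding mult.assoc[symmetric] by (rule mult_right_mono) simp
      qed
      also have "\<dots> = ennreal K0 * (\<integral>\<^sup>+x\<in>dyadic_cube k m. (\<Sum>i. N (k + i) x) \<partial>lborel)"
        by (rule nn_integral_cmult) measurable
      also have "\<dots> \<le> ennreal K0 * ennreal (C * (3 * 2 ^ CARD('n)) * B * ((1/2) ^ k) ^ CARD('n))"
        by (intro mult_left_mono NQ) simp
      also have "\<dots> = ennreal (K0 * (C * (3 * 2 ^ CARD('n)) * B * ((1/2) ^ k) ^ CARD('n)))"
        using K0(1) by (intro ennreal_mult'[symmetric]) simp
      also have "\<dots> \<le> ennreal (K * B * ((1/2) ^ k) ^ CARD('n))"
      proof (rule ennreal_leI)
        have "K0 * (C * (3 * 2 ^ CARD('n)) * B * ((1/2) ^ k) ^ CARD('n)) = K1 * (B * ((1/2) ^ k) ^ CARD('n))"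
          by (simp add: K1_def)
        also have "\<dots> \<le> K * (B * ((1/2) ^ k) ^ CARD('n))"
          using B K2 by (intro mult_right_mono) (auto simp: K_def)
        finally show "K0 * (C * (3 * 2 ^ CARD('n)) * B * ((1/2) ^ k) ^ CARD('n)) \<le> K * B * ((1/2) ^ k) ^ CARD('n)"
          by (simp add: mult.assoc)
      qed
      finally show ?thesis .
    qed
    have p: "norm (band (\<phi> 0) f x) powr q \<le> K * B" for x
    proof -
      define m where "m = (\<chi> i. \<lfloor>x $ i\<rfloor>)"
      let ?Q = "dyadic_cube 0 m"
      have x: "x \<in> ?Q" unfolding m_def by (rule dyadic_unit_cube(1))
      \<comment> \<open>The cube has measure 1, so a constant equals its integral over it. Next, the
        constant is compared with \<open>N 0 y\<close> for each \<open>y\<close> in the cube, and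
        this is one term of the sum that \<open>NQ\<close> controls.\<close>
      have "N 0 x = (\<integral>\<^sup>+y. N 0 x * indicator ?Q y \<partial>lborel)"
        using emeasure_dyadic_cube[of 0 m] by (simp add: nn_integral_cmult_indicator)
      also have "\<dots> \<le> (\<integral>\<^sup>+y. ennreal P * ((\<Sum>i. N (0 + i) y) * indicator ?Q y) \<partial>lborel)"
      proof (rule nn_integral_mono)
        fix y
        show "N 0 x * indicator ?Q y \<le> ennreal P * ((\<Sum>i. N (0 + i) y) * indicator ?Q y)"
        proof (cases "y \<in> ?Q")
          case True
          have "N 0 x \<le> ennreal ((1 + norm (x - y)) ^ ?L) * N 0 y"
            using nn_integral_wt_shift[of "?H 0" ?L x y] by (simp add: N_def)
          also have "\<dots> \<le> ennreal P * N 0 y"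
            unfolding P_def by (intro mult_right_mono ennreal_leI power_mono add_left_mono dyadic_unit_cube(2)[OF True x]) auto
          also have "N 0 y \<le> (\<Sum>i. N (0 + i) y)"
            using sum_le_suminf[of "\<lambda>i. N (0 + i) y" "{0}"] summableI by auto
          finally show ?thesis using True by (simp add: mult_left_mono)
        qed simp
      qed
      also have "\<dots> = ennreal P * (\<integral>\<^sup>+y\<in>?Q. (\<Sum>i. N (0 + i) y) \<partial>lborel)"
        by (rule nn_integral_cmult) measurable
      also have "\<dots> \<le> ennreal P * ennreal (C * (3 * 2 ^ CARD('n)) * B * ((1/2) ^ 0) ^ CARD('n))"
        by (intro mult_left_mono NQ) simp
      also have "\<dots> = ennreal (P * (C * (3 * 2 ^ CARD('n)) * B))"
        using P by (simp add: ennreal_mult')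
      finally have "ennreal K0 * N 0 x \<le> ennreal K0 * ennreal (P * (C * (3 * 2 ^ CARD('n)) * B))"
        by (rule mult_left_mono) simp
      also have "\<dots> = ennreal (P * K1 * B)" using K0(1) by (simp add: ennreal_mult'[symmetric] K1_def mult_ac)
      finally have "ennreal (level_weight s w q 0 * norm (band (\<phi> 0) f x) powr q) \<le> ennreal (P * K1 * B)"
        using point[of 0 x] by (rule order_trans[rotated])
      then have "level_weight s w q 0 * norm (band (\<phi> 0) f x) powr q \<le> P * K1 * B"
        using P K1 B by (subst (asm) ennreal_le_iff) auto
      then have "norm (band (\<phi> 0) f x) powr q \<le> K2 * B"
        using level_weight_pos[OF w, of s q 0] by (simp add: K2_def field_simps)
      also have "\<dots> \<le> K * B" using B K1 by (intro mult_right_mono) (auto simp: K_def)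
      finally show ?thesis .
    qed
    from e p show ?thesis by blast
  qed
  show ?thesis by (rule exI[of _ K]) (use K main in blast)
qed

section \<open>From energies back to the quasi-norm\<close>

lemma ennreal_powr_divide_le:
  assumes "E \<le> ennreal (b * c)" "c > 0" "b \<ge> 0" "p > 0"
  shows "ennreal_powr (E / ennreal c) p \<le> ennreal (b powr p)"
proof -
  obtain e where e: "E = ennreal e" "e \<ge> 0"
    using assms(1) by (cases E) (auto simp: top_unique)
  have "e \<le> b * c" using assms e by (simp add: ennreal_le_iff)
  then have "e / c \<le> b" using assms by (simp add: field_simps)
  then have "(e / c) powr p \<le> b powr p" using assms e by (intro powr_mono2) auto
  then show ?thesis using assms e by (simp add: ennreal_powr_def divide_ennreal ennreal_leI)
qed

lemma ennreal_powr_divide_leD: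
  assumes "ennreal_powr (E / ennreal c) (1 / q) \<le> ennreal \<nu>" "c > 0" "\<nu> \<ge> 0" "q > 0"
  shows "E \<le> ennreal (\<nu> powr q * c)"
proof (cases E)
  case (real e)
  then have "ennreal ((e / c) powr (1 / q)) \<le> ennreal \<nu>"
    using assms by (simp add: ennreal_powr_def divide_ennreal)
  then have "(e / c) powr (1 / q) \<le> \<nu>" using assms by (simp add: ennreal_le_iff)
  then have "((e / c) powr (1 / q)) powr q \<le> \<nu> powr q" using assms by (intro powr_mono2) auto
  then have "e / c \<le> \<nu> powr q" using assms real by (simp add: powr_powr)
  then have "e \<le> \<nu> powr q * c" using assms by (simp add: field_simps)
  then show ?thesis using real by (simp add: ennreal_leI)
next
  case top
  have "E / ennreal c = top" using top assms by (simp add: ennreal_top_divide)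
  then show ?thesis using assms by (simp add: ennreal_powr_def top_unique)
qed

text \<open>If the norm for \<open>\<psi>\<close> is a finite \<open>\<nu>\<close>, its supremum
  over cubes gives the energy hypothesis with \<open>B = \<nu> powr q\<close>. Taking roots restores
  homogeneity in \<open>\<nu>\<close>.\<close>

lemma F_norm_le:
  fixes \<phi> \<psi> :: "nat \<Rightarrow> real^'n::finite \<Rightarrow> real"
  assumes q: "0 < q" and w: "admissible w" and \<phi>: "resolution_of_unity \<phi>" and \<psi>: "resolution_of_unity \<psi>"
  shows "\<exists>C>0. \<forall>f. tempered_distribution f \<longrightarrow> F_norm s w q \<phi> f \<le> ennreal C * F_norm s w q \<psi> f"
proof -
  obtain K where K: "K > 0" "\<And>f B. tempered_distribution f \<Longrightarrow> 0 \<le> B \<Longrightarrow>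
    \<forall>k m. energy s w q (\<lambda>j. band (\<psi> j) f) k m \<le> ennreal (B * ((1/2) ^ k) ^ CARD('n)) \<Longrightarrow>
    (\<forall>k m. energy s w q (\<lambda>j. band (\<phi> j) f) k m \<le> ennreal (K * B * ((1/2) ^ k) ^ CARD('n))) \<and>
    (\<forall>x. norm (band (\<phi> 0) f x) powr q \<le> K * B)"
    using energy_comparison[OF q w \<phi> \<psi>, of s] by blast
  \<comment> \<open>The factor 2 arises because the supremum of the low-frequency part and the
    supremum over cubes obey the same bound.\<close>
  define C where "C = 2 * K powr (1 / q)"
  have C: "C > 0" using K(1) by (simp add: C_def)
  have "F_norm s w q \<phi> f \<le> ennreal C * F_norm s w q \<psi> f" if f: "tempered_distribution f" for f
  proof (cases "F_norm s w q \<psi> f")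
    case top
    then show ?thesis using C by (simp add: ennreal_mult_top)
  next
    case (real \<nu>)
    define B where "B = \<nu> powr q"
    have c: "((1/2::real) ^ k) ^ CARD('n) > 0" for k by simp
    have "energy s w q (\<lambda>j. band (\<psi> j) f) k m \<le> ennreal (B * ((1/2) ^ k) ^ CARD('n))" for k m
      unfolding B_def
    proof (rule ennreal_powr_divide_leD[OF _ c real(1) q])
      have "ennreal_powr (energy s w q (\<lambda>j. band (\<psi> j) f) k m / emeasure lborel (dyadic_cube k m)) (1 / q) \<le>
        (SUP (k, m) \<in> UNIV. ennreal_powr (energy s w q (\<lambda>j. band (\<psi> j) f) k m / emeasure lborel (dyadic_cube k m)) (1 / q))"
        by (rule SUP_upper2[of "(k, m)"]) auto
      also have "\<dots> \<le> F_norm s w q \<psi> f" unfolding F_norm_eq[OF \<psi> f] by simp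
      finally show "ennreal_powr (energy s w q (\<lambda>j. band (\<psi> j) f) k m / ennreal (((1/2) ^ k) ^ CARD('n))) (1 / q) \<le> ennreal \<nu>"
        unfolding emeasure_dyadic_cube real(2) .
    qed
    then have u: "energy s w q (\<lambda>j. band (\<phi> j) f) k m \<le> ennreal (K * B * ((1/2) ^ k) ^ CARD('n))"
      "norm (band (\<phi> 0) f x) powr q \<le> K * B" for k m x
      using K(2)[OF f, of B] by (auto simp: B_def)
    have KB: "(K * B) powr (1 / q) = K powr (1 / q) * \<nu>"
      using q real(1) by (simp add: B_def powr_mult powr_powr)
    have "esssup lborel (\<lambda>x. ennreal (norm (band (\<phi> 0) f x))) \<le> ennreal (K powr (1 / q) * \<nu>)"
    proof (rule esssup_I)
      have [measurable]: "band (\<phi> 0) f \<in> borel_measurable borel"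
        by (intro band_measurable f schwartz_resolution_of_unity \<phi>)
      show "(\<lambda>x. ennreal (norm (band (\<phi> 0) f x))) \<in> borel_measurable lborel" by measurable
      show "AE x in lborel. ennreal (norm (band (\<phi> 0) f x)) \<le> ennreal (K powr (1 / q) * \<nu>)"
      proof (intro AE_I2 ennreal_leI)
        fix x
        have "(norm (band (\<phi> 0) f x) powr q) powr (1 / q) \<le> (K * B) powr (1 / q)"
          using q by (intro powr_mono2 u) auto
        then show "norm (band (\<phi> 0) f x) \<le> K powr (1 / q) * \<nu>" unfolding KB using q by (simp add: powr_powr)
      qed
    qed
    moreover have "(SUP (k, m) \<in> UNIV. ennreal_powr (energy s w q (\<lambda>j. band (\<phi> j) f) k m / emeasure lborel (dyadic_cube k m)) (1 / q))
        \<le> ennreal (K powr (1 / q) * \<nu>)"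
    proof (rule SUP_least, clarify)
      fix k m
      show "ennreal_powr (energy s w q (\<lambda>j. band (\<phi> j) f) k m / emeasure lborel (dyadic_cube k m)) (1 / q) \<le> ennreal (K powr (1 / q) * \<nu>)"
        unfolding emeasure_dyadic_cube KB[symmetric]
        by (rule ennreal_powr_divide_le[OF u(1)]) (use K(1) q in \<open>auto simp: B_def\<close>)
    qed
    ultimately have "F_norm s w q \<phi> f \<le> ennreal (K powr (1 / q) * \<nu>) + ennreal (K powr (1 / q) * \<nu>)"
      unfolding F_norm_eq[OF \<phi> f] by (rule add_mono)
    also have "\<dots> = ennreal (C * \<nu>)"
      using real(1) by (subst ennreal_plus[symmetric]) (auto simp: C_def)
    also have "\<dots> = ennreal C * F_norm s w q \<psi> f" using C real by (simp add: ennreal_mult')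
    finally show ?thesis .
  qed
  with C show ?thesis by blast
qed

theorem proposition2p10:
  fixes s q :: real
    and w :: "real \<Rightarrow> real"
    and \<phi> \<psi> :: "nat \<Rightarrow> real^'n::finite \<Rightarrow> real"
  assumes "0 < q"
    and "admissible w"
    and "resolution_of_unity \<phi>"
    and "resolution_of_unity \<psi>"
  shows "F_space s w q \<phi> = F_space s w q \<psi> \<and>
    (\<exists>c C :: real. 0 < c \<and> 0 < C \<and>
       (\<forall>f. tempered_distribution f \<longrightarrow>
          ennreal c * F_norm s w q \<psi> f \<le> F_norm s w q \<phi> f \<and>
          F_norm s w q \<phi> f \<le> ennreal C * F_norm s w q \<psi> f))"
proof -
  obtain C where C: "C > 0" "\<And>f. tempered_distribution f \<Longrightarrow> F_norm s w q \<phi> f \<le> ennreal C * F_norm s w q \<psi> f"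
    using F_norm_le[OF assms(1,2,3,4), of s] by blast
  obtain D where D: "D > 0" "\<And>f. tempered_distribution f \<Longrightarrow> F_norm s w q \<psi> f \<le> ennreal D * F_norm s w q \<phi> f"
    using F_norm_le[OF assms(1,2,4,3), of s] by blast
  have lower: "ennreal (1 / D) * F_norm s w q \<psi> f \<le> F_norm s w q \<phi> f" if "tempered_distribution f" for f
  proof -
    have "ennreal (1 / D) * F_norm s w q \<psi> f \<le> ennreal (1 / D) * (ennreal D * F_norm s w q \<phi> f)"
      by (intro mult_left_mono D that) simp
    also have "\<dots> = ennreal (1 / D * D) * F_norm s w q \<phi> f"
      using D(1) by (subst ennreal_mult') (auto simp: mult.assoc)
    finally show ?thesis using D(1) by simp
  qed
  have "F_norm s w q \<phi> f < \<infinity> \<longleftrightarrow> F_norm s w q \<psi> f < \<infinity>" if f: "tempered_distribution f" for f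
    using C(2)[OF f] D(2)[OF f] by (auto simp: ennreal_mult_less_top intro: le_less_trans)
  then have "F_space s w q \<phi> = F_space s w q \<psi>" unfolding F_space_def by blast
  moreover have "0 < 1 / D" using D(1) by simp
  ultimately show ?thesis using C lower by blast
qed

end
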